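(* Let $H:\mathbb{R}\times\mathbb{R}\to\mathbb{R}$ be continuous with $y\mapsto H(y,p)$ $\mathbb{Z}$-periodic for each $p$, $\lim_{|p|\to\infty}H(y,p)=+\infty$ uniformly in $y$, and $p\mapsto H(y,p)$ convex for each $y$. Let $g$ be bounded and Lipschitz continuous on $\mathbb{R}$. For $\varepsilon>0$ let $u^\varepsilon$ be the viscosity solution of $u^\varepsilon_t+H(x/\varepsilon,u^\varepsilon_x)=0$ in $\mathbb{R}\times(0,\infty)$, $u^\varepsilon(\cdot,0)=g$, and let $u$ be the viscosity solution of $u_t+\overline H(u_x)=0$ in $\mathbb{R}\times(0,\infty)$, $u(\cdot,0)=g$, where $\overline H$ is the effective Hamiltonian of $H$. Then there is a constant $C$ depending only on $H$ and $\|g'\|_{L^\infty(\mathbb{R})}$ such that for every $\varepsilon>0$ $$\|u^\varepsilon-u\|_{L^\infty(\mathbb{R}\times[0,\infty))}\le C\varepsilon.$$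
   Context: $\mathbb{T}=\mathbb{R}/\mathbb{Z}$. The effective Hamiltonian $\overline H:\mathbb{R}\to\mathbb{R}$: for each $p\in\mathbb{R}$, $\overline H(p)$ is the unique constant such that the cell problem $H(y,p+v')=\overline H(p)$ in $\mathbb{T}$ has a continuous ($\mathbb{Z}$-periodic) viscosity solution $v$. "The viscosity solution" of each Cauchy problem means the unique viscosity solution that is Lipschitz continuous on $\mathbb{R}\times[0,\infty)$. *)

theory Defs
  imports
    "HOL-Analysis.Analysis"
    "HOL-Library.Periodic_Fun"
    "HOL-Probability.Essential_Supremum"
begin

text \<open>First-order equations \<open>F(z, u, Du) = 0\<close> on an open set \<open>\<Omega>\<close>. The argument order of \<open>F\<close>
  is point, value, gradient; for \<open>'a = real\<close> the gradient is the ordinary derivative.\<close>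

definition C1_with_gradient ::
    "'a::euclidean_space set \<Rightarrow> ('a \<Rightarrow> real) \<Rightarrow> ('a \<Rightarrow> 'a) \<Rightarrow> bool" where
  "C1_with_gradient \<Omega> \<phi> D\<phi> \<longleftrightarrow>
     (\<forall>z\<in>\<Omega>. GDERIV \<phi> z :> D\<phi> z) \<and> continuous_on \<Omega> D\<phi>"

definition viscosity_subsolution ::
    "'a::euclidean_space set \<Rightarrow> ('a \<Rightarrow> real \<Rightarrow> 'a \<Rightarrow> real) \<Rightarrow> ('a \<Rightarrow> real) \<Rightarrow> bool" where
  "viscosity_subsolution \<Omega> F u \<longleftrightarrow>
     continuous_on \<Omega> u \<and>
     (\<forall>\<phi> D\<phi> z\<^sub>0. C1_with_gradient \<Omega> \<phi> D\<phi> \<longrightarrow> z\<^sub>0 \<in> \<Omega> \<longrightarrow>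
        (\<forall>\<^sub>F z in at z\<^sub>0. u z - \<phi> z \<le> u z\<^sub>0 - \<phi> z\<^sub>0) \<longrightarrow> F z\<^sub>0 (u z\<^sub>0) (D\<phi> z\<^sub>0) \<le> 0)"

definition viscosity_supersolution ::
    "'a::euclidean_space set \<Rightarrow> ('a \<Rightarrow> real \<Rightarrow> 'a \<Rightarrow> real) \<Rightarrow> ('a \<Rightarrow> real) \<Rightarrow> bool" where
  "viscosity_supersolution \<Omega> F u \<longleftrightarrow>
     continuous_on \<Omega> u \<and>
     (\<forall>\<phi> D\<phi> z\<^sub>0. C1_with_gradient \<Omega> \<phi> D\<phi> \<longrightarrow> z\<^sub>0 \<in> \<Omega> \<longrightarrow>
        (\<forall>\<^sub>F z in at z\<^sub>0. u z - \<phi> z \<ge> u z\<^sub>0 - \<phi> z\<^sub>0) \<longrightarrow> F z\<^sub>0 (u z\<^sub>0) (D\<phi> z\<^sub>0) \<ge> 0)"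

definition viscosity_solution ::
    "'a::euclidean_space set \<Rightarrow> ('a \<Rightarrow> real \<Rightarrow> 'a \<Rightarrow> real) \<Rightarrow> ('a \<Rightarrow> real) \<Rightarrow> bool" where
  "viscosity_solution \<Omega> F u \<longleftrightarrow>
     viscosity_subsolution \<Omega> F u \<and> viscosity_supersolution \<Omega> F u"

text \<open>Functions on \<open>\<real>/\<int>\<close> are represented as \<open>1\<close>-periodic functions on the line
  (predicate \<open>periodic_fun_simple'\<close>).\<close>

definition solves_cell_problem ::
    "(real \<Rightarrow> real \<Rightarrow> real) \<Rightarrow> real \<Rightarrow> real \<Rightarrow> (real \<Rightarrow> real) \<Rightarrow> bool" where
  "solves_cell_problem H p c v \<longleftrightarrow>
     periodic_fun_simple' v \<and> viscosity_solution UNIV (\<lambda>y r q. H y (p + q) - c) v"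

definition effective_Hamiltonian :: "(real \<Rightarrow> real \<Rightarrow> real) \<Rightarrow> real \<Rightarrow> real" where
  "effective_Hamiltonian H p = (THE c. \<exists>v. solves_cell_problem H p c v)"

text \<open>Lipschitz viscosity solutions of \<open>u\<^sub>t + G(x, u\<^sub>x) = 0\<close> in \<open>\<real> \<times> (0,\<infinity>)\<close> with initial
  datum \<open>g\<close>. Points are pairs \<open>(x, t)\<close>, gradients are pairs \<open>(u\<^sub>x, u\<^sub>t)\<close>; the values of \<open>u\<close>
  at negative times are irrelevant.\<close>

definition solves_Cauchy_problem ::
    "(real \<Rightarrow> real \<Rightarrow> real) \<Rightarrow> (real \<Rightarrow> real) \<Rightarrow> (real \<times> real \<Rightarrow> real) \<Rightarrow> bool" where
  "solves_Cauchy_problem G g u \<longleftrightarrow>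
     (\<exists>L. L-lipschitz_on (UNIV \<times> {0..}) u) \<and>
     viscosity_solution (UNIV \<times> {0<..}) (\<lambda>(x, t) r (q, \<tau>). \<tau> + G x q) u \<and>
     (\<forall>x. u (x, 0) = g x)"

text \<open>Intended also for \<open>deriv g\<close> for Lipschitz \<open>g\<close>: there \<open>deriv g\<close> is the derivative almost
  everywhere, and its unspecified values on the exceptional null set do not affect the norm.\<close>

definition Linf_norm :: "'a::euclidean_space set \<Rightarrow> ('a \<Rightarrow> real) \<Rightarrow> ereal" where
  "Linf_norm S f = esssup (lebesgue_on S) (\<lambda>x. ereal \<bar>f x\<bar>)"

end

theory Submission
  imports Defs
begin

text \<open>For \<open>c\<close> above the critical level \<open>M = max\<^sub>y min\<^sub>p H(y, p)\<close> let \<open>[p\<^sup>-(y, c), p\<^sup>+(y, c)] = {p. H(y, p) \<le> c}\<close>,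
  and let \<open>P\<^sup>\<plusminus>(c)\<close> be the averages over \<open>y\<close>. Starting from a point \<open>x\<^sub>0\<close> where \<open>min\<^sub>p H(x\<^sub>0, p) = M\<close>, the
  fundamental solution of \<open>u\<^sub>t + H(x, u\<^sub>x) = 0\<close> in one dimension is explicit: it is
  \<open>sup\<^sub>c (\<integral> p\<^sup>\<plusminus>(z, c) dz - c t)\<close>, the integral being taken from \<open>x\<^sub>0\<close> to \<open>x\<close> over \<open>p\<^sup>+\<close> to the right and
  over \<open>p\<^sup>-\<close> to the left of \<open>x\<^sub>0\<close>. Replacing \<open>p\<^sup>\<plusminus>\<close> by its average costs only \<open>O(1)\<close>, uniformly in \<open>c\<close> and \<open>t\<close>,
  and \<open>P\<^sup>\<plusminus>\<close> are the corresponding slopes of the effective Hamiltonian; so after rescaling both solutions are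
  within \<open>O(\<epsilon>)\<close> of the same Hopf--Lax formula.

  Comparison needs no doubling of variables: if \<open>H\<close> is perturbed to a strictly convex Hamiltonian and
  \<open>\<sigma> (c - M)\<^sup>2\<close> is subtracted under the supremum, the maximiser is unique, and the fundamental solution is
  \<open>C\<^sup>1\<close> for positive times, even across \<open>x\<^sub>0\<close>. It can then itself be used as a test function.\<close>

text \<open>Both solutions are compared with the inf over y of the sup over c of g(y) + cost_c(x -
  y) - c t. The upper bound holds for every y with some c, the lower bound for some y with every c;
  inserting the y of one solution into the bound for the other yields the estimate without computing
  the formula. Two restrictions shape the rest. Barriers start only where min H is the critical
  level: elsewhere the two branches on the lowest level differ and the barrier would have a kink at
  its vertex. Periodicity puts such a vertex within distance one of any point. Levels are capped at
  some C1, chosen so that the barrier is steeper than the datum; this brings the Lipschitz constant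
  of the datum into the estimate. For supersolutions the barrier runs backwards in time, with the
  Hamiltonian reflected in p. The effective Hamiltonian is a definite description, so correctors are
  constructed for all slopes; on the flat part they have kinks. The limit problem is invariant under
  rescaling, so its own error can be made arbitrarily small.\<close>

section \<open>Lipschitz functions on the line\<close>

text \<open>The Stieltjes measure of \<open>G\<close> is the push-forward of Lebesgue measure under the inverse of \<open>G\<close>; it is
  absolutely continuous because Lipschitz images of null sets are null sets.\<close>

lemma lipschitz_increasing_density:
  fixes G :: "real \<Rightarrow> real"
  assumes lip: "L-lipschitz_on UNIV G" and mono: "strict_mono G"
    and surj: "surj G"
  shows "\<exists>f. f \<in> borel_measurable borel \<and> (\<forall>a b. a \<le> b \<longrightarrow> (f has_integral (G b - G a)) {a..b})"
proof -
  have inj: "inj G" using mono by (rule strict_mono_imp_inj_on)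
  have cont: "continuous_on UNIV G" using lip by (rule lipschitz_on_continuous_on)
  have Ginv: "inv G (G x) = x" "G (inv G x) = x" for x
    using inj surj by (simp_all add: surj_f_inv_f)
  have less: "G x < G y \<longleftrightarrow> x < y" "G x \<le> G y \<longleftrightarrow> x \<le> y" for x y
    using mono by (simp_all add: strict_mono_less strict_mono_less_eq)
  have "mono (inv G)"
    by (rule monoI) (metis Ginv(2) less(2))
  then have meas: "inv G \<in> borel_measurable borel" by (rule borel_measurable_mono)
  have vimage: "inv G -` A = G ` A" for A
    using inj surj by (metis bij_def bij_vimage_eq_inv_image inv_inv_eq bij_imp_bij_inv)
  define \<nu> where "\<nu> = distr lborel borel (inv G)"
  have emeasure_\<nu>: "emeasure \<nu> A = emeasure lborel (G ` A)" if "A \<in> sets borel" for A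
    using that meas by (simp add: \<nu>_def emeasure_distr vimage)
  have ac: "absolutely_continuous lborel \<nu>"
    unfolding absolutely_continuous_def
  proof
    fix A :: "real set" assume null: "A \<in> null_sets lborel"
    then have A: "A \<in> sets borel" "emeasure lborel A = 0" by (auto simp: null_sets_def)
    have "negligible A" using null_sets_completionI[OF null] by (simp add: negligible_iff_null_sets)
    then have "negligible (G ` A)"
      by (rule negligible_locally_Lipschitz_image[OF order_refl])
        (use lipschitz_on_normD[OF lip] in \<open>metis UNIV_I open_UNIV\<close>)
    moreover have "G ` A \<in> sets borel" using measurable_sets[OF meas, of A] A(1) by (simp add: vimage)
    ultimately have "emeasure lborel (G ` A) = 0"
      by (simp add: negligible_iff_emeasure0 emeasure_completion)
    then show "A \<in> null_sets \<nu>" using A emeasure_\<nu>[of A] by (auto simp: null_sets_def \<nu>_def)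
  qed
  obtain f where f: "f \<in> borel_measurable lborel" "density lborel f = \<nu>"
    using sigma_finite_measure.Radon_Nikodym[OF sigma_finite_lborel ac]
    by (auto simp: \<nu>_def)
  have img: "G ` {a..b} = {G a..G b}" for a b
  proof
    show "G ` {a..b} \<subseteq> {G a..G b}" using less by auto
    show "{G a..G b} \<subseteq> G ` {a..b}"
    proof
      fix y assume "y \<in> {G a..G b}"
      then have "inv G y \<in> {a..b}" using less(2)[of a "inv G y"] less(2)[of "inv G y" b] Ginv by simp
      then show "y \<in> G ` {a..b}" using Ginv(2)[of y] by (metis imageI)
    qed
  qed
  have int: "(\<integral>\<^sup>+x. f x * indicator {a..b} x \<partial>lborel) = ennreal (G b - G a)" if "a \<le> b" for a b
  proof -
    have "(\<integral>\<^sup>+x. f x * indicator {a..b} x \<partial>lborel) = emeasure (density lborel f) {a..b}"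
      using f(1) by (intro emeasure_density[symmetric]) auto
    also have "\<dots> = emeasure lborel {G a..G b}" by (simp add: f(2) emeasure_\<nu> img)
    also have "\<dots> = ennreal (G b - G a)" using that less by simp
    finally show ?thesis .
  qed
  have "((\<lambda>x. enn2real (f x)) has_integral (G b - G a)) {a..b}" if ab: "a \<le> b" for a b
  proof -
    have "AE x in lborel. f x * indicator {a..b} x \<noteq> \<infinity>"
      using int[OF ab] f(1) by (intro nn_integral_PInf_AE) auto
    then have "AE x in lborel. f x * indicator {a..b} x = ennreal (enn2real (f x) * indicator {a..b} x)"
      by eventually_elim (auto split: split_indicator simp: less_top)
    then have "(\<integral>\<^sup>+x. ennreal (enn2real (f x) * indicator {a..b} x) \<partial>lborel) = ennreal (G b - G a)"
      using int[OF ab] nn_integral_cong_AE by metis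
    then have "has_bochner_integral lborel (\<lambda>x. enn2real (f x) * indicator {a..b} x) (G b - G a)"
      using f(1) ab less by (intro has_bochner_integral_nn_integral) auto
    then have "((\<lambda>x. enn2real (f x) * indicator {a..b} x) has_integral (G b - G a)) UNIV"
      using has_integral_integral_lborel[of "\<lambda>x. enn2real (f x) * indicator {a..b} x"]
      by (simp add: has_bochner_integral_iff)
    moreover have "(\<lambda>x. enn2real (f x) * indicator {a..b} x) = (\<lambda>x. if x \<in> {a..b} then enn2real (f x) else 0)"
      by auto
    ultimately show ?thesis by (simp only: has_integral_restrict_UNIV)
  qed
  moreover have "(\<lambda>x. enn2real (f x)) \<in> borel_measurable borel" using f(1) by simp
  ultimately show ?thesis by blast
qed

text \<open>Lebesgue differentiation with averages over \<open>[x, x + h]\<close>,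
  \<open>h > 0\<close>, whence a one-sided derivative; the left derivative is recovered afterwards
  by reflecting the line.\<close>

lemma right_derivative_of_indefinite_integral:
  fixes f :: "real \<Rightarrow> real"
  assumes int: "\<And>a b. a \<le> b \<Longrightarrow> (f has_integral (G b - G a)) {a..b}"
  shows "\<exists>N. negligible N \<and> (\<forall>x. x \<notin> N \<longrightarrow> (G has_real_derivative f x) (at_right x))"
proof -
  have int': "f integrable_on cbox a b" for a b
    using int[of a b] by (cases "a \<le> b") (auto simp: integrable_on_def)
  define close where "close x e \<longleftrightarrow> (\<exists>d>0. \<forall>h. 0 < h \<and> h < d \<longrightarrow>
      norm (integral (cbox x (x + h *\<^sub>R One)) f /\<^sub>R h ^ DIM(real) - f x) < e)" for x e
  have "\<exists>N. negligible N \<and> (\<forall>x e. x \<notin> N \<longrightarrow> 0 < e \<longrightarrow> close x e)"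
  proof (rule integrable_ccontinuous_explicit[of f, OF int', folded close_def])
    fix N assume "negligible N" "\<And>x e. x \<notin> N \<Longrightarrow> 0 < e \<Longrightarrow> close x e"
    then show ?thesis by (intro exI[of _ N] conjI allI impI)
  qed
  then obtain N where N: "negligible N" "\<And>x e. x \<notin> N \<Longrightarrow> 0 < e \<Longrightarrow> close x e"
    by metis
  have "(G has_real_derivative f x) (at_right x)" if x: "x \<notin> N" for x
    unfolding has_field_derivative_iff
  proof (rule tendstoI)
    fix e :: real assume "e > 0"
    then obtain d where d: "d > 0" "\<And>h. 0 < h \<Longrightarrow> h < d \<Longrightarrow> norm (integral (cbox x (x + h *\<^sub>R One)) f /\<^sub>R h ^ DIM(real) - f x) < e"
      using N(2)[OF x] unfolding close_def by metis
    have "dist ((G y - G x) / (y - x)) (f x) < e" if y: "x < y" "y < x + d" for y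
    proof -
      have "integral {x..y} f = G y - G x" using int[of x y] y by (simp add: integral_unique)
      then show ?thesis using d(2)[of "y - x"] y by (simp add: dist_real_def divide_inverse mult.commute)
    qed
    then show "\<forall>\<^sub>F y in at_right x. dist ((G y - G x) / (y - x)) (f x) < e"
      unfolding eventually_at_right[OF less_add_same_cancel1[THEN iffD2, OF d(1)]] using d(1)
      by (intro exI[of _ "x + d"]) auto
  qed
  then show ?thesis using N(1) by blast
qed

lemma lipschitz_derivative_AE:
  fixes g :: "real \<Rightarrow> real"
  assumes lip: "L-lipschitz_on UNIV g"
  shows "\<exists>f N. f \<in> borel_measurable borel \<and> negligible N \<and> (\<forall>x. x \<notin> N \<longrightarrow> DERIV g x :> f x) \<and>
     (\<forall>a b. a \<le> b \<longrightarrow> (f has_integral (g b - g a)) {a..b})"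
proof -
  have L: "0 \<le> L" using lip by (rule lipschitz_on_nonneg)
  have gL: "\<bar>g x - g y\<bar> \<le> L * \<bar>x - y\<bar>" for x y
    using lipschitz_on_normD[OF lip, of x y] by simp
  \<comment> \<open>The added slope \<open>L + 1\<close> makes all difference quotients of
    \<open>G\<close> at least one, so \<open>G\<close> is strictly increasing and onto while still
    Lipschitz.\<close>
  define G where "G x = g x + (L + 1) * x" for x
  have incr: "y - x \<le> G y - G x" if "x \<le> y" for x y
    using gL[of x y] that by (simp add: G_def algebra_simps abs_le_iff)
  have lipG: "(2 * L + 1)-lipschitz_on UNIV G"
  proof (rule lipschitz_onI)
    fix x y
    have "G x - G y = (g x - g y) + (L + 1) * (x - y)" by (simp add: G_def algebra_simps)
    also have "\<bar>\<dots>\<bar> \<le> L * \<bar>x - y\<bar> + (L + 1) * \<bar>x - y\<bar>"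
      using gL[of x y] L by (intro order.trans[OF abs_triangle_ineq] add_mono) (auto simp: abs_mult)
    finally show "dist (G x) (G y) \<le> (2 * L + 1) * dist x y" by (simp add: dist_real_def algebra_simps)
  qed (use L in simp)
  have "strict_mono G"
  proof (rule strict_monoI)
    fix x y :: real assume "x < y"
    then show "G x < G y" using incr[of x y] by simp
  qed
  moreover have "surj G"
    unfolding surj_def
  proof
    fix y
    define r where "r = \<bar>y - G 0\<bar>"
    have "G (- r) \<le> y" "y \<le> G r" using incr[of "- r" 0] incr[of 0 r] by (auto simp: r_def abs_if split: if_splits)
    moreover have "continuous_on {- r..r} G"
      using lipschitz_on_continuous_on[OF lipG] by (rule continuous_on_subset) simp
    ultimately obtain x where "G x = y" using IVT'[of G "- r" y r] by (auto simp: r_def)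
    then show "\<exists>x. y = G x" by blast
  qed
  ultimately obtain f where f: "f \<in> borel_measurable borel" "\<And>a b. a \<le> b \<Longrightarrow> (f has_integral (G b - G a)) {a..b}"
    using lipschitz_increasing_density[OF lipG] by blast
  obtain N where N: "negligible N" "\<And>x. x \<notin> N \<Longrightarrow> (G has_real_derivative f x) (at_right x)"
    using right_derivative_of_indefinite_integral[of f G, OF f(2)] by blast
  \<comment> \<open>The reflected primitive \<open>- G (- x)\<close> has density
    \<open>f (- x)\<close>; its right derivative at \<open>- x\<close> is the left derivative of
    \<open>G\<close> at \<open>x\<close>.\<close>
  have "((\<lambda>x. f (- x)) has_integral ((\<lambda>x. - G (- x)) b - (\<lambda>x. - G (- x)) a)) {a..b}" if "a \<le> b" for a b
    using f(2)[of "- b" "- a"] that has_integral_reflect_real[where f = f and a = "- b" and b = "- a"] by simp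
  from right_derivative_of_indefinite_integral[of "\<lambda>x. f (- x)" "\<lambda>x. - G (- x)", OF this]
  obtain N' where N': "negligible N'" "\<And>x. x \<notin> N' \<Longrightarrow> ((\<lambda>x. - G (- x)) has_real_derivative f (- x)) (at_right x)"
    by blast
  define N0 where "N0 = N \<union> uminus ` N'"
  have "negligible (uminus ` N')"
  proof (rule negligible_locally_Lipschitz_image[OF order_refl N'(1)])
    fix x
    have "\<forall>y\<in>N' \<inter> UNIV. norm (- y - - x) \<le> 1 * norm (y - x)" by (simp add: abs_minus_commute)
    then show "\<exists>T B. open T \<and> x \<in> T \<and> (\<forall>y\<in>N' \<inter> T. norm (- y - - x) \<le> B * norm (y - x))"
      by (intro exI[of _ UNIV] exI[of _ 1]) simp
  qed
  then have N0: "negligible N0" using N(1) by (simp add: N0_def)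
  have "DERIV g x :> f x - (L + 1)" if x: "x \<notin> N0" for x
  proof -
    have "x \<notin> N" using x by (simp add: N0_def)
    from N(2)[OF this] have right: "(G has_real_derivative f x) (at_right x)" .
    have "- x \<notin> N'"
    proof
      assume "- x \<in> N'"
      then have "- (- x) \<in> uminus ` N'" by (rule imageI)
      then show False using x by (simp add: N0_def)
    qed
    from N'(2)[OF this] have "((\<lambda>x. - G (- x)) has_real_derivative f x) (at_right (- x))" by simp
    then have "((\<lambda>y. (- G (- y) - - G x) / (y - - x)) \<longlongrightarrow> f x) (at_right (- x))"
      by (simp add: has_field_derivative_iff)
    then have "((\<lambda>y. (- G (- (- y)) - - G x) / (- y - - x)) \<longlongrightarrow> f x) (at_left x)"
      unfolding at_right_minus[of "- x"] by (simp add: filterlim_filtermap)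
    moreover have "(- G (- (- y)) - - G x) / (- y - - x) = (G y - G x) / (y - x)" for y
      by (simp add: divide_simps) (simp add: algebra_simps)
    ultimately have left: "(G has_real_derivative f x) (at_left x)"
      by (simp add: has_field_derivative_iff)
    have "DERIV G x :> f x"
      using left right by (simp add: has_field_derivative_iff filterlim_at_split)
    then have "DERIV (\<lambda>x. G x - (L + 1) * x) x :> f x - (L + 1)"
      by (auto intro!: derivative_eq_intros)
    then show ?thesis by (simp add: G_def)
  qed
  moreover have "((\<lambda>x. f x - (L + 1)) has_integral (g b - g a)) {a..b}" if "a \<le> b" for a b
  proof -
    have "((\<lambda>x. f x - (L + 1)) has_integral (G b - G a - (b - a) * (L + 1))) {a..b}"
      using f(2)[OF that] has_integral_const_real[of "L + 1" a b] that by (intro has_integral_diff) auto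
    then show ?thesis by (simp add: G_def algebra_simps)
  qed
  moreover have "(\<lambda>x. f x - (L + 1)) \<in> borel_measurable borel" using f(1) by simp
  ultimately show ?thesis using N0 by blast
qed

text \<open>Absolute continuity does the work: \<open>g\<close> is the integral of its a.e.
  derivative, so an essential bound on the derivative is a Lipschitz constant. This lets the final
  constant depend on the norm rather than on some unspecified Lipschitz constant.\<close>

lemma Linf_norm_deriv_lipschitz:
  fixes g :: "real \<Rightarrow> real"
  assumes lip: "L-lipschitz_on UNIV g"
  shows "\<exists>m\<ge>0. Linf_norm UNIV (deriv g) = ereal m \<and> m-lipschitz_on UNIV g"
proof -
  obtain f N where f: "f \<in> borel_measurable borel" "negligible N" "\<And>x. x \<notin> N \<Longrightarrow> DERIV g x :> f x"
    "\<And>a b. a \<le> b \<Longrightarrow> (f has_integral (g b - g a)) {a..b}"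
    using lipschitz_derivative_AE[OF lip] by blast
  have AE_N: "AE x in lebesgue. x \<notin> N"
    using f(2) by (simp add: negligible_iff_null_sets AE_not_in)
  then have ae: "AE x in lebesgue. f x = deriv g x"
    by eventually_elim (metis DERIV_imp_deriv f(3))
  \<comment> \<open>Measurability matters here: \<open>esssup\<close> of a non-measurable function
    is the top value.\<close>
  have "f \<in> borel_measurable lebesgue" using measurable_completion[of f lborel borel] f(1) by simp
  then have "deriv g \<in> borel_measurable lebesgue" using ae by (rule borel_measurable_AE)
  then have meas: "(\<lambda>x. ereal \<bar>deriv g x\<bar>) \<in> borel_measurable lebesgue" by measurable
  have Linf: "Linf_norm UNIV (deriv g) = esssup lebesgue (\<lambda>x. ereal \<bar>deriv g x\<bar>)"
    by (simp add: Linf_norm_def lebesgue_on_UNIV_eq)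
  have "\<bar>deriv g x\<bar> \<le> L" if "x \<notin> N" for x
  proof -
    have "((\<lambda>y. \<bar>(g y - g x) / (y - x)\<bar>) \<longlongrightarrow> \<bar>f x\<bar>) (at x)"
      using f(3)[OF that] by (intro tendsto_rabs) (simp add: has_field_derivative_iff)
    moreover have "\<bar>(g y - g x) / (y - x)\<bar> \<le> L" if "y \<noteq> x" for y
      using lipschitz_on_normD[OF lip, of y x] that by (simp add: abs_divide pos_divide_le_eq)
    then have "\<forall>\<^sub>F y in at x. \<bar>(g y - g x) / (y - x)\<bar> \<le> L" by (simp add: eventually_at_filter)
    ultimately have "\<bar>f x\<bar> \<le> L" using tendsto_upperbound trivial_limit_at by blast
    then show ?thesis using f(3)[OF that] by (simp add: DERIV_imp_deriv)
  qed
  then have "AE x in lebesgue. ereal \<bar>deriv g x\<bar> \<le> ereal L"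
    using AE_N by (auto elim: eventually_mono)
  then have upper: "Linf_norm UNIV (deriv g) \<le> ereal L" unfolding Linf using meas by (intro esssup_I)
  have "esssup lebesgue (\<lambda>x::real. ereal 0) \<le> Linf_norm UNIV (deriv g)"
    unfolding Linf by (rule esssup_mono) auto
  then have lower: "0 \<le> Linf_norm UNIV (deriv g)"
    by (subst (asm) esssup_const) (auto simp: zero_ereal_def)
  obtain m where m: "Linf_norm UNIV (deriv g) = ereal m"
    using upper lower by (cases "Linf_norm UNIV (deriv g)") auto
  have m0: "0 \<le> m" using lower m by simp
  have "AE x in lebesgue. ereal \<bar>deriv g x\<bar> \<le> ereal m"
    using esssup_AE[of "\<lambda>x. ereal \<bar>deriv g x\<bar>" lebesgue] by (simp add: m[symmetric] Linf)
  with ae have "AE x in lebesgue. \<bar>f x\<bar> \<le> m" by eventually_elim simp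
  then obtain N2 where N2: "negligible N2" "\<And>x. x \<notin> N2 \<Longrightarrow> \<bar>f x\<bar> \<le> m"
    by (auto simp: eventually_ae_filter negligible_iff_null_sets)
  have bound: "\<bar>g b - g a\<bar> \<le> m * (b - a)" if "a \<le> b" for a b
  proof -
    define f' where "f' x = (if x \<in> N2 then 0 else f x)" for x
    have "(f' has_integral (g b - g a)) {a..b}"
      by (rule has_integral_spike[OF N2(1) _ f(4)[OF that]]) (simp add: f'_def)
    moreover have "norm (f' x) \<le> m" for x using N2(2) m0 by (simp add: f'_def)
    ultimately have "norm (g b - g a) \<le> m * measure lborel {a..b}"
      using m0 by (intro has_integral_bound_real[where S = "{}" and f = f']) auto
    then show ?thesis using that by simp
  qed
  have "m-lipschitz_on UNIV g"
  proof (rule lipschitz_on_leI[OF _ m0])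
    fix x y :: real assume "x \<le> y"
    then show "dist (g x) (g y) \<le> m * dist x y"
      using bound[of x y] by (simp add: dist_real_def abs_minus_commute)
  qed
  with m m0 show ?thesis by blast
qed


section \<open>Sublevel sets of a convex Hamiltonian\<close>

definition upper_slope :: "(real \<Rightarrow> real) \<Rightarrow> real \<Rightarrow> real" where
  "upper_slope h c = Sup {p. h p \<le> c}"

text \<open>The left end of the sublevel set, encoded through the reflected function so that its
  properties follow from those of \<open>upper_slope\<close> by \<open>p\<close> \<mapsto>
  \<open>- p\<close>.\<close>

definition lower_slope :: "(real \<Rightarrow> real) \<Rightarrow> real \<Rightarrow> real" where
  "lower_slope h c = - upper_slope (\<lambda>p. h (- p)) c"

text \<open>This number is the max-min level; it turns out to be the minimum of the effective
  Hamiltonian as well.\<close>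

definition critical_level :: "(real \<Rightarrow> real \<Rightarrow> real) \<Rightarrow> real" where
  "critical_level H = Inf {c. \<forall>y. \<exists>p. H y p \<le> c}"

lemma convex_on_UNIV_max:
  fixes h :: "real \<Rightarrow> real"
  assumes "convex_on UNIV h" "a \<le> x" "x \<le> b"
  shows "h x \<le> max (h a) (h b)"
proof (cases "a = b")
  case False
  define t where "t = (x - a) / (b - a)"
  have t: "0 \<le> t" "t \<le> 1" using assms False by (auto simp: t_def)
  have "t * (b - a) = x - a" using assms False by (simp add: t_def)
  then have x: "x = (1 - t) *\<^sub>R a + t *\<^sub>R b" by (simp add: algebra_simps)
  have "h x \<le> (1 - t) * h a + t * h b"
    unfolding x using t by (intro convex_onD[OF assms(1)]) auto
  also have "\<dots> \<le> (1 - t) * max (h a) (h b) + t * max (h a) (h b)"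
    using t by (intro add_mono mult_left_mono) auto
  finally show ?thesis by (simp add: algebra_simps)
qed (use assms in auto)

lemma convex_on_UNIV_less:
  fixes h :: "real \<Rightarrow> real"
  assumes "convex_on UNIV h" "a < x" "x \<le> b" "h a < c" "h b \<le> c" "x < b"
  shows "h x < c"
proof -
  define t where "t = (x - a) / (b - a)"
  have t: "0 \<le> t" "t < 1" using assms by (auto simp: t_def)
  have "t * (b - a) = x - a" using assms by (simp add: t_def)
  then have x: "x = (1 - t) *\<^sub>R a + t *\<^sub>R b" by (simp add: algebra_simps)
  have "h x \<le> (1 - t) * h a + t * h b"
    unfolding x using t by (intro convex_onD[OF assms(1)]) auto
  also have "\<dots> < (1 - t) * c + t * c"
    using t assms by (intro add_less_le_mono mult_strict_left_mono mult_left_mono) auto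
  finally show ?thesis by (simp add: algebra_simps)
qed

locale convex_Hamiltonian =
  fixes H :: "real \<Rightarrow> real \<Rightarrow> real"
  assumes continuous_H: "continuous_on UNIV (\<lambda>(y, p). H y p)"
    and periodic_H: "H (y + 1) p = H y p"
    and coercive_H: "\<exists>R. \<forall>y p. R \<le> \<bar>p\<bar> \<longrightarrow> N \<le> H y p"
    and convex_H: "convex_on UNIV (H y)"
begin

abbreviation "U y c \<equiv> upper_slope (H y) c"
abbreviation "D y c \<equiv> lower_slope (H y) c"
abbreviation "M \<equiv> critical_level H"

text \<open>Transfers facts about the upper branch to the lower one. The reflected Hamiltonian also
  drives the barrier for supersolutions, where time runs backwards.\<close>

lemma reflected: "convex_Hamiltonian (\<lambda>y p. H y (- p))"
proof
  show "continuous_on UNIV (\<lambda>(y, p). H y (- p))"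
  proof -
    have "continuous_on UNIV ((\<lambda>(y, p). H y p) \<circ> (\<lambda>z::real \<times> real. (fst z, - snd z)))"
      by (intro continuous_on_compose continuous_intros continuous_on_subset[OF continuous_H]) auto
    then show ?thesis by (simp add: o_def case_prod_beta)
  qed
  show "\<exists>R. \<forall>y p. R \<le> \<bar>p\<bar> \<longrightarrow> N \<le> H y (- p)" for N
    using coercive_H[of N] by (metis abs_minus_cancel)
  show "convex_on UNIV (\<lambda>p. H y (- p))" for y
  proof (rule convex_onI)
    fix t x z :: real assume t: "0 < t" "t < 1"
    have "H y ((1 - t) *\<^sub>R (- x) + t *\<^sub>R (- z)) \<le> (1 - t) * H y (- x) + t * H y (- z)"
      using t by (intro convex_onD[OF convex_H]) auto
    then show "H y (- ((1 - t) *\<^sub>R x + t *\<^sub>R z)) \<le> (1 - t) * H y (- x) + t * H y (- z)"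
      by (simp add: algebra_simps)
  qed simp
qed (simp add: periodic_H)

lemma critical_level_reflected: "critical_level (\<lambda>y p. H y (- p)) = M"
proof -
  have "(\<exists>p. H y (- p) \<le> c) \<longleftrightarrow> (\<exists>p. H y p \<le> c)" for y c
    by (metis minus_minus)
  then show ?thesis by (simp add: critical_level_def)
qed

lemma continuous_at_H:
  assumes "(f \<longlongrightarrow> a) F" "(g \<longlongrightarrow> b) F"
  shows "((\<lambda>x. H (f x) (g x)) \<longlongrightarrow> H a b) F"
proof -
  have "isCont (\<lambda>(y, p). H y p) (a, b)"
    using continuous_H by (simp add: continuous_on_eq_continuous_at)
  then have "((\<lambda>x. (\<lambda>(y, p). H y p) (f x, g x)) \<longlongrightarrow> (\<lambda>(y, p). H y p) (a, b)) F"
    by (rule isCont_tendsto_compose) (intro tendsto_Pair assms)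
  then show ?thesis by simp
qed

lemma continuous_on_H [continuous_intros]:
  assumes "continuous_on S f" "continuous_on S g"
  shows "continuous_on S (\<lambda>x. H (f x) (g x))"
  using assms unfolding continuous_on_def by (auto intro: continuous_at_H)

lemma periodic_int: "H (y + of_int n) p = H y p"
proof -
  interpret periodic_fun_simple' "\<lambda>y. H y p"
    by (rule periodic_fun_simple'.intro) (rule periodic_H)
  show ?thesis by (rule plus_of_int)
qed

lemma frac_H: "H (frac y) p = H y p"
  using periodic_int[of "frac y" "\<lfloor>y\<rfloor>" p] by (simp add: frac_def)

lemma bounded_H: "\<exists>N. \<forall>y p. \<bar>p\<bar> \<le> R \<longrightarrow> \<bar>H y p\<bar> \<le> N"
proof -
  have "compact ((\<lambda>(y, p). H y p) ` ({0..1} \<times> {-R..R}))"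
    by (intro compact_continuous_image continuous_on_subset[OF continuous_H] compact_Times) auto
  then obtain N where N: "\<And>z. z \<in> {0..1} \<times> {-R..R} \<Longrightarrow> \<bar>(\<lambda>(y, p). H y p) z\<bar> \<le> N"
    unfolding bounded_iff by (metis compact_imp_bounded bounded_iff image_eqI real_norm_def)
  have "\<bar>H y p\<bar> \<le> N" if "\<bar>p\<bar> \<le> R" for y p
  proof -
    have "(frac y, p) \<in> {0..1} \<times> {-R..R}"
      using that frac_lt_1[of y] frac_ge_0[of y] by auto
    from N[OF this] show ?thesis by (simp add: frac_H)
  qed
  then show ?thesis by blast
qed

text \<open>Along a ray from \<open>0\<close> a convex function grows at least with the slope of an
  earlier chord: outside a radius \<open>R\<close> at which \<open>H\<close> exceeds its values at
  \<open>p = 0\<close> by one, that slope is \<open>1 / R\<close>, uniformly in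
  \<open>y\<close>.\<close>

lemma linear_growth: "\<exists>a b. a > 0 \<and> (\<forall>y p. a * \<bar>p\<bar> - b \<le> H y p)"
proof -
  obtain N where N: "\<And>y p. \<bar>p\<bar> \<le> 0 \<Longrightarrow> \<bar>H y p\<bar> \<le> N" using bounded_H by metis
  obtain R' where R': "\<And>y p. R' \<le> \<bar>p\<bar> \<Longrightarrow> N + 1 \<le> H y p" using coercive_H by metis
  define R where "R = max R' 1"
  have R: "R > 0" "\<And>y p. R \<le> \<bar>p\<bar> \<Longrightarrow> N + 1 \<le> H y p" using R' by (auto simp: R_def)
  obtain N' where N': "\<And>y p. \<bar>p\<bar> \<le> R \<Longrightarrow> \<bar>H y p\<bar> \<le> N'" using bounded_H by metis
  have "1 / R * \<bar>p\<bar> - (\<bar>N\<bar> + \<bar>N'\<bar> + 1) \<le> H y p" for y p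
  proof (cases "\<bar>p\<bar> \<le> R")
    case True
    then have "1 / R * \<bar>p\<bar> \<le> 1" using R by simp
    then show ?thesis using N'[OF True, of y] by linarith
  next
    case False
    define t where "t = R / \<bar>p\<bar>"
    have t: "0 < t" "t \<le> 1" using R False by (auto simp: t_def)
    have "H y ((1 - t) *\<^sub>R 0 + t *\<^sub>R p) \<le> (1 - t) * H y 0 + t * H y p"
      using t by (intro convex_onD[OF convex_H]) auto
    moreover have "N + 1 \<le> H y ((1 - t) *\<^sub>R 0 + t *\<^sub>R p)"
      using R False by (intro R(2)) (auto simp: t_def abs_mult)
    moreover have "H y 0 \<le> N" "- N \<le> H y 0" using N[of 0 y] by auto
    ultimately have "N + 1 \<le> H y 0 + t * (H y p - H y 0)" by (simp add: algebra_simps)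
    then have "1 \<le> t * (H y p - H y 0)" using \<open>H y 0 \<le> N\<close> by simp
    then have "1 / t \<le> H y p - H y 0" using t by (simp add: field_simps)
    moreover have "1 / t = 1 / R * \<bar>p\<bar>" using R False by (simp add: t_def)
    ultimately show ?thesis using \<open>- N \<le> H y 0\<close> by linarith
  qed
  then show ?thesis using R by (meson divide_pos_pos zero_less_one)
qed

lemma bounded_sublevel: "\<exists>R. \<forall>y p. H y p \<le> c \<longrightarrow> \<bar>p\<bar> \<le> R"
  using coercive_H[of "c + 1"] by (metis add_le_same_cancel1 dual_order.trans linorder_linear not_one_le_zero)

lemma sublevel_bdd_above: "bdd_above {p. H y p \<le> c}"
  using bounded_sublevel[of c] by (auto simp: bdd_above_def abs_le_iff)

lemma critical_set_bdd_below: "bdd_below {c. \<forall>y. \<exists>p. H y p \<le> c}"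
proof -
  obtain a b where ab: "a > 0" "\<And>y p. a * \<bar>p\<bar> - b \<le> H y p" using linear_growth by metis
  have lb: "- b \<le> H y p" for y p
  proof -
    have "0 \<le> a * \<bar>p\<bar>" using ab(1) by simp
    then show ?thesis using ab(2)[of p y] by linarith
  qed
  show ?thesis
  proof (rule bdd_belowI)
    fix c assume "c \<in> {c. \<forall>y. \<exists>p. H y p \<le> c}"
    then obtain p where "H 0 p \<le> c" by blast
    with lb[of 0 p] show "- b \<le> c" by linarith
  qed
qed

lemma critical_set_nonempty: "{c. \<forall>y. \<exists>p. H y p \<le> c} \<noteq> {}"
proof -
  obtain N where N: "\<And>y p. \<bar>p\<bar> \<le> 0 \<Longrightarrow> \<bar>H y p\<bar> \<le> N" using bounded_H by metis
  have "N \<in> {c. \<forall>y. \<exists>p. H y p \<le> c}"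
    using N[of 0] by (auto intro!: exI[of _ 0] simp: abs_le_iff)
  then show ?thesis by blast
qed

lemma sublevel_nonempty_gt: "c > M \<Longrightarrow> \<exists>p. H y p \<le> c"
proof -
  assume "c > M"
  then obtain c' where "\<forall>y. \<exists>p. H y p \<le> c'" "c' < c"
    unfolding critical_level_def using cInf_lessD[OF critical_set_nonempty] by blast
  then show ?thesis by (meson less_imp_le order.trans)
qed

text \<open>The infimum defining \<open>M\<close> is attained: coercivity keeps points of slightly
  higher sublevel sets in a compact interval.\<close>

lemma sublevel_nonempty:
  assumes "M \<le> c" shows "\<exists>p. H y p \<le> c"
proof -
  have "\<exists>p. H y p \<le> c + 1 / (real n + 1)" for n
  proof (rule sublevel_nonempty_gt)
    have "0 < 1 / (real n + 1)" by simp
    then show "M < c + 1 / (real n + 1)" using assms by linarith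
  qed
  then obtain p where p: "\<And>n. H y (p n) \<le> c + 1 / (real n + 1)" by metis
  have p': "H y (p n) \<le> c + 1" for n by (rule order_trans[OF p]) simp
  obtain R where "\<And>q. H y q \<le> c + 1 \<Longrightarrow> \<bar>q\<bar> \<le> R" using bounded_sublevel by metis
  then have "p n \<in> {-R..R}" for n using p'[of n] by (metis abs_le_iff atLeastAtMost_iff minus_le_iff)
  then obtain l r where l: "strict_mono r" "(p \<circ> r) \<longlonglongrightarrow> l"
    using seq_compactE[OF compact_imp_seq_compact[OF compact_Icc]] by blast
  have "(\<lambda>n. H y ((p \<circ> r) n)) \<longlonglongrightarrow> H y l" using l by (intro continuous_at_H tendsto_const)
  moreover have "(\<lambda>n. c + 1 / (real (r n) + 1)) \<longlonglongrightarrow> c + 0"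
    using LIMSEQ_subseq_LIMSEQ[OF LIMSEQ_inverse_real_of_nat l(1)]
    by (intro tendsto_add tendsto_const) (simp add: o_def inverse_eq_divide add.commute)
  ultimately have "H y l \<le> c + 0"
    using p by (intro LIMSEQ_le) (auto simp: o_def)
  then show ?thesis by auto
qed

lemma critical_le: "(\<And>y. \<exists>p. H y p \<le> c) \<Longrightarrow> M \<le> c"
  unfolding critical_level_def by (intro cInf_lower critical_set_bdd_below) auto

text \<open>Supplies the vertices of the barriers. Points whose minimum is almost \<open>M\<close>
  are moved into \<open>[0, 1]\<close> by periodicity, and a subsequence converges.\<close>

lemma critical_point: "\<exists>y. \<forall>p. M \<le> H y p"
proof -
  have "\<exists>y. \<forall>p. M - 1 / (real n + 1) \<le> H y p" for n
  proof (rule ccontr)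
    assume "\<nexists>y. \<forall>p. M - 1 / (real n + 1) \<le> H y p"
    then have "M \<le> M - 1 / (real n + 1)" by (intro critical_le) (metis linear)
    then show False by (simp add: field_simps)
  qed
  then obtain y' where y': "\<And>n p. M - 1 / (real n + 1) \<le> H (y' n) p" by metis
  define y where "y n = frac (y' n)" for n
  have y: "M - 1 / (real n + 1) \<le> H (y n) p" for n p using y' by (simp add: y_def frac_H)
  have "y n \<in> {0..1}" for n by (simp add: y_def frac_lt_1 less_imp_le)
  then obtain l r where l: "strict_mono r" "(y \<circ> r) \<longlonglongrightarrow> l"
    using seq_compactE[OF compact_imp_seq_compact[OF compact_Icc]] by blast
  have "M - 0 \<le> H l p" for p
  proof (rule LIMSEQ_le)
    show "(\<lambda>n. M - 1 / (real (r n) + 1)) \<longlonglongrightarrow> M - 0"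
      using LIMSEQ_subseq_LIMSEQ[OF LIMSEQ_inverse_real_of_nat l(1)]
      by (intro tendsto_diff tendsto_const) (simp add: o_def inverse_eq_divide add.commute)
    show "(\<lambda>n. H ((y \<circ> r) n) p) \<longlonglongrightarrow> H l p" using l by (intro continuous_at_H tendsto_const)
  qed (use y in auto)
  then show ?thesis by auto
qed

lemma slope_le_U: "H y p \<le> c \<Longrightarrow> p \<le> U y c"
  unfolding upper_slope_def by (intro cSup_upper sublevel_bdd_above) auto

lemma H_U: assumes "M \<le> c" shows "H y (U y c) = c"
proof -
  have cl: "closed {p. H y p \<le> c}" by (intro closed_Collect_le continuous_intros)
  have "U y c \<in> {p. H y p \<le> c}"
    unfolding upper_slope_def using sublevel_nonempty[OF assms]
    by (intro closed_contains_Sup cl sublevel_bdd_above) auto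
  then have le: "H y (U y c) \<le> c" by simp
  have "\<not> H y (U y c) < c"
  proof
    assume "H y (U y c) < c"
    moreover have "((\<lambda>p. H y p) \<longlongrightarrow> H y (U y c)) (at_right (U y c))"
      by (intro continuous_at_H tendsto_intros)
    ultimately have "\<forall>\<^sub>F p in at_right (U y c). H y p < c" by (auto simp: order_tendsto_iff)
    moreover have "\<forall>\<^sub>F p in at_right (U y c). U y c < p" by (simp add: eventually_at_filter)
    ultimately have "\<forall>\<^sub>F p in at_right (U y c). False"
    proof eventually_elim
      case (elim p)
      then show False using slope_le_U[of y p c] by simp
    qed
    then show False by simp
  qed
  with le show ?thesis by simp
qed

lemma D_le_slope: "H y p \<le> c \<Longrightarrow> D y c \<le> p"
  using convex_Hamiltonian.slope_le_U[OF reflected, of y "-p" c] by (simp add: lower_slope_def)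

lemma H_D: "M \<le> c \<Longrightarrow> H y (D y c) = c"
  using convex_Hamiltonian.H_U[OF reflected, of c y]
  by (simp add: lower_slope_def critical_level_reflected)

lemma D_le_U: "M \<le> c \<Longrightarrow> D y c \<le> U y c"
  using H_U[of c y] D_le_slope by auto

lemma sublevel_iff: "M \<le> c \<Longrightarrow> H y p \<le> c \<longleftrightarrow> D y c \<le> p \<and> p \<le> U y c"
  using slope_le_U[of y p c] D_le_slope[of y p c] H_U[of c y] H_D[of c y]
    convex_on_UNIV_max[OF convex_H[of y], of "D y c" p "U y c"] by linarith

lemma U_mono: "M \<le> c \<Longrightarrow> c \<le> c' \<Longrightarrow> U y c \<le> U y c'"
  using H_U[of c y] by (intro slope_le_U) simp

lemma D_antimono: "M \<le> c \<Longrightarrow> c \<le> c' \<Longrightarrow> D y c' \<le> D y c"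
  using H_D[of c y] by (intro D_le_slope) simp

lemma U_periodic: "U (y + 1) c = U y c" by (simp add: upper_slope_def periodic_H)
lemma D_periodic: "D (y + 1) c = D y c" by (simp add: lower_slope_def upper_slope_def periodic_H)

text \<open>The epigraph of \<open>H y\<close> is convex, and \<open>U y\<close> is its right
  boundary seen as a function of the level.\<close>

lemma U_concave:
  assumes "M \<le> c" "M \<le> c'" "0 \<le> t" "t \<le> 1"
  shows "(1 - t) * U y c + t * U y c' \<le> U y ((1 - t) * c + t * c')"
proof (rule slope_le_U)
  have "H y ((1 - t) *\<^sub>R U y c + t *\<^sub>R U y c') \<le> (1 - t) * H y (U y c) + t * H y (U y c')"
    using assms by (intro convex_onD[OF convex_H]) auto
  then show "H y ((1 - t) * U y c + t * U y c') \<le> (1 - t) * c + t * c'"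
    using assms by (simp add: H_U)
qed

lemma D_convex:
  assumes "M \<le> c" "M \<le> c'" "0 \<le> t" "t \<le> 1"
  shows "D y ((1 - t) * c + t * c') \<le> (1 - t) * D y c + t * D y c'"
  using convex_Hamiltonian.U_concave[OF reflected, of c c' t y] assms
  by (simp add: lower_slope_def critical_level_reflected algebra_simps)

text \<open>If \<open>U\<close> jumped up by \<open>e\<close>, convexity would bound nearby values
  of \<open>H\<close> at \<open>U y c + e\<close> by a level \<open>d\<close> just above
  \<open>c\<close>, although they exceed \<open>d\<close>. The argument covers the critical level,
  where \<open>U\<close> can be discontinuous.\<close>

lemma U_upper_semicontinuous:
  assumes "M \<le> c" "e > 0"
  shows "\<forall>\<^sub>F z in at (y, c) within UNIV \<times> {M..}. U (fst z) (snd z) < U y c + e"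
proof -
  let ?F = "at (y, c) within UNIV \<times> {M..}"
  define p1 where "p1 = U y c + e"
  have "c < H y p1" using slope_le_U[of y p1 c] assms by (force simp: p1_def)
  then obtain d where d: "c < d" "d < H y p1" using dense by blast
  have lim: "(fst \<longlongrightarrow> y) ?F" "(snd \<longlongrightarrow> c) ?F"
    by (auto intro!: tendsto_eq_intros)
  have "\<forall>\<^sub>F z in ?F. d < H (fst z) p1"
    using continuous_at_H[OF lim(1) tendsto_const[of p1]] d(2) by (auto simp: order_tendsto_iff)
  moreover have "\<forall>\<^sub>F z in ?F. H (fst z) (U y c) < d"
    using continuous_at_H[OF lim(1) tendsto_const[of "U y c"]] d(1) assms(1)
    by (auto simp: order_tendsto_iff H_U)
  moreover have "\<forall>\<^sub>F z in ?F. snd z < d"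
    using lim(2) d(1) by (auto simp: order_tendsto_iff)
  moreover have "\<forall>\<^sub>F z in ?F. M \<le> snd z" by (simp add: eventually_at_filter mem_Times_iff)
  ultimately show ?thesis
  proof eventually_elim
    case (elim z)
    show ?case
    proof (rule ccontr)
      assume "\<not> ?thesis"
      then have "H (fst z) p1 \<le> max (H (fst z) (U y c)) (H (fst z) (U (fst z) (snd z)))"
        using assms by (intro convex_on_UNIV_max[OF convex_H]) (auto simp: p1_def)
      then show False using elim by (simp add: H_U)
    qed
  qed
qed

lemma D_lower_semicontinuous:
  assumes "M \<le> c" "e > 0"
  shows "\<forall>\<^sub>F z in at (y, c) within UNIV \<times> {M..}. D y c - e < D (fst z) (snd z)"
  using convex_Hamiltonian.U_upper_semicontinuous[OF reflected, of c e y] assms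
  by (simp add: lower_slope_def critical_level_reflected algebra_simps)

text \<open>The issue is lower semicontinuity. If \<open>H y\<close> takes a value below
  \<open>c\<close>, it does so at slopes arbitrarily close to \<open>U y c\<close>, and this is
  stable under perturbation of \<open>y\<close> and \<open>c\<close>. If the sublevel set is a
  single point, \<open>D\<close> is lower semicontinuous there and pushes \<open>U\<close> from
  below.\<close>

lemma U_continuous:
  assumes "M \<le> c" "(\<exists>q. H y q < c) \<or> U y c = D y c"
  shows "((\<lambda>z. U (fst z) (snd z)) \<longlongrightarrow> U y c) (at (y, c) within UNIV \<times> {M..})"
proof -
  let ?F = "at (y, c) within UNIV \<times> {M..}"
  have "\<forall>\<^sub>F z in ?F. U y c - e < U (fst z) (snd z)" if e: "e > 0" for e
  proof (cases "\<exists>q. H y q < c")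
    case True
    then obtain q where q: "H y q < c" by blast
    then have "q \<noteq> U y c" "q \<le> U y c" using slope_le_U[of y q c] H_U[OF assms(1), of y] by auto
    define r where "r = max (U y c - e / 2) ((q + U y c) / 2)"
    have r: "q < r" "r < U y c" "U y c - e < r"
      using \<open>q \<noteq> U y c\<close> \<open>q \<le> U y c\<close> e by (auto simp: r_def less_max_iff_disj)
    have "H y r < c"
      using r q H_U[OF assms(1), of y] by (intro convex_on_UNIV_less[OF convex_H, of q r "U y c"]) auto
    then obtain d where d: "H y r < d" "d < c" using dense by blast
    have lim: "(fst \<longlongrightarrow> y) ?F" "(snd \<longlongrightarrow> c) ?F"
      by (auto intro!: tendsto_eq_intros)
    have "\<forall>\<^sub>F z in ?F. H (fst z) r < d"
      using continuous_at_H[OF lim(1) tendsto_const[of r]] d(1) by (auto simp: order_tendsto_iff)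
    moreover have "\<forall>\<^sub>F z in ?F. d < snd z" using lim(2) d(2) by (auto simp: order_tendsto_iff)
    ultimately show ?thesis
    proof eventually_elim
      case (elim z)
      then have "r \<le> U (fst z) (snd z)" by (intro slope_le_U) auto
      then show ?case using r by simp
    qed
  next
    case False
    then have eq: "U y c = D y c" using assms by blast
    have "\<forall>\<^sub>F z in ?F. M \<le> snd z" by (simp add: eventually_at_filter mem_Times_iff)
    with D_lower_semicontinuous[OF assms(1) e, of y] show ?thesis
    proof eventually_elim
      case (elim z)
      then show ?case using D_le_U[of "snd z" "fst z"] eq by simp
    qed
  qed
  note lower = this
  have upper: "\<forall>\<^sub>F z in ?F. U (fst z) (snd z) < U y c + e" if "e > 0" for e
    using U_upper_semicontinuous assms that by blast
  have "\<forall>\<^sub>F z in ?F. dist (U (fst z) (snd z)) (U y c) < e" if "e > 0" for e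
  proof -
    from lower[OF that] upper[OF that] show ?thesis
      by eventually_elim (auto simp: dist_real_def abs_less_iff)
  qed
  then show ?thesis by (rule tendstoI)
qed

lemma D_continuous:
  assumes "M \<le> c" "(\<exists>q. H y q < c) \<or> U y c = D y c"
  shows "((\<lambda>z. D (fst z) (snd z)) \<longlongrightarrow> D y c) (at (y, c) within UNIV \<times> {M..})"
proof -
  have "(\<exists>q. H y (- q) < c) \<or> upper_slope (\<lambda>p. H y (- p)) c = lower_slope (\<lambda>p. H y (- p)) c"
  proof (cases "\<exists>q. H y q < c")
    case True
    then obtain q where "H y (- (- q)) < c" by auto
    then show ?thesis by blast
  next
    case False
    then show ?thesis using assms(2) by (simp add: lower_slope_def)
  qed
  from convex_Hamiltonian.U_continuous[OF reflected, of c y] assms(1) this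
  show ?thesis by (simp add: lower_slope_def critical_level_reflected tendsto_minus)
qed

lemma gt_critical: "M < c \<Longrightarrow> \<exists>q. H y q < c"
  using sublevel_nonempty[of M y] by (meson le_less_trans order_refl)

lemma continuous_on_U_gt: "continuous_on (UNIV \<times> {M<..}) (\<lambda>z. U (fst z) (snd z))"
  (is "continuous_on _ ?u")
  unfolding continuous_on_def
proof (intro ballI)
  fix z :: "real \<times> real" assume "z \<in> UNIV \<times> {M<..}"
  then have "((\<lambda>z. U (fst z) (snd z)) \<longlongrightarrow> U (fst z) (snd z)) (at z within UNIV \<times> {M..})"
    using U_continuous[of "snd z" "fst z"] gt_critical[of "snd z" "fst z"] by auto
  then show "((\<lambda>z. U (fst z) (snd z)) \<longlongrightarrow> U (fst z) (snd z)) (at z within UNIV \<times> {M<..})"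
    by (rule tendsto_within_subset) auto
qed

lemma continuous_on_D_gt: "continuous_on (UNIV \<times> {M<..}) (\<lambda>z. D (fst z) (snd z))"
proof -
  interpret r: convex_Hamiltonian "\<lambda>y p. H y (- p)" by (rule reflected)
  show ?thesis
    using continuous_on_minus[OF r.continuous_on_U_gt] by (simp add: lower_slope_def critical_level_reflected)
qed

lemma slope_bound:
  assumes "\<And>y p. a * \<bar>p\<bar> - b \<le> H y p" "a > 0" "M \<le> c"
  shows "\<bar>U y c\<bar> \<le> (c + b) / a" "\<bar>D y c\<bar> \<le> (c + b) / a"
  using assms(1)[of "U y c" y] assms(1)[of "D y c" y] assms(2,3)
  by (simp_all add: H_U H_D field_simps)

end

section \<open>The fundamental solution\<close>

lemma integral_affine_bound:
  fixes g :: "real \<Rightarrow> real"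
  assumes "a \<le> b" "continuous_on {a..b} g" "\<And>z. z \<in> {a..b} \<Longrightarrow> \<bar>g z - q\<bar> \<le> e"
  shows "\<bar>integral {a..b} g - q * (b - a)\<bar> \<le> e * (b - a)"
proof -
  have "norm (integral {a..b} (\<lambda>z. g z - q)) \<le> e * (b - a)"
    using assms by (intro integral_bound continuous_intros) auto
  moreover have "integral {a..b} (\<lambda>z. g z - q) = integral {a..b} g - integral {a..b} (\<lambda>z. q)"
    using assms by (intro integral_diff integrable_continuous_real) auto
  ultimately show ?thesis using assms(1) by (simp add: mult.commute)
qed

text \<open>In the application \<open>Br\<close> and \<open>Bl\<close> are the upper and lower branch of \<open>H(x, \<cdot>) = c\<close>. They agree at \<open>x0\<close>
  only on the lowest level \<open>m0\<close>; this suffices for differentiability across \<open>x0\<close>, since \<open>m0\<close> is the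
  maximiser there.\<close>

locale barrier =
  fixes x0 m0 C1 \<sigma> \<Lambda> :: real and Br Bl :: "real \<Rightarrow> real \<Rightarrow> real"
  assumes levels: "m0 \<le> C1" and \<sigma>: "\<sigma> > 0"
    and Br_bound: "c \<in> {m0..C1} \<Longrightarrow> \<bar>Br x c\<bar> \<le> \<Lambda>"
    and Bl_bound: "c \<in> {m0..C1} \<Longrightarrow> \<bar>Bl x c\<bar> \<le> \<Lambda>"
    and Br_continuous: "continuous_on (UNIV \<times> {m0..C1}) (\<lambda>z. Br (fst z) (snd z))"
    and Bl_continuous: "continuous_on (UNIV \<times> {m0..C1}) (\<lambda>z. Bl (fst z) (snd z))"
    and Br_concave: "\<And>x. concave_on {m0..C1} (Br x)"
    and Bl_convex: "\<And>x. convex_on {m0..C1} (Bl x)"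
    and B_match: "Br x0 m0 = Bl x0 m0"
begin

definition "B x c = (if x0 \<le> x then Br x c else Bl x c)"

text \<open>At least one of the two intervals is empty or a point; the minus sign makes the second
  term an oriented integral from \<open>x0\<close> to \<open>x\<close>.\<close>

definition "A x c = integral {x0..x} (\<lambda>z. Br z c) - integral {x..x0} (\<lambda>z. Bl z c)"

text \<open>Without the penalty, a family of separated solutions indexed by the level, a complete
  integral. \<open>F\<close> is its upper envelope, and \<open>DF\<close> is the gradient of
  \<open>f\<close> in \<open>z\<close> with the optimal level held fixed.\<close>

definition "f z c = A (fst z) c - c * snd z - \<sigma> * (c - m0)\<^sup>2"

definition "copt z = (SOME c. c \<in> {m0..C1} \<and> (\<forall>c'\<in>{m0..C1}. f z c' \<le> f z c))"

definition "F z = f z (copt z)"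

definition "DF z = (B (fst z) (copt z), - copt z)"

lemma \<Lambda>_nonneg: "0 \<le> \<Lambda>"
  using Br_bound[of m0 0] levels by simp

lemma Br_cont_slice: "c \<in> {m0..C1} \<Longrightarrow> continuous_on S (\<lambda>x. Br x c)"
  using continuous_on_compose2[OF Br_continuous, of S "\<lambda>x. (x, c)"]
  by (force intro!: continuous_intros)

lemma Bl_cont_slice: "c \<in> {m0..C1} \<Longrightarrow> continuous_on S (\<lambda>x. Bl x c)"
  using continuous_on_compose2[OF Bl_continuous, of S "\<lambda>x. (x, c)"]
  by (force intro!: continuous_intros)

lemma A_continuous_level: "continuous_on {m0..C1} (A x)"
proof -
  have "continuous_on {m0..C1} (\<lambda>c. integral (cbox x0 x) (\<lambda>z. Br z c))"
    by (intro integral_continuous_on_param)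
       (auto simp: case_prod_beta intro!: continuous_on_compose2[OF Br_continuous, of _ "\<lambda>z. (snd z, fst z)", simplified] continuous_intros)
  moreover have "continuous_on {m0..C1} (\<lambda>c. integral (cbox x x0) (\<lambda>z. Bl z c))"
    by (intro integral_continuous_on_param)
       (auto simp: case_prod_beta intro!: continuous_on_compose2[OF Bl_continuous, of _ "\<lambda>z. (snd z, fst z)", simplified] continuous_intros)
  ultimately have "continuous_on {m0..C1} (\<lambda>c. integral {x0..x} (\<lambda>z. Br z c) - integral {x..x0} (\<lambda>z. Bl z c))"
    by (simp add: continuous_on_diff)
  then show ?thesis by (simp add: A_def[abs_def])
qed

text \<open>The slope \<open>q\<close> is arbitrary so that one estimate serves twice: with
  \<open>q = 0\<close> as a Lipschitz bound, with the slope at a point as differentiability. A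
  segment across \<open>x0\<close> uses both branches, so both have to be near
  \<open>q\<close>.\<close>

lemma A_increment_ordered:
  assumes c: "c \<in> {m0..C1}" and "x \<le> x'"
    and r: "\<And>z. x \<le> z \<Longrightarrow> z \<le> x' \<Longrightarrow> x0 \<le> z \<Longrightarrow> \<bar>Br z c - q\<bar> \<le> e"
    and l: "\<And>z. x \<le> z \<Longrightarrow> z \<le> x' \<Longrightarrow> z \<le> x0 \<Longrightarrow> \<bar>Bl z c - q\<bar> \<le> e"
  shows "\<bar>A x' c - A x c - q * (x' - x)\<bar> \<le> e * (x' - x)"
proof -
  note int = integrable_continuous_real[OF Br_cont_slice[OF c]] integrable_continuous_real[OF Bl_cont_slice[OF c]]
  consider "x0 \<le> x" | "x' \<le> x0" | "x < x0" "x0 < x'" by linarith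
  then show ?thesis
  proof cases
    case 1
    have "integral {x0..x} (\<lambda>z. Br z c) + integral {x..x'} (\<lambda>z. Br z c) = integral {x0..x'} (\<lambda>z. Br z c)"
      using 1 assms(2) int by (intro Henstock_Kurzweil_Integration.integral_combine) auto
    moreover have "integral {x..x0} (\<lambda>z. Bl z c) = 0" "integral {x'..x0} (\<lambda>z. Bl z c) = 0"
      using 1 assms(2) by (auto simp: order_le_less)
    ultimately have "A x' c - A x c = integral {x..x'} (\<lambda>z. Br z c)" by (simp add: A_def)
    then show ?thesis using integral_affine_bound[OF assms(2) Br_cont_slice[OF c], of q e] r 1 by simp
  next
    case 2
    have "integral {x..x'} (\<lambda>z. Bl z c) + integral {x'..x0} (\<lambda>z. Bl z c) = integral {x..x0} (\<lambda>z. Bl z c)"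
      using 2 assms(2) int by (intro Henstock_Kurzweil_Integration.integral_combine) auto
    moreover have "integral {x0..x} (\<lambda>z. Br z c) = 0" "integral {x0..x'} (\<lambda>z. Br z c) = 0"
      using 2 assms(2) by (auto simp: order_le_less)
    ultimately have "A x' c - A x c = integral {x..x'} (\<lambda>z. Bl z c)" by (simp add: A_def)
    then show ?thesis using integral_affine_bound[OF assms(2) Bl_cont_slice[OF c], of q e] l 2 by simp
  next
    case 3
    have "A x' c - A x c = integral {x..x0} (\<lambda>z. Bl z c) + integral {x0..x'} (\<lambda>z. Br z c)"
      using 3 by (simp add: A_def)
    moreover have "\<bar>integral {x..x0} (\<lambda>z. Bl z c) - q * (x0 - x)\<bar> \<le> e * (x0 - x)"
      using 3 l by (intro integral_affine_bound Bl_cont_slice c) auto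
    moreover have "\<bar>integral {x0..x'} (\<lambda>z. Br z c) - q * (x' - x0)\<bar> \<le> e * (x' - x0)"
      using 3 r by (intro integral_affine_bound Br_cont_slice c) auto
    ultimately show ?thesis by (simp add: algebra_simps abs_le_iff)
  qed
qed

lemma A_increment:
  assumes c: "c \<in> {m0..C1}"
    and r: "\<And>z. \<bar>z - x\<bar> \<le> \<bar>x' - x\<bar> \<Longrightarrow> x0 \<le> z \<Longrightarrow> \<bar>Br z c - q\<bar> \<le> e"
    and l: "\<And>z. \<bar>z - x\<bar> \<le> \<bar>x' - x\<bar> \<Longrightarrow> z \<le> x0 \<Longrightarrow> \<bar>Bl z c - q\<bar> \<le> e"
  shows "\<bar>A x' c - A x c - q * (x' - x)\<bar> \<le> e * \<bar>x' - x\<bar>"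
proof (cases "x \<le> x'")
  case True
  have "\<bar>A x' c - A x c - q * (x' - x)\<bar> \<le> e * (x' - x)"
    by (rule A_increment_ordered[OF c True]) (use True in \<open>auto intro!: r l\<close>)
  with True show ?thesis by simp
next
  case False
  then have *: "x' \<le> x" by simp
  have "\<bar>A x c - A x' c - q * (x - x')\<bar> \<le> e * (x - x')"
    by (rule A_increment_ordered[OF c *]) (use * in \<open>auto intro!: r l\<close>)
  moreover have "\<bar>A x c - A x' c - q * (x - x')\<bar> = \<bar>A x' c - A x c - q * (x' - x)\<bar>"
    by (subst abs_minus_commute) (simp add: algebra_simps)
  ultimately show ?thesis using False by simp
qed

lemma A_x0: "A x0 c = 0" by (simp add: A_def)

lemma A_lipschitz: "c \<in> {m0..C1} \<Longrightarrow> \<bar>A x' c - A x c\<bar> \<le> \<Lambda> * \<bar>x' - x\<bar>"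
  using A_increment[of c x x' 0 \<Lambda>] Br_bound Bl_bound by simp

lemma A_concave: "concave_on {m0..C1} (A x)"
  unfolding concave_on_def
proof (rule convex_onI)
  fix t a b :: real
  assume t: "0 < t" "t < 1" and ab: "a \<in> {m0..C1}" "b \<in> {m0..C1}"
  let ?c = "(1 - t) *\<^sub>R a + t *\<^sub>R b"
  have c: "?c \<in> {m0..C1}"
    using convexD_alt[OF convex_real_interval(5), of a m0 C1 b t] ab t by auto
  have "(1 - t) * integral {x0..x} (\<lambda>z. Br z a) + t * integral {x0..x} (\<lambda>z. Br z b)
      = integral {x0..x} (\<lambda>z. (1 - t) * Br z a + t * Br z b)"
    using ab by (subst integral_add)
      (auto intro!: integrable_continuous_real continuous_intros Br_cont_slice)
  also have "\<dots> \<le> integral {x0..x} (\<lambda>z. Br z ?c)"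
    using ab t c by (intro integral_le integrable_continuous_real continuous_intros Br_cont_slice)
      (use concave_onD[OF Br_concave, of t a b] in auto)
  finally have 1: "(1 - t) * integral {x0..x} (\<lambda>z. Br z a) + t * integral {x0..x} (\<lambda>z. Br z b)
      \<le> integral {x0..x} (\<lambda>z. Br z ?c)" .
  have "integral {x..x0} (\<lambda>z. Bl z ?c) \<le> integral {x..x0} (\<lambda>z. (1 - t) * Bl z a + t * Bl z b)"
    using ab t c by (intro integral_le integrable_continuous_real continuous_intros Bl_cont_slice)
      (use convex_onD[OF Bl_convex, of t a b] in auto)
  also have "\<dots> = (1 - t) * integral {x..x0} (\<lambda>z. Bl z a) + t * integral {x..x0} (\<lambda>z. Bl z b)"
    using ab by (subst integral_add)
      (auto intro!: integrable_continuous_real continuous_intros Bl_cont_slice)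
  finally have "(1 - t) * A x a + t * A x b \<le> A x ?c"
    using 1 unfolding A_def right_diff_distrib by linarith
  then show "- A x ?c \<le> (1 - t) * - A x a + t * - A x b" by simp
qed (rule convex_real_interval)

lemma copt: "copt z \<in> {m0..C1}" "c \<in> {m0..C1} \<Longrightarrow> f z c \<le> f z (copt z)"
proof -
  have "continuous_on {m0..C1} (f z)"
    unfolding f_def[abs_def] by (intro continuous_intros A_continuous_level)
  then obtain c0 where "c0 \<in> {m0..C1}" "\<forall>c\<in>{m0..C1}. f z c \<le> f z c0"
    using continuous_attains_sup[of "{m0..C1}" "f z"] levels by auto
  then have *: "\<exists>c. c \<in> {m0..C1} \<and> (\<forall>c'\<in>{m0..C1}. f z c' \<le> f z c)" by blast
  show "copt z \<in> {m0..C1}" "c \<in> {m0..C1} \<Longrightarrow> f z c \<le> f z (copt z)"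
    using someI_ex[OF *] unfolding copt_def by blast+
qed

text \<open>Compare the maximum with the value at the midpoint of \<open>c\<close> and the
  maximiser: \<open>A\<close> is concave, and the quadratic penalty contributes the gap.\<close>

lemma f_strongly_concave:
  assumes "c \<in> {m0..C1}"
  shows "f z c + \<sigma> / 2 * (c - copt z)\<^sup>2 \<le> f z (copt z)"
proof -
  let ?o = "copt z" and ?m = "(c + copt z) / 2"
  have m: "?m \<in> {m0..C1}" using assms copt(1)[of z] by (auto simp: field_simps)
  have "(1 - 1/2) * A (fst z) c + (1/2) * A (fst z) ?o \<le> A (fst z) ((1 - 1/2) *\<^sub>R c + (1/2) *\<^sub>R ?o)"
    using assms copt(1)[of z] by (intro concave_onD[OF A_concave]) auto
  then have "(A (fst z) c + A (fst z) ?o) / 2 \<le> A (fst z) ?m" by (simp add: field_simps)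
  moreover have "(?m - m0)\<^sup>2 = ((c - m0)\<^sup>2 + (?o - m0)\<^sup>2) / 2 - (c - ?o)\<^sup>2 / 4"
    by (simp add: power2_eq_square field_simps)
  then have "\<sigma> * (?m - m0)\<^sup>2 = (\<sigma> * (c - m0)\<^sup>2 + \<sigma> * (?o - m0)\<^sup>2) / 2 - \<sigma> * (c - ?o)\<^sup>2 / 4"
    by (simp only: right_diff_distrib distrib_left times_divide_eq_right)
  ultimately have "(f z c + f z ?o) / 2 + \<sigma> * (c - ?o)\<^sup>2 / 4 \<le> f z ?m"
    unfolding f_def by (simp add: field_simps)
  also have "\<dots> \<le> f z ?o" by (rule copt(2)[OF m])
  finally show ?thesis by (simp add: field_simps)
qed

lemma f_lipschitz:
  assumes "c \<in> {m0..C1}"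
  shows "\<bar>f z' c - f z c\<bar> \<le> (\<Lambda> + \<bar>m0\<bar> + \<bar>C1\<bar>) * dist z' z"
proof -
  have c: "\<bar>c\<bar> \<le> \<bar>m0\<bar> + \<bar>C1\<bar>" using assms by auto
  have "\<bar>f z' c - f z c\<bar> \<le> \<bar>A (fst z') c - A (fst z) c\<bar> + \<bar>c\<bar> * \<bar>snd z' - snd z\<bar>"
    unfolding f_def by (simp add: abs_mult[symmetric] algebra_simps)
  also have "\<dots> \<le> \<Lambda> * dist z' z + (\<bar>m0\<bar> + \<bar>C1\<bar>) * dist z' z"
  proof (intro add_mono mult_mono)
    show "\<bar>A (fst z') c - A (fst z) c\<bar> \<le> \<Lambda> * dist z' z"
      using A_lipschitz[OF assms, of "fst z'" "fst z"]
        mult_left_mono[OF dist_fst_le[of z' z] \<Lambda>_nonneg] by (simp add: dist_real_def)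
    show "\<bar>snd z' - snd z\<bar> \<le> dist z' z" using dist_snd_le[of z' z] by (simp add: dist_real_def)
  qed (use c in auto)
  finally show ?thesis by (simp add: algebra_simps)
qed

lemma F_lipschitz: "\<bar>F z' - F z\<bar> \<le> (\<Lambda> + \<bar>m0\<bar> + \<bar>C1\<bar>) * dist z' z"
proof -
  have "F z' - F z \<le> (\<Lambda> + \<bar>m0\<bar> + \<bar>C1\<bar>) * dist z' z" for z z'
    using f_lipschitz[OF copt(1)[of z'], of z' z] copt(2)[OF copt(1)[of z'], of z]
    by (simp add: F_def abs_le_iff)
  from this[of z' z] this[of z z'] show ?thesis by (simp add: dist_commute abs_le_iff)
qed

lemma continuous_on_F: "continuous_on S F"
proof -
  have "(\<Lambda> + \<bar>m0\<bar> + \<bar>C1\<bar>)-lipschitz_on S F"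
    using F_lipschitz \<Lambda>_nonneg by (auto intro!: lipschitz_onI simp: dist_real_def)
  then show ?thesis by (rule lipschitz_on_continuous_on)
qed

text \<open>By strong concavity the squared displacement of the maximiser is at most a multiple of
  the change of \<open>f\<close>, so \<open>copt\<close> is Hoelder continuous with exponent
  1/2.\<close>

lemma isCont_copt: "isCont copt z"
proof -
  define K where "K = 4 * (\<Lambda> + \<bar>m0\<bar> + \<bar>C1\<bar>) / \<sigma>"
  have est: "(copt z' - copt z)\<^sup>2 \<le> K * dist z' z" for z'
  proof -
    have "f z (copt z') + \<sigma> / 2 * (copt z' - copt z)\<^sup>2 \<le> f z (copt z)"
      by (rule f_strongly_concave[OF copt(1)])
    moreover have "f z' (copt z) \<le> f z' (copt z')" by (rule copt(2)[OF copt(1)])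
    ultimately have "\<sigma> / 2 * (copt z' - copt z)\<^sup>2 \<le> 2 * (\<Lambda> + \<bar>m0\<bar> + \<bar>C1\<bar>) * dist z' z"
      using f_lipschitz[OF copt(1)[of z], of z' z] f_lipschitz[OF copt(1)[of z'], of z' z]
      by linarith
    then show ?thesis using \<sigma> by (simp add: K_def field_simps)
  qed
  have "((\<lambda>z'. \<bar>copt z' - copt z\<bar>) \<longlongrightarrow> 0) (at z)"
  proof (rule tendsto_sandwich[OF always_eventually _ tendsto_const])
    show "\<forall>\<^sub>F z' in at z. \<bar>copt z' - copt z\<bar> \<le> sqrt (K * dist z' z)"
      using est by (intro always_eventually allI real_le_rsqrt) simp
    have "((\<lambda>z'. sqrt (K * dist z' z)) \<longlongrightarrow> sqrt (K * dist z z)) (at z)"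
      by (intro tendsto_intros)
    then show "((\<lambda>z'. sqrt (K * dist z' z)) \<longlongrightarrow> 0) (at z)" by simp
  qed simp
  then show ?thesis
    unfolding isCont_def using tendsto_rabs_zero_iff LIM_zero_iff by blast
qed

text \<open>At the vertex the integrals vanish and what remains decreases in the level, so the
  lowest level wins; it is the one on which the two branches agree.\<close>

lemma copt_x0: assumes "t > 0" shows "copt (x0, t) = m0"
proof (rule ccontr)
  assume "copt (x0, t) \<noteq> m0"
  then have c: "copt (x0, t) > m0" using copt(1)[of "(x0, t)"] by simp
  have "f (x0, t) m0 \<le> f (x0, t) (copt (x0, t))" using levels by (intro copt(2)) simp
  then have "copt (x0, t) * t + \<sigma> * (copt (x0, t) - m0)\<^sup>2 \<le> m0 * t"
    by (simp add: f_def A_x0)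
  moreover have "m0 * t < copt (x0, t) * t" using c assms by simp
  moreover have "0 \<le> \<sigma> * (copt (x0, t) - m0)\<^sup>2" using \<sigma> by simp
  ultimately show False by linarith
qed

text \<open>Rules out a kink of \<open>F\<close> across the vertex. Away from \<open>x0\<close> a
  small radius excludes the other branch; at \<open>x0\<close> the optimum is \<open>m0\<close>,
  where both branches have the same value.\<close>

lemma slopes_near_optimum:
  assumes "snd z > 0" "e > 0"
  shows "\<exists>d>0. \<forall>x c. \<bar>x - fst z\<bar> < d \<longrightarrow> \<bar>c - copt z\<bar> < d \<longrightarrow> c \<in> {m0..C1} \<longrightarrow>
     (x0 \<le> x \<longrightarrow> \<bar>Br x c - B (fst z) (copt z)\<bar> < e) \<and>
     (x \<le> x0 \<longrightarrow> \<bar>Bl x c - B (fst z) (copt z)\<bar> < e)"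
proof -
  let ?w = "(fst z, copt z)"
  have near: "\<exists>d>0. \<forall>x c. \<bar>x - fst z\<bar> < d \<longrightarrow> \<bar>c - copt z\<bar> < d \<longrightarrow> c \<in> {m0..C1} \<longrightarrow> \<bar>b x c - b (fst z) (copt z)\<bar> < e"
    if "continuous_on (UNIV \<times> {m0..C1}) (\<lambda>z. b (fst z) (snd z))" for b :: "real \<Rightarrow> real \<Rightarrow> real"
  proof -
    note cont = that
    have "?w \<in> UNIV \<times> {m0..C1}" using copt(1)[of z] by simp
    then obtain d where d: "d > 0" "\<And>w. w \<in> UNIV \<times> {m0..C1} \<Longrightarrow> dist w ?w < d \<Longrightarrow> dist (b (fst w) (snd w)) (b (fst z) (copt z)) < e"
      using cont assms(2) unfolding continuous_on_iff by (metis fst_conv snd_conv)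
    have "\<bar>b x c - b (fst z) (copt z)\<bar> < e"
      if "\<bar>x - fst z\<bar> < d / 2" "\<bar>c - copt z\<bar> < d / 2" "c \<in> {m0..C1}" for x c
    proof -
      have "dist (x, c) ?w \<le> \<bar>x - fst z\<bar> + \<bar>c - copt z\<bar>"
        unfolding dist_Pair_Pair dist_real_def 
        using sqrt_sum_squares_le_sum_abs[of "\<bar>x - fst z\<bar>" "\<bar>c - copt z\<bar>"] by simp
      then have "dist (x, c) ?w < d" using that by simp
      with d(2)[of "(x, c)"] that show ?thesis by (simp add: dist_real_def)
    qed
    then show ?thesis using d(1) by (intro exI[of _ "d / 2"]) auto
  qed
  obtain d1 where d1: "d1 > 0" "\<And>x c. \<bar>x - fst z\<bar> < d1 \<Longrightarrow> \<bar>c - copt z\<bar> < d1 \<Longrightarrow> c \<in> {m0..C1} \<Longrightarrow> \<bar>Br x c - Br (fst z) (copt z)\<bar> < e"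
    using near[OF Br_continuous] by blast
  obtain d2 where d2: "d2 > 0" "\<And>x c. \<bar>x - fst z\<bar> < d2 \<Longrightarrow> \<bar>c - copt z\<bar> < d2 \<Longrightarrow> c \<in> {m0..C1} \<Longrightarrow> \<bar>Bl x c - Bl (fst z) (copt z)\<bar> < e"
    using near[OF Bl_continuous] by blast
  show ?thesis
  proof (cases "fst z = x0")
    case True
    then have "z = (x0, snd z)" by (metis prod.collapse)
    then have "copt z = m0" using copt_x0[OF assms(1)] by metis
    then have "Br (fst z) (copt z) = B (fst z) (copt z)" "Bl (fst z) (copt z) = B (fst z) (copt z)"
      using True B_match by (auto simp: B_def)
    then show ?thesis using d1 d2 by (intro exI[of _ "min d1 d2"]) auto
  next
    case False
    then show ?thesis
      using d1 d2 by (intro exI[of _ "min (min d1 d2) \<bar>fst z - x0\<bar>"]) (auto simp: B_def)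
  qed
qed

text \<open>Envelope argument: the increment of \<open>F\<close> lies between the increments of
  \<open>f\<close> for the old and for the new maximiser. Both are close to the same linear map,
  since the maximiser is continuous.\<close>

lemma GDERIV_F:
  assumes "snd z > 0" shows "GDERIV F z :> DF z"
proof -
  let ?D = "\<lambda>w. inner w (DF z)"
  have "(F has_derivative ?D) (at z)"
    unfolding has_derivative_at_alt
  proof (intro conjI bounded_linear_inner_left allI impI)
    fix e :: real assume e: "e > 0"
    obtain d where d: "d > 0" "\<And>x c. \<bar>x - fst z\<bar> < d \<Longrightarrow> \<bar>c - copt z\<bar> < d \<Longrightarrow> c \<in> {m0..C1} \<Longrightarrow>
       (x0 \<le> x \<longrightarrow> \<bar>Br x c - B (fst z) (copt z)\<bar> < e / 2) \<and> (x \<le> x0 \<longrightarrow> \<bar>Bl x c - B (fst z) (copt z)\<bar> < e / 2)"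
      using slopes_near_optimum[OF assms, of "e / 2"] e by (metis half_gt_zero)
    obtain d' where d': "d' > 0" "\<And>z'. dist z' z < d' \<Longrightarrow> \<bar>copt z' - copt z\<bar> < min d (e / 2)"
      using isCont_copt[of z] d(1) e unfolding continuous_at_eps_delta
      by (metis dist_real_def half_gt_zero min_less_iff_conj)
    have "norm (F z' - F z - ?D (z' - z)) \<le> e * norm (z' - z)" if z': "norm (z' - z) < min d d'" for z'
    proof -
      define h k where "h = fst z' - fst z" and "k = snd z' - snd z"
      let ?b = "B (fst z) (copt z)"
      have hk: "\<bar>h\<bar> \<le> norm (z' - z)" "\<bar>k\<bar> \<le> norm (z' - z)"
        using norm_fst_le[of "fst z' - fst z" "snd z' - snd z"] norm_snd_le[of "snd z' - snd z" "fst z' - fst z"]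
        by (simp_all add: h_def k_def minus_prod_def)
      have D: "?D (z' - z) = ?b * h - copt z * k"
        by (simp add: DF_def h_def k_def inner_prod_def algebra_simps)
      have incr: "\<bar>f z' c - f z c - (?b * h - c * k)\<bar> \<le> e / 2 * \<bar>h\<bar>"
        if c: "c \<in> {m0..C1}" "\<bar>c - copt z\<bar> < d" for c
      proof -
        have "\<bar>A (fst z') c - A (fst z) c - ?b * (fst z' - fst z)\<bar> \<le> e / 2 * \<bar>fst z' - fst z\<bar>"
        proof (rule A_increment[OF c(1)])
          fix w assume "\<bar>w - fst z\<bar> \<le> \<bar>fst z' - fst z\<bar>"
          then have "\<bar>w - fst z\<bar> < d" using hk z' by (simp add: h_def)
          with d(2)[OF this c(2,1)] show "x0 \<le> w \<Longrightarrow> \<bar>Br w c - ?b\<bar> \<le> e / 2" "w \<le> x0 \<Longrightarrow> \<bar>Bl w c - ?b\<bar> \<le> e / 2"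
            by auto
        qed
        then show ?thesis by (simp add: f_def h_def k_def algebra_simps)
      qed
      have c': "\<bar>copt z' - copt z\<bar> < d" "\<bar>copt z' - copt z\<bar> \<le> e / 2"
        using d'(2)[of z'] z' by (auto simp: dist_norm)
      have "\<bar>(copt z' - copt z) * k\<bar> \<le> e / 2 * \<bar>k\<bar>"
        unfolding abs_mult using c' by (intro mult_right_mono) auto
      moreover have "f z (copt z') \<le> f z (copt z)" "f z' (copt z) \<le> f z' (copt z')"
        using copt by blast+
      moreover note incr[OF copt(1)[of z]] incr[OF copt(1)[of z'] c'(1)]
      moreover have "e / 2 * \<bar>h\<bar> \<le> e / 2 * norm (z' - z)" "e / 2 * \<bar>k\<bar> \<le> e / 2 * norm (z' - z)"
        using hk e by (auto intro: mult_left_mono)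
      ultimately have "\<bar>F z' - F z - (?b * h - copt z * k)\<bar> \<le> e / 2 * norm (z' - z) + e / 2 * norm (z' - z)"
        using d(1) unfolding F_def abs_le_iff left_diff_distrib diff_self abs_zero by linarith
      then show ?thesis by (simp add: D)
    qed
    then show "\<exists>d>0. \<forall>z'. norm (z' - z) < d \<longrightarrow> norm (F z' - F z - ?D (z' - z)) \<le> e * norm (z' - z)"
      using d(1) d'(1) by (intro exI[of _ "min d d'"]) auto
  qed
  then show ?thesis by (simp add: gderiv_def)
qed

lemma continuous_on_DF: "continuous_on (UNIV \<times> {0<..}) DF"
  unfolding DF_def[abs_def]
proof (intro continuous_on_Pair continuous_on_minus continuous_at_imp_continuous_on ballI isCont_copt)
  fix z :: "real \<times> real" assume "z \<in> UNIV \<times> {0<..}"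
  then have z: "snd z > 0" by (simp add: mem_Times_iff)
  show "isCont (\<lambda>z. B (fst z) (copt z)) z"
    unfolding continuous_at_eps_delta
  proof (intro allI impI)
    fix e :: real assume "e > 0"
    obtain d where d: "d > 0" "\<And>x c. \<bar>x - fst z\<bar> < d \<Longrightarrow> \<bar>c - copt z\<bar> < d \<Longrightarrow> c \<in> {m0..C1} \<Longrightarrow>
       (x0 \<le> x \<longrightarrow> \<bar>Br x c - B (fst z) (copt z)\<bar> < e) \<and> (x \<le> x0 \<longrightarrow> \<bar>Bl x c - B (fst z) (copt z)\<bar> < e)"
      using slopes_near_optimum[OF z \<open>e > 0\<close>] by metis
    obtain d' where d': "d' > 0" "\<And>z'. dist z' z < d' \<Longrightarrow> \<bar>copt z' - copt z\<bar> < d"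
      using isCont_copt[of z] d(1) unfolding continuous_at_eps_delta by (metis dist_real_def)
    have "dist (B (fst z') (copt z')) (B (fst z) (copt z)) < e" if z': "dist z' z < min d d'" for z'
    proof -
      have "\<bar>fst z' - fst z\<bar> < d" using dist_fst_le[of z' z] z' by (simp add: dist_real_def)
      from d(2)[OF this d'(2) copt(1)] z' show ?thesis by (auto simp: B_def[of "fst z'"] dist_real_def)
    qed
    then show "\<exists>d>0. \<forall>z'. dist z' z < d \<longrightarrow> dist (B (fst z') (copt z')) (B (fst z) (copt z)) < e"
      using d(1) d'(1) by (intro exI[of _ "min d d'"]) auto
  qed
qed

lemma F_ge: "c \<in> {m0..C1} \<Longrightarrow> A x c - c * t - \<sigma> * (c - m0)\<^sup>2 \<le> F (x, t)"
  unfolding F_def using copt(2)[of c "(x, t)"] by (simp add: f_def)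

lemma F_attained: "\<exists>c\<in>{m0..C1}. F (x, t) \<le> A x c - c * t"
  using copt(1)[of "(x, t)"] \<sigma> by (intro bexI[of _ "copt (x, t)"]) (auto simp: F_def f_def)

text \<open>Gives the barrier linear growth in \<open>x\<close>, so that extrema over unbounded
  strips exist and initial data of slope at most \<open>k\<close> are dominated.\<close>

lemma A_lower:
  assumes c: "c \<in> {m0..C1}" and k: "\<And>z. k \<le> Br z c" "\<And>z. Bl z c \<le> - k"
  shows "k * \<bar>x - x0\<bar> \<le> A x c"
proof (cases "x0 \<le> x")
  case True
  have "integral {x0..x} (\<lambda>z. k) \<le> integral {x0..x} (\<lambda>z. Br z c)"
    using k c by (intro integral_le integrable_continuous_real continuous_intros Br_cont_slice) auto
  moreover have "A x c = integral {x0..x} (\<lambda>z. Br z c)"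
    using True by (auto simp: A_def order_le_less)
  ultimately show ?thesis using True by (simp add: mult.commute)
next
  case False
  have "integral {x..x0} (\<lambda>z. Bl z c) \<le> integral {x..x0} (\<lambda>z. - k)"
    using k c by (intro integral_le integrable_continuous_real continuous_intros Bl_cont_slice) auto
  then show ?thesis using False by (simp add: A_def algebra_simps)
qed

end

section \<open>Viscosity solutions and the fundamental solution\<close>

lemma attains_max_if_bounded_superlevel:
  fixes \<Phi> :: "'a::euclidean_space \<Rightarrow> real"
  assumes "closed S" "continuous_on S \<Phi>" "z0 \<in> S" "bounded {z \<in> S. \<Phi> z0 \<le> \<Phi> z}"
  shows "\<exists>z\<in>S. \<forall>w\<in>S. \<Phi> w \<le> \<Phi> z"
proof -
  let ?K = "{z \<in> S. \<Phi> z0 \<le> \<Phi> z}"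
  have "closed (S \<inter> \<Phi> -` {\<Phi> z0..})"
    by (rule continuous_closed_preimage[OF assms(2,1) closed_atLeast])
  also have "S \<inter> \<Phi> -` {\<Phi> z0..} = ?K" by auto
  finally have "closed ?K" .
  then have compact: "compact ?K"
    by (rule compact_eq_bounded_closed[THEN iffD2, OF conjI[OF assms(4)]])
  have ne: "?K \<noteq> {}" using assms(3) by blast
  have cont: "continuous_on ?K \<Phi>" by (rule continuous_on_subset[OF assms(2)]) blast
  from continuous_attains_sup[OF compact ne cont] obtain z
    where z: "z \<in> ?K" "\<forall>w\<in>?K. \<Phi> w \<le> \<Phi> z" ..
  have "\<Phi> w \<le> \<Phi> z" if "w \<in> S" for w
  proof (cases "\<Phi> z0 \<le> \<Phi> w")
    case False
    then show ?thesis using z(1) by simp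
  qed (use z that in blast)
  then show ?thesis using z(1) by blast
qed

lemma bounded_rectangle_subset:
  fixes S :: "(real \<times> real) set"
  assumes "\<And>z. z \<in> S \<Longrightarrow> fst z \<in> {a..b} \<and> snd z \<in> {c..d}"
  shows "bounded S"
proof (rule bounded_subset)
  show "bounded ({a..b} \<times> {c..d})" by (intro bounded_Times bounded_closed_interval)
  show "S \<subseteq> {a..b} \<times> {c..d}" using assms by (auto simp: mem_Times_iff)
qed

lemma GDERIV_time:
  assumes "DERIV h (snd z) :> d"
  shows "GDERIV (\<lambda>z::real \<times> real. h (snd z)) z :> (0, d)"
proof -
  have "((\<lambda>z. h (snd z)) has_derivative (\<lambda>w. snd w * d)) (at z)"
    using has_derivative_compose[of snd snd z UNIV h "(*) d"] assms
    by (simp add: has_field_derivative_def has_derivative_snd mult.commute[of d])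
  then show ?thesis by (simp add: gderiv_def inner_prod_def)
qed

lemma GDERIV_compose_time:
  assumes "GDERIV \<psi> (fst z, \<rho> (snd z)) :> (a, b)" "DERIV \<rho> (snd z) :> d"
  shows "GDERIV (\<lambda>z::real \<times> real. \<psi> (fst z, \<rho> (snd z))) z :> (a, d * b)"
proof -
  have "((\<lambda>z. (fst z, \<rho> (snd z))) has_derivative (\<lambda>w. (fst w, snd w * d))) (at z)"
  proof (rule has_derivative_Pair)
    show "((\<lambda>z. \<rho> (snd z)) has_derivative (\<lambda>w. snd w * d)) (at z)"
      using GDERIV_time[OF assms(2)] by (simp add: gderiv_def inner_prod_def)
  qed (auto intro: derivative_intros)
  from has_derivative_compose[OF this, of \<psi> "\<lambda>w. inner w (a, b)"] assms(1)
  have "((\<lambda>z. \<psi> (fst z, \<rho> (snd z))) has_derivative (\<lambda>w. inner (fst w, snd w * d) (a, b))) (at z)"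
    by (simp add: gderiv_def)
  then show ?thesis by (simp add: gderiv_def inner_prod_def algebra_simps)
qed

text \<open>Test functions are required on the whole half-plane, but the time-reversed barrier is
  \<open>C1\<close> only before time \<open>T\<close>. A \<open>C1\<close> change of time that is
  the identity around \<open>t0\<close> squeezes all positive times into
  \<open>(0, T)\<close>.\<close>

lemma C1_time_extension:
  fixes \<psi> :: "real \<times> real \<Rightarrow> real"
  assumes C1: "C1_with_gradient (UNIV \<times> {0<..<T}) \<psi> D\<psi>" and t0: "0 < t0" "t0 < T"
  obtains \<phi> D\<phi> where "C1_with_gradient (UNIV \<times> {0<..}) \<phi> D\<phi>"
    and "\<And>x. D\<phi> (x, t0) = D\<psi> (x, t0)"
    and "\<And>x. \<forall>\<^sub>F z in nhds (x, t0). \<phi> z = \<psi> z"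
proof -
  define s1 \<delta> where "s1 = (t0 + T) / 2" and "\<delta> = T - s1"
  have s1: "t0 < s1" "0 < s1" "s1 < T" "\<delta> > 0" using t0 by (auto simp: s1_def \<delta>_def)
  \<comment> \<open>The identity up to \<open>s1\<close>, then a hyperbola with value
    \<open>s1\<close> and slope one at \<open>s1\<close> and with asymptote
    \<open>s1 + \<delta> = T\<close>.\<close>
  define \<rho> where "\<rho> s = (if s \<le> s1 then s else s1 + \<delta> - \<delta>\<^sup>2 / (s - s1 + \<delta>))" for s
  define \<rho>' where "\<rho>' s = (\<delta> / (max s s1 - s1 + \<delta>))\<^sup>2" for s
  have d1: "((\<lambda>s. s1 + \<delta> - \<delta>\<^sup>2 / (s - s1 + \<delta>)) has_real_derivative \<rho>' s) (at s within X)" if "s1 \<le> s" for s X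
    using s1 that by (auto intro!: derivative_eq_intros simp: \<rho>'_def power_divide power2_eq_square max_def)
  have d2: "((\<lambda>s. s) has_real_derivative \<rho>' s) (at s within X)" if "s \<le> s1" for s X
    using s1 that by (auto intro!: derivative_eq_intros simp: \<rho>'_def max_def)
  have \<rho>_deriv: "DERIV \<rho> s :> \<rho>' s" for s
  proof -
    have "((\<lambda>s. if s \<in> {..s1} then s else s1 + \<delta> - \<delta>\<^sup>2 / (s - s1 + \<delta>)) has_derivative
       (if s \<in> {..s1} then (*) (\<rho>' s) else (*) (\<rho>' s))) (at s within ({..s1} \<union> {s1..}))"
    proof (rule has_derivative_If_within_closures)
      show "s \<in> {..s1} \<union> closure {..s1} \<inter> closure {s1..} \<Longrightarrow>
        ((\<lambda>s. s) has_derivative (*) (\<rho>' s)) (at s within {..s1} \<union> closure {..s1} \<inter> closure {s1..})"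
        using d2[of s "{..s1} \<union> closure {..s1} \<inter> closure {s1..}"] by (auto simp: has_field_derivative_def mult.commute)
      show "s \<in> {s1..} \<union> closure {..s1} \<inter> closure {s1..} \<Longrightarrow>
        ((\<lambda>s. s1 + \<delta> - \<delta>\<^sup>2 / (s - s1 + \<delta>)) has_derivative (*) (\<rho>' s)) (at s within {s1..} \<union> closure {..s1} \<inter> closure {s1..})"
        using d1[of s "{s1..} \<union> closure {..s1} \<inter> closure {s1..}"] by (auto simp: has_field_derivative_def)
      have "s = s1" if "s \<in> closure {..s1} \<inter> closure {s1..}" for s using that by auto
      then show "s \<in> closure {..s1} \<Longrightarrow> s \<in> closure {s1..} \<Longrightarrow> s = s1 + \<delta> - \<delta>\<^sup>2 / (s - s1 + \<delta>)" for s
        using s1 by (auto simp: power2_eq_square)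
    qed auto
    moreover have "{..s1} \<union> {s1..} = (UNIV :: real set)" by auto
    moreover have "(\<lambda>s. if s \<in> {..s1} then s else s1 + \<delta> - \<delta>\<^sup>2 / (s - s1 + \<delta>)) = \<rho>" by (auto simp: \<rho>_def)
    ultimately show ?thesis by (simp add: has_field_derivative_def)
  qed
  have \<rho>'_cont: "continuous_on S (\<lambda>z. \<rho>' (snd z))" for S :: "(real \<times> real) set"
    unfolding \<rho>'_def using s1 by (intro continuous_intros) (auto simp: max_def)
  have \<rho>_range: "0 < \<rho> s \<and> \<rho> s < T" if "s > 0" for s
  proof (cases "s \<le> s1")
    case False
    then have "0 < \<delta>\<^sup>2 / (s - s1 + \<delta>)" "\<delta>\<^sup>2 / (s - s1 + \<delta>) < \<delta>"
      using s1 by (auto simp: power2_eq_square divide_simps)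
    then show ?thesis using s1 False by (auto simp: \<rho>_def \<delta>_def)
  qed (use that s1 in \<open>auto simp: \<rho>_def\<close>)
  have G: "GDERIV \<psi> z :> D\<psi> z" and cont: "continuous_on (UNIV \<times> {0<..<T}) D\<psi>" if "z \<in> UNIV \<times> {0<..<T}" for z
    using C1 that by (auto simp: C1_with_gradient_def)
  define \<phi> where "\<phi> z = \<psi> (fst z, \<rho> (snd z))" for z
  define D\<phi> where "D\<phi> z = (fst (D\<psi> (fst z, \<rho> (snd z))), \<rho>' (snd z) * snd (D\<psi> (fst z, \<rho> (snd z))))" for z
  show ?thesis
  proof
    show "C1_with_gradient (UNIV \<times> {0<..}) \<phi> D\<phi>"
      unfolding C1_with_gradient_def
    proof (intro conjI ballI)
      fix z :: "real \<times> real" assume "z \<in> UNIV \<times> {0<..}"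
      then have "(fst z, \<rho> (snd z)) \<in> UNIV \<times> {0<..<T}"
        using \<rho>_range[of "snd z"] by (simp add: mem_Times_iff)
      from G[OF this] show "GDERIV \<phi> z :> D\<phi> z"
        unfolding \<phi>_def D\<phi>_def by (intro GDERIV_compose_time \<rho>_deriv) simp
    next
      have "continuous_on (UNIV \<times> {0<..}) (\<lambda>z. D\<psi> (fst z, \<rho> (snd z)))"
      proof (rule continuous_on_compose2[of "UNIV \<times> {0<..<T}" D\<psi>])
        show "continuous_on (UNIV \<times> {0<..<T}) D\<psi>" using C1 by (simp add: C1_with_gradient_def)
        have "continuous_on UNIV \<rho>"
          by (rule DERIV_continuous_on) (rule \<rho>_deriv)
        then have "continuous_on (UNIV \<times> {0<..}) (\<lambda>z::real \<times> real. \<rho> (snd z))"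
          by (rule continuous_on_compose2) (auto intro: continuous_on_snd continuous_on_id)
        then show "continuous_on (UNIV \<times> {0<..}) (\<lambda>z::real \<times> real. (fst z, \<rho> (snd z)))"
          by (intro continuous_on_Pair continuous_on_fst continuous_on_id)
        show "(\<lambda>z::real \<times> real. (fst z, \<rho> (snd z))) ` (UNIV \<times> {0<..}) \<subseteq> UNIV \<times> {0<..<T}"
          by (auto simp: \<rho>_range)
      qed
      then show "continuous_on (UNIV \<times> {0<..}) D\<phi>"
        unfolding D\<phi>_def[abs_def] 
        by (intro continuous_on_Pair continuous_on_fst continuous_on_mult continuous_on_snd \<rho>'_cont)
    qed
    have "\<rho> t0 = t0" "\<rho>' t0 = 1" using s1 by (auto simp: \<rho>_def \<rho>'_def max_def)
    then show "D\<phi> (x, t0) = D\<psi> (x, t0)" for x by (simp add: D\<phi>_def)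
    show "\<forall>\<^sub>F z in nhds (x, t0). \<phi> z = \<psi> z" for x
    proof -
      have "open (UNIV \<times> {..<s1} :: (real \<times> real) set)" by (intro open_Times) auto
      moreover have "(x, t0) \<in> UNIV \<times> {..<s1}" using s1 by simp
      ultimately have "\<forall>\<^sub>F z in nhds (x, t0). z \<in> UNIV \<times> {..<s1}" by (rule eventually_nhds_in_open)
      then show ?thesis by eventually_elim (auto simp: \<phi>_def \<rho>_def mem_Times_iff)
    qed
  qed
qed

lemma supersolution_touching:
  fixes u \<psi> :: "real \<times> real \<Rightarrow> real"
  assumes super: "viscosity_supersolution (UNIV \<times> {0<..}) (\<lambda>(x, t) r (q, \<tau>). \<tau> + G x q) u"
    and C1: "C1_with_gradient (UNIV \<times> {0<..<T}) \<psi> D\<psi>" and t: "0 < t0" "t0 < T"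
    and touch: "\<And>x t. 0 < t \<Longrightarrow> t < T \<Longrightarrow> u (x, t) - \<psi> (x, t) \<ge> u (x0, t0) - \<psi> (x0, t0)"
  shows "snd (D\<psi> (x0, t0)) + G x0 (fst (D\<psi> (x0, t0))) \<ge> 0"
proof -
  obtain \<phi> D\<phi> where \<phi>: "C1_with_gradient (UNIV \<times> {0<..}) \<phi> D\<phi>"
    "\<And>x. D\<phi> (x, t0) = D\<psi> (x, t0)" "\<And>x. \<forall>\<^sub>F z in nhds (x, t0). \<phi> z = \<psi> z"
    using C1_time_extension[OF C1 t] by blast
  have "\<phi> (x0, t0) = \<psi> (x0, t0)" using \<phi>(3) by (rule eventually_nhds_x_imp_x)
  have "open (UNIV \<times> {0<..<T} :: (real \<times> real) set)" by (intro open_Times) auto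
  then have "\<forall>\<^sub>F z in nhds (x0, t0). z \<in> UNIV \<times> {0<..<T}"
    using t by (intro eventually_nhds_in_open) auto
  with \<phi>(3)[of x0] have "\<forall>\<^sub>F z in nhds (x0, t0). u z - \<phi> z \<ge> u (x0, t0) - \<phi> (x0, t0)"
  proof eventually_elim
    case (elim z)
    then show ?case using touch[of "snd z" "fst z"] \<open>\<phi> (x0, t0) = \<psi> (x0, t0)\<close> by (auto simp: mem_Times_iff)
  qed
  then have "\<forall>\<^sub>F z in at (x0, t0). u z - \<phi> z \<ge> u (x0, t0) - \<phi> (x0, t0)"
    by (auto simp: eventually_at_filter elim: eventually_mono)
  moreover have "(x0, t0) \<in> UNIV \<times> {0<..}" using t by simp
  ultimately have "(case (x0, t0) of (x, t) \<Rightarrow> \<lambda>r (q, \<tau>). \<tau> + G x q) (u (x0, t0)) (D\<phi> (x0, t0)) \<ge> 0"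
    using super \<phi>(1) unfolding viscosity_supersolution_def by blast
  then show ?thesis by (simp add: \<phi>(2) case_prod_beta)
qed

lemma subsolution_touching:
  fixes u \<phi> :: "real \<times> real \<Rightarrow> real"
  assumes sub: "viscosity_subsolution (UNIV \<times> {0<..}) (\<lambda>(x, t) r (q, \<tau>). \<tau> + G x q) u"
    and C1: "C1_with_gradient (UNIV \<times> {0<..}) \<phi> D\<phi>" and t: "0 < t0"
    and touch: "\<And>x t. 0 < t \<Longrightarrow> u (x, t) - \<phi> (x, t) \<le> u (x0, t0) - \<phi> (x0, t0)"
  shows "snd (D\<phi> (x0, t0)) + G x0 (fst (D\<phi> (x0, t0))) \<le> 0"
proof -
  have "open (UNIV \<times> {0<..} :: (real \<times> real) set)" by (intro open_Times) auto
  then have "\<forall>\<^sub>F z in at (x0, t0). z \<in> UNIV \<times> {0<..}"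
    using t by (intro eventually_at_in_open') auto
  then have "\<forall>\<^sub>F z in at (x0, t0). u z - \<phi> z \<le> u (x0, t0) - \<phi> (x0, t0)"
  proof eventually_elim
    case (elim z)
    then show ?case using touch[of "snd z" "fst z"] by (auto simp: mem_Times_iff)
  qed
  moreover have "(x0, t0) \<in> UNIV \<times> {0<..}" using t by simp
  ultimately have "(case (x0, t0) of (x, t) \<Rightarrow> \<lambda>r (q, \<tau>). \<tau> + G x q) (u (x0, t0)) (D\<phi> (x0, t0)) \<le> 0"
    using sub C1 unfolding viscosity_subsolution_def by blast
  then show ?thesis by (simp add: case_prod_beta)
qed

text \<open>The assumption says that each \<open>H y\<close> has a unique minimiser, which makes
  both slopes continuous down to the critical level.\<close>

locale strictly_convex_Hamiltonian = convex_Hamiltonian +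
  assumes strict: "p \<noteq> q \<Longrightarrow> H y p \<le> c \<Longrightarrow> H y q \<le> c \<Longrightarrow> \<exists>r. H y r < c"
begin

lemma slopes_continuous:
  shows "continuous_on (UNIV \<times> {M..C1}) (\<lambda>z. U (fst z) (snd z))"
    and "continuous_on (UNIV \<times> {M..C1}) (\<lambda>z. D (fst z) (snd z))"
proof -
  have *: "(\<exists>q. H y q < c) \<or> U y c = D y c" if "M \<le> c" for y c
    using strict[of "U y c" "D y c" y c] H_U[OF that] H_D[OF that] by auto
  show "continuous_on (UNIV \<times> {M..C1}) (\<lambda>z. U (fst z) (snd z))"
    unfolding continuous_on_def
  proof (intro ballI)
    fix z :: "real \<times> real" assume z: "z \<in> UNIV \<times> {M..C1}"
    then have "((\<lambda>z. U (fst z) (snd z)) \<longlongrightarrow> U (fst z) (snd z)) (at (fst z, snd z) within UNIV \<times> {M..})"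
      by (intro U_continuous *) auto
    then show "((\<lambda>z. U (fst z) (snd z)) \<longlongrightarrow> U (fst z) (snd z)) (at z within UNIV \<times> {M..C1})"
      by (auto elim!: tendsto_within_subset)
  qed
  show "continuous_on (UNIV \<times> {M..C1}) (\<lambda>z. D (fst z) (snd z))"
    unfolding continuous_on_def
  proof (intro ballI)
    fix z :: "real \<times> real" assume z: "z \<in> UNIV \<times> {M..C1}"
    then have "((\<lambda>z. D (fst z) (snd z)) \<longlongrightarrow> D (fst z) (snd z)) (at (fst z, snd z) within UNIV \<times> {M..})"
      by (intro D_continuous *) auto
    then show "((\<lambda>z. D (fst z) (snd z)) \<longlongrightarrow> D (fst z) (snd z)) (at z within UNIV \<times> {M..C1})"
      by (auto elim!: tendsto_within_subset)
  qed
qed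

text \<open>Since \<open>M\<close> is the minimum of \<open>H x0\<close>, uniqueness of the
  minimiser shrinks the lowest sublevel set at the vertex to a point, so the branches match
  there.\<close>

lemma barrier:
  assumes "\<And>y p. a * \<bar>p\<bar> - b \<le> H y p" "a > 0" "M \<le> C1" "\<sigma> > 0" "\<And>p. M \<le> H x0 p"
  shows "barrier x0 M C1 \<sigma> ((C1 + b) / a) (\<lambda>x c. U x c) (\<lambda>x c. D x c)"
proof
  fix x c assume c: "c \<in> {M..C1}"
  then have "(c + b) / a \<le> (C1 + b) / a" using assms(2) by (simp add: divide_right_mono)
  then show "\<bar>U x c\<bar> \<le> (C1 + b) / a" "\<bar>D x c\<bar> \<le> (C1 + b) / a"
    using slope_bound[OF assms(1,2), of c x] c by auto
next
  show "concave_on {M..C1} (U x)" for x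
    unfolding concave_on_def
  proof (rule convex_onI)
    fix t c c' :: real assume "0 < t" "t < 1" "c \<in> {M..C1}" "c' \<in> {M..C1}"
    then show "- U x ((1 - t) *\<^sub>R c + t *\<^sub>R c') \<le> (1 - t) * - U x c + t * - U x c'"
      using U_concave[of c c' t x] by simp
  qed simp
  show "convex_on {M..C1} (D x)" for x
    by (rule convex_onI) (use D_convex[of _ _ _ x] in auto)
  have "\<not> (\<exists>r. H x0 r < M)" using assms(5) by (simp add: not_less)
  then show "U x0 M = D x0 M" using strict[of "U x0 M" "D x0 M" x0 M] by (auto simp: H_U H_D)
qed (use assms slopes_continuous in auto)

end

section \<open>Comparison of viscosity solutions with the fundamental solution\<close>

context strictly_convex_Hamiltonian
begin

text \<open>As the time derivative of the barrier is \<open>- copt\<close>, this makes it a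
  classical solution for positive times.\<close>

lemma H_barrier_slope:
  assumes "barrier x0 M C1 \<sigma> \<Lambda> U D" "c \<in> {M..C1}"
  shows "H x (barrier.B x0 U D x c) = c"
  using assms(2) by (simp add: barrier.B_def[OF assms(1)] H_U H_D)

text \<open>The barrier itself is the test function: after penalisation
  \<open>u - F - \<kappa> t\<close> has its maximum on the initial line, where the growth of
  \<open>F\<close> dominates the datum. \<open>H\<close> will be a perturbation of \<open>G\<close>,
  and \<open>\<kappa>\<close> pays for the difference on slopes of level at most
  \<open>C1\<close>.\<close>

lemma subsolution_le_barrier:
  fixes u :: "real \<times> real \<Rightarrow> real"
  assumes bar: "barrier x0 M C1 \<sigma> \<Lambda> U D"
    and sub: "viscosity_subsolution (UNIV \<times> {0<..}) (\<lambda>(x, t) r (q, \<tau>). \<tau> + G x q) u"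
    and G: "\<And>x q. H x q \<le> C1 \<Longrightarrow> H x q - \<kappa> \<le> G x q"
    and lip: "L-lipschitz_on (UNIV \<times> {0..}) u"
    and bounded: "\<And>x. \<bar>u (x, 0)\<bar> \<le> N"
    and k: "k > 0" "\<And>x. k \<le> U x C1" "\<And>x. D x C1 \<le> - k"
    and initial: "\<And>x. u (x, 0) \<le> u (x0, 0) + k * \<bar>x - x0\<bar>"
    and t: "t \<ge> 0"
  shows "\<exists>c\<in>{M..C1}. u (x, t) \<le> u (x0, 0) + barrier.A x0 U D x c - c * t + \<kappa> * t + \<sigma> * (C1 - M)\<^sup>2"
proof -
  interpret b: barrier x0 M C1 \<sigma> \<Lambda> U D by (rule bar)
  let ?S = "UNIV \<times> {0..} :: (real \<times> real) set"
  let ?s = "\<sigma> * (C1 - M)\<^sup>2"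
  have C1: "C1 \<in> {M..C1}" using b.levels by simp
  have F_lower: "k * \<bar>x - x0\<bar> - C1 * t - ?s \<le> b.F (x, t)" for x t
    using b.F_ge[OF C1, of x t] b.A_lower[OF C1 k(2,3), of x] by simp
  txt \<open>The term \<open>\<theta> t\<^sup>2\<close> beats the linear growth of \<open>u - F\<close> and makes the test function strict.\<close>
  have main: "u (x, t) - b.F (x, t) - \<kappa> * t \<le> u (x0, 0) + ?s + \<theta> * t\<^sup>2" if \<theta>: "\<theta> > 0" for \<theta>
  proof -
    define \<Phi> where "\<Phi> z = u z - (b.F z + \<kappa> * snd z + \<theta> * (snd z)\<^sup>2)" for z
    have cont: "continuous_on ?S \<Phi>"
      unfolding \<Phi>_def using lipschitz_on_continuous_on[OF lip]
      by (intro continuous_on_diff continuous_on_add continuous_on_mult continuous_on_power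
          continuous_on_snd continuous_on_const continuous_on_id b.continuous_on_F)
    have "\<exists>z\<in>?S. \<forall>w\<in>?S. \<Phi> w \<le> \<Phi> z"
    proof (rule attains_max_if_bounded_superlevel[OF _ cont])
      define E where "E = N + ?s - \<Phi> (x0, 0)"
      define J where "J = L + \<bar>C1\<bar> + \<bar>\<kappa>\<bar>"
      have L0: "0 \<le> L" using lip by (rule lipschitz_on_nonneg)
      show "bounded {z \<in> ?S. \<Phi> (x0, 0) \<le> \<Phi> z}"
      proof (rule bounded_rectangle_subset[where c = 0])
        fix z assume "z \<in> {z \<in> ?S. \<Phi> (x0, 0) \<le> \<Phi> z}"
        then obtain y s where z: "z = (y, s)" "s \<ge> 0" "\<Phi> (x0, 0) \<le> \<Phi> (y, s)" by (cases z) auto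
        have "dist (u (y, s)) (u (y, 0)) \<le> L * dist (y, s) (y, 0)"
          using z by (intro lipschitz_onD[OF lip]) auto
        then have "u (y, s) \<le> u (y, 0) + L * s"
          using z by (simp add: dist_Pair_Pair dist_real_def abs_le_iff)
        also have "\<dots> \<le> N + L * s" using bounded[of y] by (simp add: abs_le_iff)
        finally have "k * \<bar>y - x0\<bar> + \<theta> * s\<^sup>2 \<le> E + (L * s + C1 * s - \<kappa> * s)"
          using z(3) F_lower[of y s] by (simp add: \<Phi>_def E_def)
        also have "L * s + C1 * s - \<kappa> * s \<le> J * s"
        proof -
          have "(C1 - \<kappa>) * s \<le> (\<bar>C1\<bar> + \<bar>\<kappa>\<bar>) * s" using z by (intro mult_right_mono) auto
          then show ?thesis by (simp add: J_def algebra_simps)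
        qed
        also have "J * s \<le> \<theta> / 2 * s\<^sup>2 + J\<^sup>2 / (2 * \<theta>)"
        proof -
          have "0 \<le> (\<theta> * s - J)\<^sup>2 / (2 * \<theta>)" using \<theta> by simp
          also have "\<dots> = \<theta> / 2 * s\<^sup>2 - J * s + J\<^sup>2 / (2 * \<theta>)"
            using \<theta> by (simp add: power2_eq_square field_simps)
          finally show ?thesis by simp
        qed
        finally have *: "k * \<bar>y - x0\<bar> + \<theta> / 2 * s\<^sup>2 \<le> E + J\<^sup>2 / (2 * \<theta>)" by simp
        define W where "W = E + J\<^sup>2 / (2 * \<theta>)"
        have kn: "0 \<le> k * \<bar>y - x0\<bar>" "0 \<le> \<theta> / 2 * s\<^sup>2" using k(1) \<theta> by auto
        have "\<bar>y - x0\<bar> \<le> W / k" using * kn k(1) by (simp add: W_def pos_le_divide_eq mult.commute)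
        moreover have "s \<le> 2 * W / \<theta> + 1"
        proof -
          have "s\<^sup>2 \<le> 2 * W / \<theta>" using * kn \<theta> by (simp add: W_def pos_le_divide_eq mult.commute)
          moreover have "s \<le> s\<^sup>2 + 1"
          proof -
            have "0 \<le> (s - 1)\<^sup>2" by simp
            then have "2 * s \<le> s\<^sup>2 + 1" by (simp add: power2_eq_square algebra_simps)
            then show ?thesis using z(2) by linarith
          qed
          ultimately show ?thesis by linarith
        qed
        ultimately show "fst z \<in> {x0 - (E + J\<^sup>2 / (2 * \<theta>)) / k..x0 + (E + J\<^sup>2 / (2 * \<theta>)) / k} \<and>
            snd z \<in> {0..2 * (E + J\<^sup>2 / (2 * \<theta>)) / \<theta> + 1}"
          using z by (auto simp: W_def abs_le_iff)
      qed
    qed (auto intro: closed_Times)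
    then obtain x1 t1 where max: "t1 \<ge> 0" "\<And>w. w \<in> ?S \<Longrightarrow> \<Phi> w \<le> \<Phi> (x1, t1)" by auto
    have "\<not> t1 > 0"
    proof
      assume t1: "t1 > 0"
      define \<phi> where "\<phi> z = b.F z + (\<kappa> * snd z + \<theta> * (snd z)\<^sup>2)" for z
      define D\<phi> where "D\<phi> z = b.DF z + (0, \<kappa> + 2 * \<theta> * snd z)" for z
      have time: "GDERIV (\<lambda>z. \<kappa> * snd z + \<theta> * (snd z)\<^sup>2) z :> (0, \<kappa> + 2 * \<theta> * snd z)" for z :: "real \<times> real"
        by (rule GDERIV_time) (auto intro!: derivative_eq_intros)
      have "C1_with_gradient (UNIV \<times> {0<..}) \<phi> D\<phi>"
        unfolding C1_with_gradient_def
      proof (intro conjI ballI)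
        fix z :: "real \<times> real" assume "z \<in> UNIV \<times> {0<..}"
        then show "GDERIV \<phi> z :> D\<phi> z"
          unfolding \<phi>_def[abs_def] D\<phi>_def by (intro GDERIV_add time b.GDERIV_F) auto
      next
        show "continuous_on (UNIV \<times> {0<..}) D\<phi>"
          unfolding D\<phi>_def[abs_def]
          by (intro continuous_on_add b.continuous_on_DF continuous_on_Pair continuous_on_mult
              continuous_on_snd continuous_on_const continuous_on_id)
      qed
      then have "snd (D\<phi> (x1, t1)) + G x1 (fst (D\<phi> (x1, t1))) \<le> 0"
      proof (rule subsolution_touching[OF sub _ t1])
        fix x t :: real assume "0 < t"
        then show "u (x, t) - \<phi> (x, t) \<le> u (x1, t1) - \<phi> (x1, t1)"
          using max(2)[of "(x, t)"] by (simp add: \<Phi>_def \<phi>_def)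
      qed
      \<comment> \<open>The touching inequality is
        \<open>- c + \<kappa> + 2 * \<theta> * t1 + G x1 (b.B x1 c) \<le> 0\<close>, while the last
        term is at least \<open>c - \<kappa>\<close>; this leaves
        \<open>2 * \<theta> * t1 \<le> 0\<close>.\<close>
      moreover define c where "c = b.copt (x1, t1)"
      have c: "c \<in> {M..C1}" by (simp only: c_def b.copt)
      have "H x1 (b.B x1 c) = c" by (rule H_barrier_slope[OF bar c])
      then have "c - \<kappa> \<le> G x1 (b.B x1 c)" using G[of x1 "b.B x1 c"] c by simp
      moreover have "D\<phi> (x1, t1) = (b.B x1 c, - c + \<kappa> + 2 * \<theta> * t1)"
        by (simp add: D\<phi>_def b.DF_def c_def)
      ultimately have "2 * \<theta> * t1 \<le> 0" by simp
      then show False using \<theta> t1 by (metis mult_pos_pos not_less zero_less_numeral)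
    qed
    then have "t1 = 0" using max(1) by simp
    have "\<Phi> (x, t) \<le> \<Phi> (x1, 0)" using max(2)[of "(x, t)"] t \<open>t1 = 0\<close> by simp
    also have "\<dots> \<le> u (x0, 0) + ?s"
      using initial[of x1] F_lower[of x1 0] by (simp add: \<Phi>_def)
    finally show ?thesis by (simp add: \<Phi>_def)
  qed
  have "u (x, t) - b.F (x, t) - \<kappa> * t \<le> u (x0, 0) + ?s"
  proof (rule field_le_epsilon)
    fix e :: real assume e: "e > 0"
    define \<theta> where "\<theta> = e / (1 + t\<^sup>2)"
    have pos: "1 + t\<^sup>2 > 0" by (simp add: add_pos_nonneg)
    then have "\<theta> > 0" using e by (simp add: \<theta>_def)
    have "\<theta> * t\<^sup>2 \<le> e" using e pos by (simp add: \<theta>_def pos_divide_le_eq)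
    with main[OF \<open>\<theta> > 0\<close>] show "u (x, t) - b.F (x, t) - \<kappa> * t \<le> u (x0, 0) + ?s + e" by linarith
  qed
  moreover obtain c where "c \<in> {M..C1}" "b.F (x, t) \<le> b.A x c - c * t" using b.F_attained by blast
  ultimately show ?thesis by (intro bexI[of _ c]) auto
qed

text \<open>The point \<open>y'\<close> minimises \<open>u (y, 0) + F (y, T)\<close>, and the claim
  is that the sum of \<open>u\<close> and the time-reversed barrier never falls below this value.
  The test function is \<open>- F (y, T - s)\<close>; its spatial slope is the negative of a barrier
  slope, hence \<open>G x (- q)\<close> in the hypothesis.\<close>

lemma supersolution_ge_barrier:
  fixes u :: "real \<times> real \<Rightarrow> real"
  assumes bar: "barrier x0 M C1 \<sigma> \<Lambda> U D"
    and super: "viscosity_supersolution (UNIV \<times> {0<..}) (\<lambda>(x, t) r (q, \<tau>). \<tau> + G x q) u"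
    and G: "\<And>x q. G x (- q) \<le> H x q"
    and lip: "L-lipschitz_on (UNIV \<times> {0..}) u"
    and bounded: "\<And>x. \<bar>u (x, 0)\<bar> \<le> N"
    and k: "k > 0" "\<And>x. k \<le> U x C1" "\<And>x. D x C1 \<le> - k"
    and T: "T > 0"
  shows "\<exists>y'. \<forall>y s. 0 \<le> s \<longrightarrow> s < T \<longrightarrow>
    u (y', 0) + barrier.F x0 M C1 \<sigma> U D (y', T) \<le> u (y, s) + barrier.F x0 M C1 \<sigma> U D (y, T - s)"
proof -
  interpret b: barrier x0 M C1 \<sigma> \<Lambda> U D by (rule bar)
  let ?s = "\<sigma> * (C1 - M)\<^sup>2"
  have C1: "C1 \<in> {M..C1}" using b.levels by simp
  have F_lower: "k * \<bar>x - x0\<bar> - C1 * t - ?s \<le> b.F (x, t)" for x t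
    using b.F_ge[OF C1, of x t] b.A_lower[OF C1 k(2,3), of x] by simp
  have u_cont: "continuous_on (UNIV \<times> {0..}) u" by (rule lipschitz_on_continuous_on[OF lip])
  have L0: "0 \<le> L" using lip by (rule lipschitz_on_nonneg)
  have u_lower: "- N - L * T \<le> u (y, s)" if "0 \<le> s" "s \<le> T" for y s
  proof -
    have "dist (u (y, s)) (u (y, 0)) \<le> L * dist (y, s) (y, 0)"
      using that by (intro lipschitz_onD[OF lip]) auto
    then have "u (y, 0) - L * s \<le> u (y, s)"
      using that by (simp add: dist_Pair_Pair dist_real_def abs_le_iff)
    moreover have "L * s \<le> L * T" using that L0 by (intro mult_left_mono)
    ultimately show ?thesis using bounded[of y] by (simp add: abs_le_iff)
  qed
  define E where "E = N + L * T + \<bar>C1\<bar> * T + ?s"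
  have Psi_lower: "k * \<bar>y - x0\<bar> - E \<le> u (y, s) + b.F (y, T - s)" if "0 \<le> s" "s \<le> T" for y s
  proof -
    have "C1 * (T - s) \<le> \<bar>C1\<bar> * T" using that by (intro mult_mono) auto
    then show ?thesis using u_lower[OF that, of y] F_lower[of y "T - s"] by (simp add: E_def)
  qed
  obtain y' where y': "\<And>y. u (y', 0) + b.F (y', T) \<le> u (y, 0) + b.F (y, T)"
  proof -
    let ?\<Phi> = "\<lambda>y. - (u (y, 0) + b.F (y, T))"
    have "\<exists>y\<in>UNIV. \<forall>w\<in>UNIV. ?\<Phi> w \<le> ?\<Phi> y"
    proof (rule attains_max_if_bounded_superlevel[of _ _ x0])
      have "continuous_on UNIV (\<lambda>y. u (y, 0))"
        by (rule continuous_on_compose2[OF u_cont]) (auto intro: continuous_intros)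
      moreover have "continuous_on UNIV (\<lambda>y. b.F (y, T))"
        by (rule continuous_on_compose2[OF b.continuous_on_F[of UNIV]]) (auto intro: continuous_intros)
      ultimately show "continuous_on UNIV ?\<Phi>" by (intro continuous_on_minus continuous_on_add)
      show "bounded {y \<in> UNIV. ?\<Phi> x0 \<le> ?\<Phi> y}"
      proof (rule bounded_subset[OF bounded_closed_interval])
        let ?W = "(E - ?\<Phi> x0) / k"
        show "{y \<in> UNIV. ?\<Phi> x0 \<le> ?\<Phi> y} \<subseteq> {x0 - ?W..x0 + ?W}"
        proof
          fix y assume "y \<in> {y \<in> UNIV. ?\<Phi> x0 \<le> ?\<Phi> y}"
          then have "k * \<bar>y - x0\<bar> \<le> E - ?\<Phi> x0" using Psi_lower[of 0 y] T by simp
          then have "\<bar>y - x0\<bar> \<le> ?W" using k(1) by (simp add: pos_le_divide_eq mult.commute)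
          then show "y \<in> {x0 - ?W..x0 + ?W}" by (auto simp: abs_le_iff)
        qed
      qed
    qed auto
    then obtain y where "\<And>w. ?\<Phi> w \<le> ?\<Phi> y" by blast
    then have "u (y, 0) + b.F (y, T) \<le> u (w, 0) + b.F (w, T)" for w by (smt (verit))
    then show ?thesis by (rule that)
  qed
  txt \<open>The term \<open>\<theta> / (T - s)\<close> keeps the minimum away from \<open>s = T\<close>, and since it increases in \<open>s\<close> it makes the
    test function strict, so that the minimum can only be attained at \<open>s = 0\<close>.\<close>
  have main: "u (y', 0) + b.F (y', T) \<le> u (y, s) + b.F (y, T - s) + \<theta> / (T - s)"
    if \<theta>: "\<theta> > 0" and s: "0 \<le> s" "s < T" for \<theta> y s
  proof -
    define \<Psi> where "\<Psi> z = u z + b.F (fst z, T - snd z) + \<theta> / (T - snd z)" for z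
    \<comment> \<open>For times in \<open>[T - \<eta>, T)\<close> the penalty is at least
      \<open>E'\<close>, which exceeds what is needed to beat the values at \<open>(x0, 0)\<close>
      and at the given point \<open>(y, s)\<close>; a minimum over the closed strip is then one over
      all times before \<open>T\<close>.\<close>
    define E' where "E' = \<bar>\<Psi> (x0, 0)\<bar> + \<bar>\<Psi> (y, s)\<bar> + \<bar>E\<bar> + 1"
    define \<eta> where "\<eta> = \<theta> / E'"
    have E': "E' > 0" by (simp add: E'_def)
    then have \<eta>: "\<eta> > 0" using \<theta> by (simp add: \<eta>_def)
    let ?S = "UNIV \<times> {0..T - \<eta>} :: (real \<times> real) set"
    have late: "\<Psi> (x0, 0) < \<Psi> (w, r)" "\<Psi> (y, s) < \<Psi> (w, r)" if "0 \<le> r" "r < T" "T - \<eta> \<le> r" for w r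
    proof -
      have "E' \<le> \<theta> / (T - r)"
      proof -
        have "E' * (T - r) \<le> E' * \<eta>" using that E' by (intro mult_left_mono) auto
        also have "\<dots> = \<theta>" using E' by (simp add: \<eta>_def)
        finally show ?thesis using that by (simp add: pos_le_divide_eq)
      qed
      moreover have "- E \<le> u (w, r) + b.F (w, T - r)"
        using Psi_lower[of r w] that k(1) by (smt (verit) mult_nonneg_nonneg abs_ge_zero)
      ultimately show "\<Psi> (x0, 0) < \<Psi> (w, r)" "\<Psi> (y, s) < \<Psi> (w, r)"
        unfolding E'_def \<Psi>_def[of "(w, r)"] by auto
    qed
    have s\<eta>: "s < T - \<eta>" using late(2)[of s y] s by force
    have T\<eta>: "0 < T - \<eta>" using late(1)[of 0 x0] T by force
    have cont: "continuous_on ?S (\<lambda>z. - \<Psi> z)"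
    proof -
      have "continuous_on ?S u" by (rule continuous_on_subset[OF u_cont]) auto
      moreover have "continuous_on ?S (\<lambda>z. b.F (fst z, T - snd z))"
        by (rule continuous_on_compose2[OF b.continuous_on_F[of UNIV]]) (auto intro!: continuous_intros)
      moreover have "continuous_on ?S (\<lambda>z. \<theta> / (T - snd z))"
        using \<eta> by (intro continuous_intros) auto
      ultimately show ?thesis unfolding \<Psi>_def by (intro continuous_on_minus continuous_on_add)
    qed
    have "\<exists>z\<in>?S. \<forall>w\<in>?S. - \<Psi> w \<le> - \<Psi> z"
    proof (rule attains_max_if_bounded_superlevel[OF _ cont])
      show "(x0, 0) \<in> ?S" using T\<eta> by simp
      show "bounded {z \<in> ?S. - \<Psi> (x0, 0) \<le> - \<Psi> z}"
      proof (rule bounded_rectangle_subset)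
        fix z assume "z \<in> {z \<in> ?S. - \<Psi> (x0, 0) \<le> - \<Psi> z}"
        then obtain w r where z: "z = (w, r)" "0 \<le> r" "r \<le> T - \<eta>" "\<Psi> (w, r) \<le> \<Psi> (x0, 0)"
          by (cases z) auto
        have "0 \<le> \<theta> / (T - r)" using z \<theta> \<eta> by simp
        then have "k * \<bar>w - x0\<bar> \<le> E + \<Psi> (x0, 0)"
          using z Psi_lower[of r w] \<eta> by (simp add: \<Psi>_def[of "(w, r)"])
        then have "\<bar>w - x0\<bar> \<le> (E + \<Psi> (x0, 0)) / k" using k(1) by (simp add: pos_le_divide_eq mult.commute)
        then show "fst z \<in> {x0 - (E + \<Psi> (x0, 0)) / k..x0 + (E + \<Psi> (x0, 0)) / k} \<and> snd z \<in> {0..T - \<eta>}"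
          using z by (auto simp: abs_le_iff)
      qed
    qed (auto intro: closed_Times)
    then obtain z1 where "z1 \<in> ?S" "\<And>w. w \<in> ?S \<Longrightarrow> - \<Psi> w \<le> - \<Psi> z1" by blast
    then obtain x1 t1 where t1: "0 \<le> t1" "t1 \<le> T - \<eta>" and min_S: "\<And>w. w \<in> ?S \<Longrightarrow> \<Psi> (x1, t1) \<le> \<Psi> w"
      by (cases z1) (auto simp del: split_paired_All)
    have min: "\<Psi> (x1, t1) \<le> \<Psi> (w, r)" if "0 \<le> r" "r < T" for w r
    proof (cases "r \<le> T - \<eta>")
      case False
      have "\<Psi> (x1, t1) \<le> \<Psi> (x0, 0)" using T\<eta> by (intro min_S) auto
      also have "\<dots> < \<Psi> (w, r)" using False that by (intro late) auto
      finally show ?thesis by simp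
    qed (use that min_S in auto)
    have "\<not> t1 > 0"
    proof
      assume pos: "t1 > 0"
      define \<phi> where "\<phi> z = - b.F (fst z, T - snd z) + - (\<theta> / (T - snd z))" for z
      define D\<phi> where "D\<phi> z = - (fst (b.DF (fst z, T - snd z)), (- 1) * snd (b.DF (fst z, T - snd z)))
         + - (0, \<theta> / (T - snd z)\<^sup>2)" for z
      have C1\<phi>: "C1_with_gradient (UNIV \<times> {0<..<T}) \<phi> D\<phi>"
        unfolding C1_with_gradient_def
      proof (intro conjI ballI)
        fix z :: "real \<times> real" assume z: "z \<in> UNIV \<times> {0<..<T}"
        have 1: "GDERIV (\<lambda>z. b.F (fst z, T - snd z)) z :> (fst (b.DF (fst z, T - snd z)), (- 1) * snd (b.DF (fst z, T - snd z)))"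
          using z by (intro GDERIV_compose_time) (auto intro!: derivative_eq_intros b.GDERIV_F)
        have 2: "GDERIV (\<lambda>z. \<theta> / (T - snd z)) z :> (0, \<theta> / (T - snd z)\<^sup>2)"
          using z by (intro GDERIV_time) (auto intro!: derivative_eq_intros simp: power2_eq_square)
        show "GDERIV \<phi> z :> D\<phi> z"
          unfolding \<phi>_def[abs_def] D\<phi>_def by (intro GDERIV_add GDERIV_minus 1 2)
      next
        have "continuous_on (UNIV \<times> {0<..<T}) (\<lambda>z. b.DF (fst z, T - snd z))"
          by (rule continuous_on_compose2[OF b.continuous_on_DF]) (auto intro!: continuous_intros)
        then show "continuous_on (UNIV \<times> {0<..<T}) D\<phi>"
          unfolding D\<phi>_def[abs_def]
          by (intro continuous_on_add continuous_on_minus continuous_on_Pair continuous_on_fst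
              continuous_on_mult continuous_on_const continuous_on_snd continuous_on_divide
              continuous_on_power continuous_on_diff continuous_on_id) auto
      qed
      have t1T: "t1 < T" using t1 \<eta> by simp
      have "0 \<le> snd (D\<phi> (x1, t1)) + G x1 (fst (D\<phi> (x1, t1)))"
      proof (rule supersolution_touching[OF super C1\<phi> pos t1T])
        fix x t :: real assume "0 < t" "t < T"
        then show "u (x, t) - \<phi> (x, t) \<ge> u (x1, t1) - \<phi> (x1, t1)"
          using min[of t x] by (simp add: \<Psi>_def \<phi>_def)
      qed
      moreover define c where "c = b.copt (x1, T - t1)"
      have c: "c \<in> {M..C1}" by (simp only: c_def b.copt)
      have "G x1 (- b.B x1 c) \<le> c" using G[of x1 "b.B x1 c"] H_barrier_slope[OF bar c, of x1] by simp
      moreover have "D\<phi> (x1, t1) = (- b.B x1 c, - c - \<theta> / (T - t1)\<^sup>2)"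
        by (simp add: D\<phi>_def b.DF_def c_def)
      ultimately have "\<theta> / (T - t1)\<^sup>2 \<le> 0" by simp
      moreover have "\<theta> / (T - t1)\<^sup>2 > 0" using \<theta> t1T by simp
      ultimately show False by simp
    qed
    then have "t1 = 0" using t1 by simp
    have "u (y', 0) + b.F (y', T) \<le> \<Psi> (x1, t1)"
      using y'[of x1] \<theta> T by (simp add: \<Psi>_def \<open>t1 = 0\<close> add_increasing2)
    also have "\<dots> \<le> \<Psi> (y, s)" by (rule min[OF s])
    finally show ?thesis by (simp add: \<Psi>_def)
  qed
  have "u (y', 0) + b.F (y', T) \<le> u (y, s) + b.F (y, T - s)" if s: "0 \<le> s" "s < T" for y s
  proof (rule field_le_epsilon)
    fix e :: real assume e: "e > 0"
    then have "e * (T - s) > 0" using s by simp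
    from main[OF this s, of y] s show "u (y', 0) + b.F (y', T) \<le> u (y, s) + b.F (y, T - s) + e" by simp
  qed
  then show ?thesis by blast
qed

end

section \<open>Hopf--Lax bounds\<close>

lemma integral_shift_periodic:
  fixes f :: "real \<Rightarrow> real"
  assumes per: "\<And>x. f (x + 1) = f x"
  shows "integral {u + of_int n..v + of_int n} f = integral {u..v} f"
proof -
  interpret periodic_fun_simple' f by standard (rule per)
  show ?thesis
    using integral_shift_real_ivl[of "u + of_int n" "of_int n" "v + of_int n" f] by (simp add: plus_of_int)
qed

lemma integral_period:
  fixes f :: "real \<Rightarrow> real"
  assumes int: "\<And>a b. f integrable_on {a..b}" and per: "\<And>x. f (x + 1) = f x"
  shows "integral {b..b + 1} f = integral {0..1} f"
proof -
  note shift = integral_shift_periodic[of f, OF per]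
  define r where "r = frac b"
  have r: "0 \<le> r" "r \<le> 1" by (auto simp: r_def less_imp_le frac_lt_1)
  have b: "b = r + of_int \<lfloor>b\<rfloor>" by (simp add: r_def frac_def)
  have "integral {b..b + 1} f = integral {r + of_int \<lfloor>b\<rfloor>..(r + 1) + of_int \<lfloor>b\<rfloor>} f"
    by (subst b, subst (2) b) (simp add: algebra_simps)
  also have "\<dots> = integral {r..r + 1} f" by (rule shift)
  also have "\<dots> = integral {r..1} f + integral {1..r + 1} f"
    using r int by (intro Henstock_Kurzweil_Integration.integral_combine[symmetric]) auto
  also have "integral {1..r + 1} f = integral {0..r} f"
    using shift[of 0 1 r] by simp
  also have "integral {r..1} f + integral {0..r} f = integral {0..1} f"
    using r int Henstock_Kurzweil_Integration.integral_combine[of 0 r 1 f] by simp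
  finally show ?thesis .
qed

text \<open>Full periods contribute exactly their mean; only the remainder, shorter than one period,
  is lost, at most \<open>R\<close> for the integral and \<open>R\<close> for the mean.\<close>

lemma integral_near_mean:
  fixes f :: "real \<Rightarrow> real"
  assumes cont: "continuous_on UNIV f" and per: "\<And>x. f (x + 1) = f x"
    and bound: "\<And>x. \<bar>f x\<bar> \<le> R" and ab: "a \<le> b"
  shows "\<bar>integral {a..b} f - integral {0..1} f * (b - a)\<bar> \<le> 2 * R"
proof -
  have int: "f integrable_on {u..v}" for u v
    by (intro integrable_continuous_real continuous_on_subset[OF cont]) auto
  let ?m = "integral {0..1} f"
  have bd: "\<bar>integral {u..v} f\<bar> \<le> R * (v - u)" if "u \<le> v" for u v
    using integral_affine_bound[of u v f 0 R] that bound continuous_on_subset[OF cont] by simp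
  have periods: "integral {a..a + real n} f = real n * ?m" for n
  proof (induction n)
    case (Suc n)
    have "integral {a..a + real n} f + integral {a + real n..a + real n + 1} f = integral {a..a + real n + 1} f"
      using int by (intro Henstock_Kurzweil_Integration.integral_combine) auto
    then show ?case using Suc integral_period[OF int per, of "a + real n"] by (simp add: algebra_simps)
  qed simp
  define n where "n = nat \<lfloor>b - a\<rfloor>"
  define r where "r = b - (a + real n)"
  have n: "real n \<le> b - a" "b - a < real n + 1" using ab by (auto simp: n_def)
  have "integral {a..a + real n} f + integral {a + real n..b} f = integral {a..b} f"
    using int n by (intro Henstock_Kurzweil_Integration.integral_combine) auto
  then have "integral {a..b} f - ?m * (b - a) = integral {a + real n..b} f - ?m * r"
    using periods[of n] by (simp add: r_def algebra_simps)
  moreover have "\<bar>integral {a + real n..b} f\<bar> \<le> R * r" using n bd[of "a + real n" b] by (simp add: r_def)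
  moreover have "\<bar>?m * r\<bar> \<le> R * r"
    using bd[of 0 1] n by (simp add: abs_mult r_def mult_right_mono)
  moreover have "R * r \<le> R"
  proof -
    have "0 \<le> R" using bound[of 0] by linarith
    then show ?thesis using n mult_left_mono[of r 1 R] by (simp add: r_def)
  qed
  ultimately show ?thesis by linarith
qed

section \<open>Averaged slopes and the homogenised travel cost\<close>

definition mean_upper :: "(real \<Rightarrow> real \<Rightarrow> real) \<Rightarrow> real \<Rightarrow> real" where
  "mean_upper H c = integral {0..1} (\<lambda>y. upper_slope (H y) c)"

definition mean_lower :: "(real \<Rightarrow> real \<Rightarrow> real) \<Rightarrow> real \<Rightarrow> real" where
  "mean_lower H c = integral {0..1} (\<lambda>y. lower_slope (H y) c)"

text \<open>For \<open>c\<close> above the critical level, the support function of the interval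
  between the two means, which later proves to be the sublevel set of the effective
  Hamiltonian.\<close>

definition travel_cost :: "(real \<Rightarrow> real \<Rightarrow> real) \<Rightarrow> real \<Rightarrow> real \<Rightarrow> real" where
  "travel_cost H c \<xi> = (if 0 \<le> \<xi> then mean_upper H c * \<xi> else mean_lower H c * \<xi>)"

context convex_Hamiltonian
begin

lemma slopes_continuous_gt:
  assumes "M < c"
  shows "continuous_on S (\<lambda>y. U y c)" "continuous_on S (\<lambda>y. D y c)"
proof -
  have "continuous_on S (\<lambda>y. (y, c))" "(\<lambda>y. (y, c)) ` S \<subseteq> UNIV \<times> {M<..}"
    using assms by (auto intro!: continuous_intros)
  from continuous_on_compose2[OF continuous_on_U_gt this] continuous_on_compose2[OF continuous_on_D_gt this]
  show "continuous_on S (\<lambda>y. U y c)" "continuous_on S (\<lambda>y. D y c)" by simp_all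
qed

lemma mean_reflected:
  "mean_upper (\<lambda>y p. H y (- p)) c = - mean_lower H c" "mean_lower (\<lambda>y p. H y (- p)) c = - mean_upper H c"
  by (simp_all add: mean_upper_def mean_lower_def lower_slope_def)

lemma travel_cost_reflected: "travel_cost (\<lambda>y p. H y (- p)) c \<xi> = travel_cost H c (- \<xi>)"
  by (auto simp: travel_cost_def mean_reflected)

lemma mean_lower_le_upper: "M < c \<Longrightarrow> mean_lower H c \<le> mean_upper H c"
  unfolding mean_upper_def mean_lower_def
  by (intro integral_le integrable_continuous_real slopes_continuous_gt D_le_U) auto

context
  fixes a b C1 R
  assumes growth: "\<And>y p. a * \<bar>p\<bar> - b \<le> H y p" and a: "a > 0" and R: "R = (C1 + b) / a"
begin

lemma slopes_le:
  assumes "M \<le> c" "c \<le> C1"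
  shows "\<bar>U y c\<bar> \<le> R" "\<bar>D y c\<bar> \<le> R"
proof -
  have "(c + b) / a \<le> R" using assms a by (simp add: R divide_right_mono)
  then show "\<bar>U y c\<bar> \<le> R" "\<bar>D y c\<bar> \<le> R" using slope_bound[OF growth a assms(1), of y] by linarith+
qed

lemma mean_le:
  assumes "M < c" "c \<le> C1"
  shows "\<bar>mean_upper H c\<bar> \<le> R" "\<bar>mean_lower H c\<bar> \<le> R"
  using integral_affine_bound[of 0 1 "\<lambda>y. U y c" 0 R] integral_affine_bound[of 0 1 "\<lambda>y. D y c" 0 R]
    slopes_le[of c] slopes_continuous_gt[OF assms(1)] assms
  by (simp_all add: mean_upper_def mean_lower_def)

lemma travel_cost_lipschitz:
  assumes "M < c" "c \<le> C1"
  shows "travel_cost H c \<xi> \<le> travel_cost H c \<eta> + R * \<bar>\<xi> - \<eta>\<bar>"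
proof -
  let ?P = "mean_upper H c" and ?Q = "mean_lower H c"
  have eq: "travel_cost H c \<zeta> = max (?P * \<zeta>) (?Q * \<zeta>)" for \<zeta>
    using mean_lower_le_upper[OF assms(1)]
    by (auto simp: travel_cost_def max_def mult_right_mono mult_right_mono_neg
        intro: antisym)
  have "?P * \<xi> \<le> ?P * \<eta> + R * \<bar>\<xi> - \<eta>\<bar>" "?Q * \<xi> \<le> ?Q * \<eta> + R * \<bar>\<xi> - \<eta>\<bar>"
  proof -
    have "?P * (\<xi> - \<eta>) \<le> \<bar>?P\<bar> * \<bar>\<xi> - \<eta>\<bar>" "?Q * (\<xi> - \<eta>) \<le> \<bar>?Q\<bar> * \<bar>\<xi> - \<eta>\<bar>"
      by (simp_all flip: abs_mult)
    moreover have "\<bar>?P\<bar> * \<bar>\<xi> - \<eta>\<bar> \<le> R * \<bar>\<xi> - \<eta>\<bar>" "\<bar>?Q\<bar> * \<bar>\<xi> - \<eta>\<bar> \<le> R * \<bar>\<xi> - \<eta>\<bar>"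
      using mean_le[OF assms] by (simp_all add: mult_right_mono)
    ultimately show "?P * \<xi> \<le> ?P * \<eta> + R * \<bar>\<xi> - \<eta>\<bar>" "?Q * \<xi> \<le> ?Q * \<eta> + R * \<bar>\<xi> - \<eta>\<bar>"
      unfolding right_diff_distrib by linarith+
  qed
  then show ?thesis unfolding eq by linarith
qed

lemma travel_cost_integral:
  assumes c: "M < c" "c \<le> C1"
  shows "\<bar>integral {x0..x} (\<lambda>z. U z c) - integral {x..x0} (\<lambda>z. D z c) - travel_cost H c (x - x0)\<bar> \<le> 2 * R"
proof (cases "x0 \<le> x")
  case True
  have "\<bar>integral {x0..x} (\<lambda>z. U z c) - mean_upper H c * (x - x0)\<bar> \<le> 2 * R"
    unfolding mean_upper_def using True c
    by (intro integral_near_mean slopes_continuous_gt slopes_le U_periodic) auto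
  moreover have "integral {x..x0} (\<lambda>z. D z c) = 0" using True by (auto simp: order_le_less)
  ultimately show ?thesis using True by (simp add: travel_cost_def)
next
  case False
  have "\<bar>integral {x..x0} (\<lambda>z. D z c) - mean_lower H c * (x0 - x)\<bar> \<le> 2 * R"
    unfolding mean_lower_def using False c
    by (intro integral_near_mean slopes_continuous_gt slopes_le D_periodic) auto
  then show ?thesis using False by (simp add: travel_cost_def right_diff_distrib)
qed

text \<open>\<open>Br\<close> and \<open>Bl\<close> stand for slopes of a perturbed Hamiltonian,
  which can only be compared with the slopes of \<open>H\<close> on a nearby level.\<close>

lemma barrier_integral_le:
  assumes c: "M < c" "c \<le> C1"
    and Br: "continuous_on UNIV Br" "\<And>z. Br z \<le> U z c"
    and Bl: "continuous_on UNIV Bl" "\<And>z. D z c \<le> Bl z"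
  shows "integral {x0..x} Br - integral {x..x0} Bl \<le> travel_cost H c (x - x0) + 2 * R"
proof -
  have "integral {x0..x} Br \<le> integral {x0..x} (\<lambda>z. U z c)" "integral {x..x0} (\<lambda>z. D z c) \<le> integral {x..x0} Bl"
    using Br Bl by (auto intro!: integral_le integrable_continuous_real slopes_continuous_gt c
        continuous_on_subset[OF Br(1)] continuous_on_subset[OF Bl(1)])
  then show ?thesis using travel_cost_integral[OF c, of x0 x] by linarith
qed

lemma barrier_integral_ge:
  assumes c: "M < c" "c \<le> C1"
    and Br: "continuous_on UNIV Br" "\<And>z. U z c \<le> Br z"
    and Bl: "continuous_on UNIV Bl" "\<And>z. Bl z \<le> D z c"
  shows "travel_cost H c (x - x0) - 2 * R \<le> integral {x0..x} Br - integral {x..x0} Bl"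
proof -
  have "integral {x0..x} (\<lambda>z. U z c) \<le> integral {x0..x} Br" "integral {x..x0} Bl \<le> integral {x..x0} (\<lambda>z. D z c)"
    using Br Bl by (auto intro!: integral_le integrable_continuous_real slopes_continuous_gt c
        continuous_on_subset[OF Br(1)] continuous_on_subset[OF Bl(1)])
  then show ?thesis using travel_cost_integral[OF c, of x0 x] by linarith
qed

end

section \<open>One-sided Hopf--Lax bounds at unit scale\<close>

lemma strictly_convex_perturbation:
  assumes "\<delta> > 0"
  shows "strictly_convex_Hamiltonian (\<lambda>y p. H y p + \<delta> * p\<^sup>2)"
proof
  show "continuous_on UNIV (\<lambda>(y, p). H y p + \<delta> * p\<^sup>2)"
    unfolding case_prod_beta by (intro continuous_intros) 
  show "H (y + 1) p + \<delta> * p\<^sup>2 = H y p + \<delta> * p\<^sup>2" for y p by (simp add: periodic_H)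
  show "\<exists>R. \<forall>y p. R \<le> \<bar>p\<bar> \<longrightarrow> N \<le> H y p + \<delta> * p\<^sup>2" for N
  proof -
    obtain R where R: "\<forall>y p. R \<le> \<bar>p\<bar> \<longrightarrow> N \<le> H y p" using coercive_H by blast
    have "0 \<le> \<delta> * p\<^sup>2" for p :: real using assms by simp
    with R show ?thesis by (meson add_increasing2)
  qed
  show "convex_on UNIV (\<lambda>p. H y p + \<delta> * p\<^sup>2)" for y
  proof (rule convex_on_add[OF convex_H])
    show "convex_on UNIV (\<lambda>p. \<delta> * p\<^sup>2)"
      using assms by (intro convex_on_cmul convex_power2) auto
  qed
  fix p q c y :: real
  assume pq: "p \<noteq> q" "H y p + \<delta> * p\<^sup>2 \<le> c" "H y q + \<delta> * q\<^sup>2 \<le> c"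
  let ?r = "(p + q) / 2"
  have "H y ((1 - 1/2) *\<^sub>R p + (1/2) *\<^sub>R q) \<le> (1 - 1/2) * H y p + (1/2) * H y q"
    by (intro convex_onD[OF convex_H]) auto
  then have "H y ?r \<le> (H y p + H y q) / 2" by (simp add: field_simps)
  moreover have "\<delta> * ?r\<^sup>2 = (\<delta> * p\<^sup>2 + \<delta> * q\<^sup>2) / 2 - \<delta> * ((p - q) / 2)\<^sup>2"
    by (simp add: power2_eq_square field_simps)
  moreover have "0 < \<delta> * ((p - q) / 2)\<^sup>2" using pq assms by simp
  ultimately have "H y ?r + \<delta> * ?r\<^sup>2 < c" using pq by (simp add: field_simps)
  then show "\<exists>r. H y r + \<delta> * r\<^sup>2 < c" by blast
qed

text \<open>Integer translates of a critical point are critical, so moving a vertex to an admissible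
  place costs only a bounded amount.\<close>

lemma lattice_point: "\<exists>z. \<bar>x - z\<bar> \<le> 1 \<and> (\<forall>p. M \<le> H z p)"
proof -
  obtain y where y: "\<And>p. M \<le> H y p" using critical_point by blast
  let ?z = "y + of_int \<lfloor>x - y\<rfloor>"
  have "\<bar>x - ?z\<bar> \<le> 1" by linarith
  then show ?thesis using y by (intro exI[of _ ?z]) (simp add: periodic_int)
qed

text \<open>The constant is fixed before \<open>u\<close>, \<open>L\<close> and \<open>N\<close>:
  these only ensure that extrema exist. The unit of slack in \<open>C1 - 1\<close> absorbs the
  perturbation, and slope \<open>K + 1\<close> makes the barrier strictly coercive even for
  \<open>K = 0\<close>.\<close>

theorem subsolution_upper_bound:
  assumes K: "K \<ge> 0" and C1: "M < C1" "\<And>x. H x (K + 1) \<le> C1 - 1" "\<And>x. H x (- (K + 1)) \<le> C1 - 1"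
  shows "\<exists>C. \<forall>u L N. viscosity_subsolution (UNIV \<times> {0<..}) (\<lambda>(x, t) r (q, \<tau>). \<tau> + H x q) u \<longrightarrow>
     L-lipschitz_on (UNIV \<times> {0..}) u \<longrightarrow> (\<forall>x. \<bar>u (x, 0)\<bar> \<le> N) \<longrightarrow>
     (\<forall>x y. u (x, 0) \<le> u (y, 0) + K * \<bar>x - y\<bar>) \<longrightarrow>
     (\<forall>x t y. 0 \<le> t \<longrightarrow> (\<exists>c. M < c \<and> c \<le> C1 \<and> u (x, t) \<le> u (y, 0) + travel_cost H c (x - y) - c * t + C))"
proof -
  obtain a b where ab: "a > 0" "\<And>y p. a * \<bar>p\<bar> - b \<le> H y p" using linear_growth by blast
  define R where "R = (C1 + b) / a"
  show ?thesis
  \<comment> \<open>Moving \<open>y\<close> to a vertex costs \<open>K\<close> in the datum and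
    \<open>R\<close> in the travel cost, averaging costs \<open>2 * R\<close>; one unit each goes to
    the convex perturbation, to the penalty in the level and to raising the level above
    \<open>M\<close>.\<close>
  proof (rule exI[of _ "K + 3 * R + 3"], intro allI impI)
    fix u :: "real \<times> real \<Rightarrow> real" and L N x t y :: real
    assume sub: "viscosity_subsolution (UNIV \<times> {0<..}) (\<lambda>(x, t) r (q, \<tau>). \<tau> + H x q) u"
      and lip: "L-lipschitz_on (UNIV \<times> {0..}) u" and N: "\<forall>x. \<bar>u (x, 0)\<bar> \<le> N"
      and uK: "\<forall>x y. u (x, 0) \<le> u (y, 0) + K * \<bar>x - y\<bar>" and t: "0 \<le> t"
    have bound: "\<bar>q\<bar> \<le> R" if "H z q \<le> C1" for z q
      using ab(2)[of q z] that ab(1) by (simp add: R_def pos_le_divide_eq mult.commute)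
    \<comment> \<open>Small enough that the perturbation changes \<open>H\<close> at
      \<open>K + 1\<close> and \<open>- (K + 1)\<close> by at most one and accumulates at most one
      up to time \<open>t\<close>.\<close>
    define \<delta> where "\<delta> = 1 / ((K + 1)\<^sup>2 + R\<^sup>2 * t + 1)"
    have den: "(K + 1)\<^sup>2 + R\<^sup>2 * t + 1 > 0" using t by (simp add: add_nonneg_pos)
    then have \<delta>: "\<delta> > 0" by (simp add: \<delta>_def)
    have \<delta>K: "\<delta> * (K + 1)\<^sup>2 \<le> 1" and \<delta>R: "\<delta> * R\<^sup>2 * t \<le> 1"
      using den t by (simp_all add: \<delta>_def pos_divide_le_eq)
    let ?H = "\<lambda>y p. H y p + \<delta> * p\<^sup>2"
    interpret s: strictly_convex_Hamiltonian ?H by (rule strictly_convex_perturbation[OF \<delta>])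
    have growth: "a * \<bar>p\<bar> - b \<le> ?H y p" for y p using ab(2)[of p y] \<delta> by (simp add: add_increasing2)
    have MM: "M \<le> s.M"
    proof (rule critical_le)
      fix y
      obtain p where "?H y p \<le> s.M" using s.sublevel_nonempty[of s.M y] by auto
      moreover have "0 \<le> \<delta> * p\<^sup>2" using \<delta> by simp
      ultimately have "H y p \<le> s.M" by linarith
      then show "\<exists>p. H y p \<le> s.M" by blast
    qed
    have HK: "?H x (K + 1) \<le> C1" "?H x (- (K + 1)) \<le> C1" for x
      using C1(2,3)[of x] \<delta>K unfolding power2_minus by linarith+
    have sMC1: "s.M \<le> C1" by (rule s.critical_le) (use HK in blast)
    define \<sigma> where "\<sigma> = 1 / (1 + (C1 - s.M)\<^sup>2)"
    have "1 + (C1 - s.M)\<^sup>2 > 0" by (simp add: add_pos_nonneg)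
    then have \<sigma>: "\<sigma> > 0" "\<sigma> * (C1 - s.M)\<^sup>2 \<le> 1" by (simp_all add: \<sigma>_def pos_divide_le_eq)
    obtain x0 where x0: "\<bar>y - x0\<bar> \<le> 1" "\<And>p. s.M \<le> ?H x0 p" using s.lattice_point by blast
    have bar: "barrier x0 s.M C1 \<sigma> ((C1 + b) / a) s.U s.D"
      by (rule s.barrier[OF growth ab(1) sMC1 \<sigma>(1) x0(2)])
    interpret b: barrier x0 s.M C1 \<sigma> "(C1 + b) / a" s.U s.D by (rule bar)
    have slopes: "K + 1 \<le> s.U x C1" "s.D x C1 \<le> - (K + 1)" for x
      using s.slope_le_U[OF HK(1)[of x]] s.D_le_slope[OF HK(2)[of x]] by auto
    have "\<exists>c\<in>{s.M..C1}. u (x, t) \<le> u (x0, 0) + b.A x c - c * t + \<delta> * R\<^sup>2 * t + \<sigma> * (C1 - s.M)\<^sup>2"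
    proof (rule s.subsolution_le_barrier[OF bar sub _ lip])
      fix z q assume "?H z q \<le> C1"
      moreover have "0 \<le> \<delta> * q\<^sup>2" using \<delta> by simp
      ultimately have "\<bar>q\<bar> \<le> R" by (intro bound[of z]) linarith
      then have "q\<^sup>2 \<le> R\<^sup>2" by (metis abs_ge_zero power2_abs power_mono)
      then have "\<delta> * q\<^sup>2 \<le> \<delta> * R\<^sup>2" using \<delta> by (intro mult_left_mono) auto
      then show "?H z q - \<delta> * R\<^sup>2 \<le> H z q" by simp
    next
      fix z
      have "u (z, 0) \<le> u (x0, 0) + K * \<bar>z - x0\<bar>" using uK by blast
      also have "K * \<bar>z - x0\<bar> \<le> (K + 1) * \<bar>z - x0\<bar>" by (intro mult_right_mono) auto
      finally show "u (z, 0) \<le> u (x0, 0) + (K + 1) * \<bar>z - x0\<bar>" by simp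
    qed (use K N slopes t in auto)
    then obtain c where c: "s.M \<le> c" "c \<le> C1"
      "u (x, t) \<le> u (x0, 0) + b.A x c - c * t + \<delta> * R\<^sup>2 * t + \<sigma> * (C1 - s.M)\<^sup>2" by auto
    \<comment> \<open>The optimal level may be \<open>M\<close> itself, where the slopes of the
      unperturbed \<open>H\<close> need not be continuous. It is raised by at most
      \<open>\<eta>\<close>, which costs at most one in \<open>c * t\<close>.\<close>
    define \<eta> where "\<eta> = min (1 / (1 + t)) (C1 - M)"
    have \<eta>: "0 < \<eta>" "\<eta> * t \<le> 1" "M + \<eta> \<le> C1"
    proof -
      have "\<eta> * t \<le> 1 / (1 + t) * t" using t by (intro mult_right_mono) (auto simp: \<eta>_def)
      also have "\<dots> \<le> 1" using t by (simp add: divide_le_eq)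
      finally show "\<eta> * t \<le> 1" .
    qed (use t C1(1) in \<open>auto simp: \<eta>_def\<close>)
    define c' where "c' = max c (M + \<eta>)"
    have c': "M < c'" "c' \<le> C1" "c \<le> c'" "c' \<le> c + \<eta>" using \<eta> c MM by (auto simp: c'_def)
    have "b.A x c \<le> travel_cost H c' (x - x0) + 2 * R"
      unfolding b.A_def
    proof (rule barrier_integral_le[OF ab(2,1) R_def c'(1,2)])
      show "continuous_on UNIV (\<lambda>z. s.U z c)" "continuous_on UNIV (\<lambda>z. s.D z c)"
        using c b.Br_cont_slice b.Bl_cont_slice by auto
      have "H z p \<le> c'" if "?H z p \<le> c" for z p 
      proof -
        have "0 \<le> \<delta> * p\<^sup>2" using \<delta> by simp
        then show ?thesis using that c' by linarith
      qed
      then show "s.U z c \<le> U z c'" "D z c' \<le> s.D z c" for z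
        using s.H_U[OF c(1), of z] s.H_D[OF c(1), of z] by (auto intro!: slope_le_U D_le_slope)
    qed
    also have "travel_cost H c' (x - x0) \<le> travel_cost H c' (x - y) + R * \<bar>(x - x0) - (x - y)\<bar>"
      by (rule travel_cost_lipschitz[OF ab(2,1) R_def c'(1,2)])
    also have "R * \<bar>(x - x0) - (x - y)\<bar> \<le> R"
    proof -
      have "0 \<le> R" using slopes_le(1)[OF ab(2,1) R_def, of C1 0] C1(1) by linarith
      then show ?thesis using x0(1) mult_left_mono[of "\<bar>y - x0\<bar>" 1 R] by simp
    qed
    finally have "b.A x c \<le> travel_cost H c' (x - y) + 3 * R" by simp
    moreover have "- c * t \<le> - c' * t + 1"
    proof -
      have "c' * t \<le> (c + \<eta>) * t" using c' t by (intro mult_right_mono)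
      then show ?thesis using \<eta>(2) by (simp add: algebra_simps)
    qed
    moreover have "u (x0, 0) \<le> u (y, 0) + K"
    proof -
      have "u (x0, 0) \<le> u (y, 0) + K * \<bar>x0 - y\<bar>" using uK by blast
      moreover have "K * \<bar>x0 - y\<bar> \<le> K * 1" using x0(1) K by (intro mult_left_mono) auto
      ultimately show ?thesis by simp
    qed
    ultimately have "u (x, t) \<le> u (y, 0) + travel_cost H c' (x - y) - c' * t + (K + 3 * R + 3)"
      using c(3) \<delta>R \<sigma>(2) by linarith
    then show "\<exists>c. M < c \<and> c \<le> C1 \<and> u (x, t) \<le> u (y, 0) + travel_cost H c (x - y) - c * t + (K + 3 * R + 3)"
      using c' by blast
  qed
qed

text \<open>Looking one unit of time ahead replaces \<open>x\<close> by a nearby point where \<open>min H = M\<close>, at bounded cost.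
  As \<open>\<delta>\<close> may depend on \<open>t\<close>, the error \<open>\<delta> R\<^sup>2 t\<close> of the perturbation is bounded uniformly in \<open>t\<close>.\<close>

theorem supersolution_lower_bound:
  assumes K: "K \<ge> 0" and C1: "M < C1" "\<And>x. H x (K + 1) \<le> C1 - 1" "\<And>x. H x (- (K + 1)) \<le> C1 - 1"
  shows "\<exists>C. \<forall>u L N. viscosity_supersolution (UNIV \<times> {0<..}) (\<lambda>(x, t) r (q, \<tau>). \<tau> + H x q) u \<longrightarrow>
     L-lipschitz_on (UNIV \<times> {0..}) u \<longrightarrow> (\<forall>x. \<bar>u (x, 0)\<bar> \<le> N) \<longrightarrow>
     (\<forall>x t. 0 \<le> t \<longrightarrow> (\<exists>y. \<forall>c. M < c \<longrightarrow> c \<le> C1 \<longrightarrow> u (y, 0) + travel_cost H c (x - y) - c * t - C \<le> u (x, t)))"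
proof -
  obtain a b where ab: "a > 0" "\<And>y p. a * \<bar>p\<bar> - b \<le> H y p" using linear_growth by blast
  \<comment> \<open>The perturbed barrier reaches the slopes of \<open>H\<close> on level
    \<open>c\<close> only at level \<open>c + \<delta> * R\<^sup>2 \<le> c + 1\<close>; the extra
    unit makes room for every \<open>c \<le> C1\<close>.\<close>
  define C2 where "C2 = C1 + 1"
  define R where "R = (C2 + b) / a"
  have ab': "\<And>y p. a * \<bar>p\<bar> - b \<le> H y (- p)" using ab(2)[of "- p" for p] by simp
  interpret r: convex_Hamiltonian "\<lambda>y p. H y (- p)" by (rule reflected)
  have rM: "r.M = M" by (rule critical_level_reflected)
  have R0: "0 \<le> R" using slopes_le[OF ab(2,1) R_def, of C1 0] C1(1) by (auto simp: C2_def)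
  show ?thesis
  \<comment> \<open>Averaging costs \<open>2 * R\<close>, shifting \<open>x\<close> to the vertex
    \<open>R\<close>, and the barrier at time one \<open>R + \<bar>M\<bar>\<close>. The additional
    unit of time costs the level \<open>c\<close>, at most
    \<open>\<bar>M\<bar> + \<bar>C1\<bar>\<close>; the number covers the perturbation and the
    penalty.\<close>
  proof (rule exI[of _ "4 * R + 2 * \<bar>M\<bar> + \<bar>C1\<bar> + 3"], intro allI impI)
    fix u :: "real \<times> real \<Rightarrow> real" and L N x t :: real
    assume super: "viscosity_supersolution (UNIV \<times> {0<..}) (\<lambda>(x, t) r (q, \<tau>). \<tau> + H x q) u"
      and lip: "L-lipschitz_on (UNIV \<times> {0..}) u" and N: "\<forall>x. \<bar>u (x, 0)\<bar> \<le> N" and t: "0 \<le> t"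
    have bound: "\<bar>q\<bar> \<le> R" if "H z q \<le> C1" for z q
    proof -
      have "a * \<bar>q\<bar> \<le> C2 + b" using ab(2)[of q z] that by (simp add: C2_def)
      then show ?thesis using ab(1) by (simp add: R_def pos_le_divide_eq mult.commute)
    qed
    define \<delta> where "\<delta> = 1 / ((K + 1)\<^sup>2 + R\<^sup>2 * (t + 1) + 1)"
    have den: "(K + 1)\<^sup>2 + R\<^sup>2 * (t + 1) + 1 > 0" using t by (simp add: add_nonneg_pos)
    then have \<delta>: "\<delta> > 0" by (simp add: \<delta>_def)
    have \<delta>K: "\<delta> * (K + 1)\<^sup>2 \<le> 1" and \<delta>Rt: "\<delta> * R\<^sup>2 * (t + 1) \<le> 1"
      using den t by (simp_all add: \<delta>_def pos_divide_le_eq)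
    have \<delta>R0: "0 \<le> \<delta> * R\<^sup>2" using \<delta> by simp
    have \<delta>R: "\<delta> * R\<^sup>2 \<le> 1"
    proof -
      have "\<delta> * R\<^sup>2 * 1 \<le> \<delta> * R\<^sup>2 * (t + 1)" using \<delta>R0 t by (intro mult_left_mono) auto
      with \<delta>Rt show ?thesis by simp
    qed
    let ?H = "\<lambda>y p. H y (- p) + \<delta> * p\<^sup>2"
    interpret s: strictly_convex_Hamiltonian ?H by (rule r.strictly_convex_perturbation[OF \<delta>])
    have growth: "a * \<bar>p\<bar> - b \<le> ?H y p" for y p using ab'[of p y] \<delta> by (simp add: add_increasing2)
    have MM: "M \<le> s.M"
    proof (rule critical_le)
      fix y
      obtain p where "?H y p \<le> s.M" using s.sublevel_nonempty[of s.M y] by auto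
      moreover have "0 \<le> \<delta> * p\<^sup>2" using \<delta> by simp
      ultimately have "H y (- p) \<le> s.M" by linarith
      then show "\<exists>p. H y p \<le> s.M" by blast
    qed
    have HK: "?H x (K + 1) \<le> C2" "?H x (- (K + 1)) \<le> C2" for x
      using C1(2,3)[of x] \<delta>K unfolding power2_minus minus_minus C2_def by linarith+
    have perturb: "?H z p \<le> c + \<delta> * R\<^sup>2" if "H z (- p) \<le> c" "c \<le> C1" for z p c
    proof -
      have "\<bar>- p\<bar> \<le> R" using that by (intro bound[of z]) auto
      then have "p\<^sup>2 \<le> R\<^sup>2" by (metis abs_ge_zero abs_minus_cancel power2_abs power_mono)
      then have "\<delta> * p\<^sup>2 \<le> \<delta> * R\<^sup>2" using \<delta> by (intro mult_left_mono) auto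
      then show ?thesis using that by simp
    qed
    have sM: "s.M \<le> c + \<delta> * R\<^sup>2" if c: "M < c" "c \<le> C1" for c
    proof (rule s.critical_le)
      fix y
      obtain p where "H y p \<le> c" using sublevel_nonempty[of c y] c by auto
      then have "?H y (- p) \<le> c + \<delta> * R\<^sup>2" using c by (intro perturb) auto
      then show "\<exists>p. ?H y p \<le> c + \<delta> * R\<^sup>2" by blast
    qed
    have sMC: "s.M \<le> C2" using sM[of C1] C1(1) \<delta>R by (simp add: C2_def)
    define \<sigma> where "\<sigma> = 1 / (1 + (C2 - s.M)\<^sup>2)"
    have \<sigma>pos: "1 + (C2 - s.M)\<^sup>2 > 0" by (simp add: add_pos_nonneg)
    then have \<sigma>: "\<sigma> > 0" by (simp add: \<sigma>_def)
    have \<sigma>1: "\<sigma> * (c - s.M)\<^sup>2 \<le> 1" if "s.M \<le> c" "c \<le> C2" for c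
    proof -
      have "\<sigma> * (c - s.M)\<^sup>2 \<le> \<sigma> * (C2 - s.M)\<^sup>2" using that \<sigma> by (intro mult_left_mono power_mono) auto
      also have "\<dots> \<le> 1" using \<sigma>pos by (simp add: \<sigma>_def pos_divide_le_eq)
      finally show ?thesis .
    qed
    obtain x0 where x0: "\<bar>x - x0\<bar> \<le> 1" "\<And>p. s.M \<le> ?H x0 p" using s.lattice_point by blast
    have bar: "barrier x0 s.M C2 \<sigma> ((C2 + b) / a) s.U s.D"
      by (rule s.barrier[OF growth ab(1) sMC \<sigma> x0(2)])
    interpret b: barrier x0 s.M C2 \<sigma> "(C2 + b) / a" s.U s.D by (rule bar)
    have slopes: "K + 1 \<le> s.U x C2" "s.D x C2 \<le> - (K + 1)" for x
      using s.slope_le_U[OF HK(1)[of x]] s.D_le_slope[OF HK(2)[of x]] by auto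
    have "\<exists>y'. \<forall>y s. 0 \<le> s \<longrightarrow> s < t + 1 \<longrightarrow> u (y', 0) + b.F (y', t + 1) \<le> u (y, s) + b.F (y, t + 1 - s)"
    proof (rule s.supersolution_ge_barrier[OF bar super _ lip])
      show "H z (- q) \<le> ?H z q" for z q using \<delta> by simp
    qed (use K N slopes t in auto)
    then obtain y' where
      "\<forall>y s. 0 \<le> s \<longrightarrow> s < t + 1 \<longrightarrow> u (y', 0) + b.F (y', t + 1) \<le> u (y, s) + b.F (y, t + 1 - s)" ..
    from this[rule_format, of t x] t have y': "u (y', 0) + b.F (y', t + 1) \<le> u (x, t) + b.F (x, 1)"
      by simp
    \<comment> \<open>At time one and within distance one of the vertex the barrier is bounded above
      independently of \<open>t\<close>.\<close>
    obtain d where d: "d \<in> {s.M..C2}" "b.F (x, 1) \<le> b.A x d - d * 1" using b.F_attained by blast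
    have "b.A x d \<le> R"
      using b.A_lipschitz[OF d(1), of x x0] x0(1) mult_left_mono[OF x0(1) R0] by (simp add: b.A_x0 R_def)
    then have Fx: "b.F (x, 1) \<le> R + \<bar>M\<bar>" using d MM unfolding atLeastAtMost_iff by linarith
    show "\<exists>y. \<forall>c. M < c \<longrightarrow> c \<le> C1 \<longrightarrow>
        u (y, 0) + travel_cost H c (x - y) - c * t - (4 * R + 2 * \<bar>M\<bar> + \<bar>C1\<bar> + 3) \<le> u (x, t)"
    proof (rule exI[of _ y'], intro allI impI)
      fix c assume c: "M < c" "c \<le> C1"
      define c' where "c' = c + \<delta> * R\<^sup>2"
      have c': "c' \<in> {s.M..C2}" using sM[OF c] c \<delta>R by (simp add: c'_def C2_def)
      have "travel_cost (\<lambda>y p. H y (- p)) c (y' - x0) - 2 * R \<le> b.A y' c'"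
        unfolding b.A_def
      proof (rule r.barrier_integral_ge[OF ab' ab(1) R_def])
        show "r.M < c" "c \<le> C2" using c by (auto simp: rM C2_def)
        show "continuous_on UNIV (\<lambda>z. s.U z c')" "continuous_on UNIV (\<lambda>z. s.D z c')"
          using c' b.Br_cont_slice b.Bl_cont_slice by auto
        show "r.U z c \<le> s.U z c'" for z
          unfolding c'_def using c r.H_U[of c z] by (intro s.slope_le_U perturb) (auto simp: rM)
        show "s.D z c' \<le> r.D z c" for z
          unfolding c'_def using c r.H_D[of c z] by (intro s.D_le_slope perturb) (auto simp: rM)
      qed
      then have A: "travel_cost H c (x0 - y') - 2 * R \<le> b.A y' c'" by (simp add: travel_cost_reflected)
      have "travel_cost H c (x - y') \<le> travel_cost H c (x0 - y') + R * \<bar>(x - y') - (x0 - y')\<bar>"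
        using c by (intro travel_cost_lipschitz[OF ab(2,1) R_def]) (auto simp: C2_def)
      also have "R * \<bar>(x - y') - (x0 - y')\<bar> \<le> R" using x0(1) mult_left_mono[OF x0(1) R0] by simp
      finally have cost: "travel_cost H c (x - y') \<le> travel_cost H c (x0 - y') + R" by simp
      have "b.A y' c' - c' * (t + 1) - \<sigma> * (c' - s.M)\<^sup>2 \<le> b.F (y', t + 1)" by (rule b.F_ge[OF c'])
      moreover have "\<sigma> * (c' - s.M)\<^sup>2 \<le> 1" using c' by (intro \<sigma>1) auto
      moreover have "c' * (t + 1) \<le> c * t + \<bar>M\<bar> + \<bar>C1\<bar> + 1"
      proof -
        have "c' * (t + 1) = c * t + c + \<delta> * R\<^sup>2 * (t + 1)" by (simp add: c'_def algebra_simps)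
        then show ?thesis using \<delta>Rt c by linarith
      qed
      ultimately show "u (y', 0) + travel_cost H c (x - y') - c * t - (4 * R + 2 * \<bar>M\<bar> + \<bar>C1\<bar> + 3) \<le> u (x, t)"
        using A cost y' Fx by linarith
    qed
  qed
qed

end

section \<open>The cell problem\<close>

lemma periodic_attains_max:
  fixes f :: "real \<Rightarrow> real"
  assumes cont: "continuous_on UNIV f" and per: "\<And>x. f (x + 1) = f x"
  shows "\<exists>y. \<forall>x. f x \<le> f y"
proof -
  interpret periodic_fun_simple' f by standard (rule per)
  have "compact {0..1::real}" "{0..1::real} \<noteq> {}" by auto
  from continuous_attains_sup[OF this continuous_on_subset[OF cont]]
  obtain y where y: "\<forall>x\<in>{0..1}. f x \<le> f y" by auto
  have "f x \<le> f y" for x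
  proof -
    have "frac x \<in> {0..1}" by (simp add: frac_lt_1 less_imp_le)
    then have "f (frac x) \<le> f y" using y by blast
    moreover have "f (frac x) = f x" using minus_of_int[of x "\<lfloor>x\<rfloor>"] by (simp add: frac_def)
    ultimately show ?thesis by simp
  qed
  then show ?thesis by blast
qed

lemma periodic_antiderivative:
  fixes f :: "real \<Rightarrow> real"
  assumes cont: "continuous_on UNIV f" and per: "\<And>x. f (x + 1) = f x" and mean: "integral {0..1} f = 0"
  obtains \<Phi> where "\<And>x. DERIV \<Phi> x :> f x" "\<And>x. \<Phi> (x + 1) = \<Phi> x"
proof -
  have "isCont f x" for x using cont by (simp add: continuous_on_eq_continuous_at)
  then obtain \<Phi> where \<Phi>: "\<And>x. DERIV \<Phi> x :> f x"
    using einterval_antiderivative[of "-\<infinity>" \<infinity> f] by (auto simp: has_real_derivative_iff_has_vector_derivative)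
  have "DERIV (\<lambda>x. \<Phi> (x + 1) - \<Phi> x) x :> 0" for x
  proof -
    have "DERIV (\<lambda>x. \<Phi> (x + 1)) x :> f (x + 1)" using \<Phi>[of "x + 1"] by (simp add: DERIV_shift)
    from DERIV_diff[OF this \<Phi>[of x]] show ?thesis by (simp add: per)
  qed
  then have const: "\<Phi> (x + 1) - \<Phi> x = \<Phi> (0 + 1) - \<Phi> 0" for x by (intro DERIV_isconst_all) blast
  have "(f has_integral (\<Phi> 1 - \<Phi> 0)) {0..1}"
    by (rule fundamental_theorem_of_calculus)
       (auto simp: has_real_derivative_iff_has_vector_derivative[symmetric] intro: has_field_derivative_at_within \<Phi>)
  then have "\<Phi> 1 - \<Phi> 0 = 0" using mean by (simp add: integral_unique)
  then have "\<Phi> (x + 1) = \<Phi> x" for x using const[of x] by simp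
  with \<Phi> show ?thesis by (rule that)
qed

section \<open>Uniqueness of the cell level and smooth correctors\<close>

context convex_Hamiltonian
begin

lemma cell_subsolution_touching:
  fixes v \<psi> :: "real \<Rightarrow> real"
  assumes v: "solves_cell_problem H p c v"
    and \<psi>: "\<And>x. DERIV \<psi> x :> s x" "continuous_on UNIV s"
    and max: "\<And>x. v x - \<psi> x \<le> v y - \<psi> y"
  shows "H y (p + s y) \<le> c"
proof -
  have "C1_with_gradient UNIV \<psi> s" using \<psi> by (simp add: C1_with_gradient_def)
  moreover have "viscosity_subsolution UNIV (\<lambda>y r q. H y (p + q) - c) v"
    using v by (simp add: solves_cell_problem_def viscosity_solution_def)
  moreover have "\<forall>\<^sub>F x in at y. v x - \<psi> x \<le> v y - \<psi> y" using max by simp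
  ultimately have "H y (p + s y) - c \<le> 0" unfolding viscosity_subsolution_def by blast
  then show ?thesis by simp
qed

lemma cell_supersolution_touching:
  fixes v \<psi> :: "real \<Rightarrow> real"
  assumes v: "solves_cell_problem H p c v"
    and \<psi>: "\<And>x. DERIV \<psi> x :> s x" "continuous_on UNIV s"
    and min: "\<And>x. v x - \<psi> x \<ge> v y - \<psi> y"
  shows "H y (p + s y) \<ge> c"
proof -
  have "C1_with_gradient UNIV \<psi> s" using \<psi> by (simp add: C1_with_gradient_def)
  moreover have "viscosity_supersolution UNIV (\<lambda>y r q. H y (p + q) - c) v"
    using v by (simp add: solves_cell_problem_def viscosity_solution_def)
  moreover have "\<forall>\<^sub>F x in at y. v x - \<psi> x \<ge> v y - \<psi> y" using min by simp
  ultimately have "H y (p + s y) - c \<ge> 0" unfolding viscosity_supersolution_def by blast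
  then show ?thesis by simp
qed

lemma cell_continuous: "solves_cell_problem H p c v \<Longrightarrow> continuous_on UNIV v"
  and cell_periodic: "solves_cell_problem H p c v \<Longrightarrow> v (x + 1) = v x"
  by (auto simp: solves_cell_problem_def viscosity_solution_def viscosity_subsolution_def
      periodic_fun_simple'_def)

text \<open>A convex combination of the two branches on level \<open>c'\<close> with mean
  \<open>p\<close> is \<open>p\<close> plus the derivative of a periodic function. Touching
  \<open>v\<close> from below with that function, the supersolution property gives \<open>c\<close>
  at most the value of \<open>H\<close> on a slope between the branches.\<close>

lemma cell_level_le:
  assumes v: "solves_cell_problem H p c v" and c': "M < c'"
    and p: "mean_lower H c' \<le> p" "p \<le> mean_upper H c'"
  shows "c \<le> c'"
proof -
  let ?P = "mean_upper H c'" and ?Q = "mean_lower H c'"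
  obtain \<theta> where \<theta>: "0 \<le> \<theta>" "\<theta> \<le> 1" "p = (1 - \<theta>) * ?Q + \<theta> * ?P"
  proof (cases "?P = ?Q")
    case True
    then show ?thesis using that[of 0] p by simp
  next
    case False
    define \<theta> where "\<theta> = (p - ?Q) / (?P - ?Q)"
    have "\<theta> * (?P - ?Q) = p - ?Q" using False by (simp add: \<theta>_def)
    moreover have "0 \<le> \<theta>" "\<theta> \<le> 1" using p False by (auto simp: \<theta>_def divide_simps)
    ultimately show ?thesis using that[of \<theta>] by (simp add: algebra_simps)
  qed
  define s where "s y = (1 - \<theta>) * D y c' + \<theta> * U y c' - p" for y
  have s_cont: "continuous_on UNIV s"
    unfolding s_def by (intro continuous_intros slopes_continuous_gt c')
  have s_per: "s (y + 1) = s y" for y by (simp add: s_def U_periodic D_periodic)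
  have "integral {0..1} s = integral {0..1} (\<lambda>y. (1 - \<theta>) * D y c' + \<theta> * U y c') - integral {0..1} (\<lambda>y::real. p)"
    unfolding s_def
    by (intro integral_diff integrable_continuous_real continuous_intros slopes_continuous_gt c')
  also have "integral {0..1} (\<lambda>y. (1 - \<theta>) * D y c' + \<theta> * U y c')
      = integral {0..1} (\<lambda>y. (1 - \<theta>) * D y c') + integral {0..1} (\<lambda>y. \<theta> * U y c')"
    by (intro integral_add integrable_continuous_real continuous_intros slopes_continuous_gt c')
  finally have "integral {0..1} s = 0" using \<theta> by (simp add: mean_upper_def mean_lower_def)
  from periodic_antiderivative[OF s_cont s_per this]
  obtain \<psi> where \<psi>: "\<And>x. DERIV \<psi> x :> s x" "\<And>x. \<psi> (x + 1) = \<psi> x" by blast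
  have \<psi>_cont: "continuous_on UNIV \<psi>" by (rule DERIV_continuous_on) (rule \<psi>(1))
  have "continuous_on UNIV (\<lambda>x. - (v x - \<psi> x))"
    by (intro continuous_on_minus continuous_on_diff cell_continuous[OF v] \<psi>_cont)
  then obtain y where y: "\<forall>x. - (v x - \<psi> x) \<le> - (v y - \<psi> y)"
    using periodic_attains_max[of "\<lambda>x. - (v x - \<psi> x)"] cell_periodic[OF v] \<psi>(2) by auto
  have "v y - \<psi> y \<le> v x - \<psi> x" for x using y[rule_format, of x] by simp
  then have "c \<le> H y (p + s y)" by (rule cell_supersolution_touching[OF v \<psi>(1) s_cont])
  also have "\<dots> \<le> c'"
  proof -
    have "D y c' \<le> U y c'" using c' by (intro D_le_U) simp
    then have "\<theta> * D y c' \<le> \<theta> * U y c'" "(1 - \<theta>) * D y c' \<le> (1 - \<theta>) * U y c'"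
      using \<theta> by (auto intro: mult_left_mono)
    then have "D y c' \<le> p + s y \<and> p + s y \<le> U y c'" by (simp add: s_def algebra_simps)
    then show ?thesis using c' by (simp add: sublevel_iff)
  qed
  finally show ?thesis .
qed

text \<open>If \<open>p\<close> were beyond a mean, shifting the corresponding branch to mean
  \<open>p\<close> would give a periodic test function whose slopes all lie outside the sublevel set
  of \<open>c'\<close>, against the subsolution property.\<close>

lemma cell_slope_bounds:
  assumes v: "solves_cell_problem H p c v" and c': "M < c'" "c < c'"
  shows "p \<le> mean_upper H c'" "mean_lower H c' \<le> p"
proof -
  have contradiction: False
    if s: "continuous_on UNIV s" "\<And>y. s (y + 1) = s y" "integral {0..1} s = 0" "\<And>y. c' < H y (p + s y)" for s
  proof -
    from periodic_antiderivative[OF s(1-3)]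
    obtain \<psi> where \<psi>: "\<And>x. DERIV \<psi> x :> s x" "\<And>x. \<psi> (x + 1) = \<psi> x" by blast
    have \<psi>_cont: "continuous_on UNIV \<psi>" by (rule DERIV_continuous_on) (rule \<psi>(1))
    have "continuous_on UNIV (\<lambda>x. v x - \<psi> x)"
      by (intro continuous_on_diff cell_continuous[OF v] \<psi>_cont)
    then obtain y where y: "\<And>x. v x - \<psi> x \<le> v y - \<psi> y"
      using periodic_attains_max[of "\<lambda>x. v x - \<psi> x"] cell_periodic[OF v] \<psi>(2) by auto
    have "H y (p + s y) \<le> c" by (rule cell_subsolution_touching[OF v \<psi>(1) s(1) y])
    then show False using s(4)[of y] c' by simp
  qed
  show "p \<le> mean_upper H c'"
  proof (rule ccontr)
    assume *: "\<not> ?thesis"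
    let ?s = "\<lambda>y. U y c' - mean_upper H c'"
    have "integral {0..1} ?s = integral {0..1} (\<lambda>y. U y c') - integral {0..1} (\<lambda>y::real. mean_upper H c')"
      by (intro integral_diff integrable_continuous_real continuous_intros slopes_continuous_gt c')
    then have "integral {0..1} ?s = 0" by (simp add: mean_upper_def)
    moreover have "c' < H y (p + ?s y)" for y
    proof (rule ccontr)
      assume "\<not> c' < H y (p + ?s y)"
      then have "p + ?s y \<le> U y c'" by (intro slope_le_U) simp
      then show False using * by simp
    qed
    ultimately show False
      by (intro contradiction[of ?s]) (auto intro!: continuous_intros slopes_continuous_gt c' simp: U_periodic)
  qed
  show "mean_lower H c' \<le> p"
  proof (rule ccontr)
    assume *: "\<not> ?thesis"
    let ?s = "\<lambda>y. D y c' - mean_lower H c'"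
    have "integral {0..1} ?s = integral {0..1} (\<lambda>y. D y c') - integral {0..1} (\<lambda>y::real. mean_lower H c')"
      by (intro integral_diff integrable_continuous_real continuous_intros slopes_continuous_gt c')
    then have "integral {0..1} ?s = 0" by (simp add: mean_lower_def)
    moreover have "c' < H y (p + ?s y)" for y
    proof (rule ccontr)
      assume "\<not> c' < H y (p + ?s y)"
      then have "D y c' \<le> p + ?s y" by (intro D_le_slope) simp
      then show False using * by simp
    qed
    ultimately show False
      by (intro contradiction[of ?s]) (auto intro!: continuous_intros slopes_continuous_gt c' simp: D_periodic)
  qed
qed

text \<open>Steep parabolas centred at \<open>y\<close> touch \<open>v\<close> from above
  arbitrarily close to \<open>y\<close>. Coercivity bounds the slopes at the touching points, and a
  limit slope lies in the sublevel set at \<open>y\<close> itself.\<close>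

lemma cell_level_ge_critical:
  assumes v: "solves_cell_problem H p c v"
  shows "M \<le> c"
proof (rule critical_le)
  fix y
  have v_cont: "continuous_on UNIV v" by (rule cell_continuous[OF v])
  obtain ymax where ymax: "\<And>x. v x \<le> v ymax"
    using periodic_attains_max[OF v_cont cell_periodic[OF v]] by blast
  define E where "E = v ymax - v y"
  have E: "0 \<le> E" using ymax[of y] by (simp add: E_def)
  have "\<exists>z q. (real n + 1) * (z - y)\<^sup>2 \<le> E \<and> H z q \<le> c" for n
  proof -
    define \<psi> where "\<psi> x = (real n + 1) * (x - y)\<^sup>2" for x
    have \<psi>: "DERIV \<psi> x :> (real n + 1) * (2 * (x - y))" for x
      unfolding \<psi>_def by (auto intro!: derivative_eq_intros)
    have close: "(real n + 1) * (x - y)\<^sup>2 \<le> E" if "v y - \<psi> y \<le> v x - \<psi> x" for x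
      using that ymax[of x] by (simp add: \<psi>_def E_def)
    have "\<exists>z\<in>UNIV. \<forall>x\<in>UNIV. v x - \<psi> x \<le> v z - \<psi> z"
    proof (rule attains_max_if_bounded_superlevel[of _ _ y])
      show "continuous_on UNIV (\<lambda>x. v x - \<psi> x)"
        by (intro continuous_on_diff v_cont DERIV_continuous_on) (rule \<psi>)
      show "bounded {x \<in> UNIV. v y - \<psi> y \<le> v x - \<psi> x}"
      proof (rule bounded_subset[OF bounded_closed_interval])
        show "{x \<in> UNIV. v y - \<psi> y \<le> v x - \<psi> x} \<subseteq> {y - (E + 1)..y + (E + 1)}"
        proof
          fix x assume "x \<in> {x \<in> UNIV. v y - \<psi> y \<le> v x - \<psi> x}"
          then have "(real n + 1) * (x - y)\<^sup>2 \<le> E" by (intro close) simp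
          moreover have "1 * (x - y)\<^sup>2 \<le> (real n + 1) * (x - y)\<^sup>2" by (intro mult_right_mono) auto
          ultimately have "(x - y)\<^sup>2 \<le> E" by simp
          also have "E \<le> (E + 1)\<^sup>2" using E by (simp add: power2_eq_square algebra_simps)
          finally have "\<bar>x - y\<bar> \<le> E + 1" using E by (metis abs_le_square_iff abs_of_nonneg add_nonneg_nonneg zero_le_one)
          then show "x \<in> {y - (E + 1)..y + (E + 1)}" by (auto simp: abs_le_iff)
        qed
      qed
    qed auto
    then obtain z where z: "\<And>x. v x - \<psi> x \<le> v z - \<psi> z" by blast
    have "H z (p + (real n + 1) * (2 * (z - y))) \<le> c"
      by (rule cell_subsolution_touching[OF v \<psi> _ z]) (intro continuous_intros)
    then show ?thesis using close[OF z] by blast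
  qed
  then obtain z q where zq: "\<And>n. (real n + 1) * (z n - y)\<^sup>2 \<le> E" "\<And>n. H (z n) (q n) \<le> c" by metis
  have z_lim: "z \<longlonglongrightarrow> y"
  proof -
    have "(\<lambda>n. \<bar>z n - y\<bar>) \<longlonglongrightarrow> 0"
    proof (rule tendsto_sandwich[OF always_eventually always_eventually tendsto_const])
      have "\<bar>z n - y\<bar> \<le> sqrt (E * (1 / (real n + 1)))" for n
        using zq(1)[of n] by (intro real_le_rsqrt) (simp add: field_simps)
      then show "\<forall>n. \<bar>z n - y\<bar> \<le> sqrt (E * (1 / (real n + 1)))" by blast
      have "(\<lambda>n. sqrt (E * (1 / (real n + 1)))) \<longlonglongrightarrow> sqrt (E * 0)"
        using LIMSEQ_inverse_real_of_nat by (intro tendsto_intros) (simp add: inverse_eq_divide add.commute)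
      then show "(\<lambda>n. sqrt (E * (1 / (real n + 1)))) \<longlonglongrightarrow> 0" by simp
    qed simp
    then show ?thesis using LIM_zero_cancel tendsto_rabs_zero_iff by blast
  qed
  obtain R where R: "\<And>y q. H y q \<le> c \<Longrightarrow> \<bar>q\<bar> \<le> R" using bounded_sublevel by blast
  have "q n \<in> {-R..R}" for n using R[OF zq(2)[of n]] by (simp add: abs_le_iff minus_le_iff)
  then obtain l r where l: "strict_mono r" "(q \<circ> r) \<longlonglongrightarrow> l"
    using seq_compactE[OF compact_imp_seq_compact[OF compact_Icc]] by blast
  have "(\<lambda>n. H ((z \<circ> r) n) ((q \<circ> r) n)) \<longlonglongrightarrow> H y l"
    using l LIMSEQ_subseq_LIMSEQ[OF z_lim l(1)] by (intro continuous_at_H)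
  moreover have "\<exists>N. \<forall>n\<ge>N. H ((z \<circ> r) n) ((q \<circ> r) n) \<le> c" using zq(2) by simp
  ultimately have "H y l \<le> c" by (rule LIMSEQ_le_const2)
  then show "\<exists>q. H y q \<le> c" by blast
qed

lemma cell_level_unique:
  assumes "solves_cell_problem H p c v" "solves_cell_problem H p c' v'"
  shows "c = c'"
proof -
  have le: "c' \<le> c" if v: "solves_cell_problem H p c v" and v': "solves_cell_problem H p c' v'" for c c' v v'
  proof (rule field_le_epsilon)
    fix e :: real assume "e > 0"
    then have "M < c + e" "c < c + e" using cell_level_ge_critical[OF v] by auto
    from cell_slope_bounds[OF v this] show "c' \<le> c + e"
      by (intro cell_level_le[OF v' \<open>M < c + e\<close>])
  qed
  from le[OF assms] le[OF assms(2,1)] show ?thesis by simp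
qed

lemma mean_continuous: "continuous_on {M<..} (mean_upper H)" "continuous_on {M<..} (mean_lower H)"
proof -
  have "continuous_on {M<..} (\<lambda>c. integral (cbox 0 1) (\<lambda>y. U y c))"
    by (intro integral_continuous_on_param)
       (auto simp: case_prod_beta intro!: continuous_on_compose2[OF continuous_on_U_gt, of _ "\<lambda>z. (snd z, fst z)", simplified] continuous_intros)
  moreover have "continuous_on {M<..} (\<lambda>c. integral (cbox 0 1) (\<lambda>y. D y c))"
    by (intro integral_continuous_on_param)
       (auto simp: case_prod_beta intro!: continuous_on_compose2[OF continuous_on_D_gt, of _ "\<lambda>z. (snd z, fst z)", simplified] continuous_intros)
  ultimately show "continuous_on {M<..} (mean_upper H)" "continuous_on {M<..} (mean_lower H)"
    by (simp_all add: mean_upper_def[abs_def] mean_lower_def[abs_def])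
qed

lemma cell_problem_smooth:
  assumes s: "continuous_on UNIV s" "\<And>y. s (y + 1) = s y" "integral {0..1} s = p" "\<And>y. H y (s y) = c"
  shows "\<exists>v. solves_cell_problem H p c v"
proof -
  let ?s = "\<lambda>y. s y - p"
  have "integral {0..1} ?s = integral {0..1} s - integral {0..1} (\<lambda>y::real. p)"
    by (intro integral_diff integrable_continuous_real continuous_intros continuous_on_subset[OF s(1)]) auto
  then have mean: "integral {0..1} ?s = 0" using s(3) by simp
  have cont: "continuous_on UNIV ?s" by (intro continuous_intros s(1))
  obtain v where v: "\<And>x. DERIV v x :> s x - p" "\<And>x. v (x + 1) = v x"
    using periodic_antiderivative[OF cont _ mean] s(2) by auto
  have v_cont: "continuous_on UNIV v" by (rule DERIV_continuous_on) (rule v(1))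
  have eq: "H y (p + D\<phi> y) = c"
    if "C1_with_gradient UNIV \<phi> D\<phi>"
      and "(\<forall>\<^sub>F x in at y. v x - \<phi> x \<le> v y - \<phi> y) \<or> (\<forall>\<^sub>F x in at y. v y - \<phi> y \<le> v x - \<phi> x)" for \<phi> D\<phi> y
  proof -
    have "DERIV \<phi> y :> D\<phi> y" using that(1) by (simp add: C1_with_gradient_def)
    then have d: "DERIV (\<lambda>x. v x - \<phi> x) y :> s y - p - D\<phi> y" by (intro DERIV_diff v)
    from that(2) have "s y - p - D\<phi> y = 0"
    proof
      assume "\<forall>\<^sub>F x in at y. v x - \<phi> x \<le> v y - \<phi> y"
      then obtain e where "e > 0" "\<forall>x. \<bar>y - x\<bar> < e \<longrightarrow> v x - \<phi> x \<le> v y - \<phi> y"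
        by (auto simp: eventually_at dist_real_def abs_minus_commute) (metis order_refl)
      then show ?thesis by (rule DERIV_local_max[OF d])
    next
      assume "\<forall>\<^sub>F x in at y. v y - \<phi> y \<le> v x - \<phi> x"
      then obtain e where "e > 0" "\<forall>x. \<bar>y - x\<bar> < e \<longrightarrow> v y - \<phi> y \<le> v x - \<phi> x"
        by (auto simp: eventually_at dist_real_def abs_minus_commute) (metis order_refl)
      then show ?thesis by (rule DERIV_local_min[OF d])
    qed
    then have "p + D\<phi> y = s y" by simp
    then show ?thesis using s(4) by simp
  qed
  have "solves_cell_problem H p c v"
    unfolding solves_cell_problem_def viscosity_solution_def viscosity_subsolution_def viscosity_supersolution_def
    using v(2) v_cont eq by (auto simp: periodic_fun_simple'_def)
  then show ?thesis by blast
qed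

end

text \<open>Only a bound on \<open>b\<close> near \<open>y\<close> and increments on one side enter,
  so the lemma applies to slopes that are merely semicontinuous, as on the critical level.\<close>

lemma DERIV_le_if_increment_le:
  fixes \<psi> b :: "real \<Rightarrow> real"
  assumes \<psi>: "DERIV \<psi> y :> q" and b: "\<And>u v. b integrable_on {u..v}"
    and C: "b y \<le> C" "\<forall>\<^sub>F z in at y. b z \<le> C"
    and incr: "(\<forall>\<^sub>F z in at_left y. \<psi> y - \<psi> z \<le> integral {z..y} b) \<or>
      (\<forall>\<^sub>F z in at_right y. \<psi> z - \<psi> y \<le> integral {y..z} b)"
  shows "q \<le> C"
proof -
  obtain d where d: "d > 0" "\<And>z. \<bar>z - y\<bar> < d \<Longrightarrow> b z \<le> C"
    using C unfolding eventually_at dist_real_def by (metis UNIV_I)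
  have le: "integral {u..v} b \<le> C * (v - u)" if "u \<le> v" "y - d < u" "v < y + d" for u v
  proof -
    have "integral {u..v} b \<le> integral {u..v} (\<lambda>z. C)"
      using that by (intro integral_le b integrable_const_ivl d(2)) auto
    then show ?thesis using that by (simp add: mult.commute)
  qed
  have quotient: "((\<lambda>z. (\<psi> z - \<psi> y) / (z - y)) \<longlongrightarrow> q) (at y)"
    using \<psi> by (simp add: has_field_derivative_iff)
  from incr show ?thesis
  proof
    assume ev: "\<forall>\<^sub>F z in at_left y. \<psi> y - \<psi> z \<le> integral {z..y} b"
    have "\<forall>\<^sub>F z in at_left y. z \<in> {y - d<..<y}"
      using d(1) by (intro eventually_at_leftI[of "y - d"]) auto
    with ev have "\<forall>\<^sub>F z in at_left y. (\<psi> z - \<psi> y) / (z - y) \<le> C"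
    proof eventually_elim
      case (elim z)
      then have "C * (z - y) \<le> \<psi> z - \<psi> y" using le[of z y] d(1) by (simp add: algebra_simps)
      then show ?case using elim by (simp add: neg_divide_le_eq)
    qed
    then show ?thesis
      by (rule tendsto_upperbound[rotated]) (use quotient in \<open>auto simp: filterlim_at_split\<close>)
  next
    assume ev: "\<forall>\<^sub>F z in at_right y. \<psi> z - \<psi> y \<le> integral {y..z} b"
    have "\<forall>\<^sub>F z in at_right y. z \<in> {y<..<y + d}"
      using d(1) by (intro eventually_at_rightI[of _ "y + d"]) auto
    with ev have "\<forall>\<^sub>F z in at_right y. (\<psi> z - \<psi> y) / (z - y) \<le> C"
    proof eventually_elim
      case (elim z)
      then have "\<psi> z - \<psi> y \<le> C * (z - y)" using le[of y z] d(1) by simp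
      then show ?case using elim by (simp add: pos_divide_le_eq)
    qed
    then show ?thesis
      by (rule tendsto_upperbound[rotated]) (use quotient in \<open>auto simp: filterlim_at_split\<close>)
  qed
qed

lemma DERIV_ge_if_increment_ge:
  fixes \<psi> b :: "real \<Rightarrow> real"
  assumes \<psi>: "DERIV \<psi> y :> q" and b: "\<And>u v. b integrable_on {u..v}"
    and C: "C \<le> b y" "\<forall>\<^sub>F z in at y. C \<le> b z"
    and incr: "(\<forall>\<^sub>F z in at_left y. integral {z..y} b \<le> \<psi> y - \<psi> z) \<or>
      (\<forall>\<^sub>F z in at_right y. integral {y..z} b \<le> \<psi> z - \<psi> y)"
  shows "C \<le> q"
proof -
  have "- q \<le> - C"
  proof (rule DERIV_le_if_increment_le[where \<psi> = "\<lambda>z. - \<psi> z" and b = "\<lambda>z. - b z" and y = y])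
    show "DERIV (\<lambda>z. - \<psi> z) y :> - q" by (rule DERIV_minus[OF \<psi>])
  qed (use C incr in \<open>auto intro: integrable_neg b simp: algebra_simps\<close>)
  then show ?thesis by simp
qed

section \<open>Slopes on the critical level and the corrector on the flat part\<close>

context convex_Hamiltonian
begin

lemma U_near_critical:
  assumes "e > 0"
  shows "\<forall>\<^sub>F z in at y. U z M < U y M + e"
proof -
  have "filterlim (\<lambda>z. (z, M)) (at (y, M) within UNIV \<times> {M..}) (at y)"
    unfolding filterlim_at by (auto simp: eventually_at_filter intro!: tendsto_intros)
  from eventually_compose_filterlim[OF U_upper_semicontinuous[OF order_refl assms] this]
  show ?thesis by simp
qed

lemma D_near_critical:
  assumes "e > 0"
  shows "\<forall>\<^sub>F z in at y. D y M - e < D z M"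
proof -
  have "filterlim (\<lambda>z. (z, M)) (at (y, M) within UNIV \<times> {M..}) (at y)"
    unfolding filterlim_at by (auto simp: eventually_at_filter intro!: tendsto_intros)
  from eventually_compose_filterlim[OF D_lower_semicontinuous[OF order_refl assms] this]
  show ?thesis by simp
qed

lemma slopes_continuous_critical:
  assumes "\<exists>q. H y q < M"
  shows "((\<lambda>z. U z M) \<longlongrightarrow> U y M) (at y)" "((\<lambda>z. D z M) \<longlongrightarrow> D y M) (at y)"
proof -
  have lim: "filterlim (\<lambda>z. (z, M)) (at (y, M) within UNIV \<times> {M..}) (at y)"
    unfolding filterlim_at by (auto simp: eventually_at_filter intro!: tendsto_intros)
  show "((\<lambda>z. U z M) \<longlongrightarrow> U y M) (at y)"
    using filterlim_compose[OF U_continuous[OF order_refl] lim] assms by simp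
  show "((\<lambda>z. D z M) \<longlongrightarrow> D y M) (at y)"
    using filterlim_compose[OF D_continuous[OF order_refl] lim] assms by simp
qed

lemma U_critical_limit: "(\<lambda>n. U y (M + 1 / (real n + 1))) \<longlonglongrightarrow> U y M"
proof (rule order_tendstoI)
  fix a assume "a < U y M"
  moreover have "U y M \<le> U y (M + 1 / (real n + 1))" for n by (intro U_mono) auto
  ultimately show "\<forall>\<^sub>F n in sequentially. a < U y (M + 1 / (real n + 1))"
    by (meson always_eventually less_le_trans)
next
  fix a assume a: "U y M < a"
  have "(\<lambda>n. M + 1 / (real n + 1)) \<longlonglongrightarrow> M + 0"
    using LIMSEQ_inverse_real_of_nat by (intro tendsto_add tendsto_const) (simp add: inverse_eq_divide add.commute)
  then have "filterlim (\<lambda>n. (y, M + 1 / (real n + 1))) (at (y, M) within UNIV \<times> {M..}) sequentially"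
    unfolding filterlim_at by (auto intro!: tendsto_Pair always_eventually)
  from eventually_compose_filterlim[OF U_upper_semicontinuous[of M "a - U y M" y] this] a
  show "\<forall>\<^sub>F n in sequentially. U y (M + 1 / (real n + 1)) < a" by simp
qed

text \<open>On level \<open>M\<close> the slope may be discontinuous in \<open>y\<close>;
  integrability and the value of the integral come from higher levels by dominated
  convergence.\<close>

lemma U_critical_integral:
  shows "(\<lambda>z. U z M) integrable_on {a..b}"
    and "(\<lambda>n. integral {a..b} (\<lambda>z. U z (M + 1 / (real n + 1)))) \<longlonglongrightarrow> integral {a..b} (\<lambda>z. U z M)"
proof -
  obtain k l where growth: "k > 0" "\<And>y p. k * \<bar>p\<bar> - l \<le> H y p" using linear_growth by blast
  have n: "M < M + 1 / (real n + 1)" "M + 1 / (real n + 1) \<le> M + 1" for n by auto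
  have *: "norm (U z (M + 1 / (real n + 1))) \<le> (M + 1 + l) / k" for n z
    using slopes_le(1)[OF growth(2,1) refl less_imp_le[OF n(1)] n(2)] by simp
  note dc = dominated_convergence[of "\<lambda>n z. U z (M + 1 / (real n + 1))" "{a..b}" "\<lambda>_. (M + 1 + l) / k" "\<lambda>z. U z M"]
  show "(\<lambda>z. U z M) integrable_on {a..b}"
    "(\<lambda>n. integral {a..b} (\<lambda>z. U z (M + 1 / (real n + 1)))) \<longlonglongrightarrow> integral {a..b} (\<lambda>z. U z M)"
    by (rule dc; intro integrable_continuous_real slopes_continuous_gt n continuous_on_const * ballI U_critical_limit)+
qed

lemma D_critical_integral:
  shows "(\<lambda>z. D z M) integrable_on {a..b}"
    and "(\<lambda>n. integral {a..b} (\<lambda>z. D z (M + 1 / (real n + 1)))) \<longlonglongrightarrow> integral {a..b} (\<lambda>z. D z M)"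
proof -
  interpret r: convex_Hamiltonian "\<lambda>y p. H y (- p)" by (rule reflected)
  show "(\<lambda>z. D z M) integrable_on {a..b}"
    using integrable_neg[OF r.U_critical_integral(1)[of a b]] by (simp add: lower_slope_def critical_level_reflected)
  show "(\<lambda>n. integral {a..b} (\<lambda>z. D z (M + 1 / (real n + 1)))) \<longlonglongrightarrow> integral {a..b} (\<lambda>z. D z M)"
    using tendsto_minus[OF r.U_critical_integral(2)[of a b]] by (simp add: lower_slope_def critical_level_reflected)
qed

text \<open>On the flat part of the effective Hamiltonian the corrector switches between both branches of
  \<open>H = M\<close>; the switch from the lower to the upper branch, a convex kink, happens where
  \<open>min H(y, \<cdot>) = M\<close>, so that the supersolution property holds there.\<close>

lemma cell_problem_flat:
  assumes p: "\<And>c. M < c \<Longrightarrow> mean_lower H c \<le> p \<and> p \<le> mean_upper H c"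
  shows "\<exists>v. solves_cell_problem H p M v"
proof -
  obtain y0 where y0: "\<And>q. M \<le> H y0 q" using critical_point by blast
  define up where "up z = U z M" for z
  define lo where "lo z = D z M" for z
  have int: "up integrable_on {a..b}" "lo integrable_on {a..b}" for a b
    using U_critical_integral(1) D_critical_integral(1) by (simp_all add: up_def[abs_def] lo_def[abs_def])
  have per: "up (z + 1) = up z" "lo (z + 1) = lo z" for z by (simp_all add: up_def lo_def U_periodic D_periodic)
  have lo_up: "lo z \<le> up z" for z by (simp add: up_def lo_def D_le_U)
  have p_up: "p \<le> integral {b..b + 1} up" for b
  proof -
    have "\<exists>N. \<forall>n\<ge>N. p \<le> integral {0..1} (\<lambda>z. U z (M + 1 / (real n + 1)))"
      using p by (auto simp: mean_upper_def)
    from LIMSEQ_le_const[OF U_critical_integral(2) this] show ?thesis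
      using integral_period[of up b] int per by (simp add: up_def[abs_def])
  qed
  have lo_p: "integral {b..b + 1} lo \<le> p" for b
  proof -
    have "\<exists>N. \<forall>n\<ge>N. integral {0..1} (\<lambda>z. D z (M + 1 / (real n + 1))) \<le> p"
      using p by (auto simp: mean_lower_def)
    from LIMSEQ_le_const2[OF D_critical_integral(2) this] show ?thesis
      using integral_period[of lo b] int per by (simp add: lo_def[abs_def])
  qed
  \<comment> \<open>A primitive with the lower branch left of \<open>y0\<close> and the upper branch
    right of it; its only switch of branch is the harmless convex kink at \<open>y0\<close>.\<close>
  define \<Phi> where "\<Phi> x = integral {y0..x} up - integral {x..y0} lo" for x
  have \<Phi>_right: "\<Phi> b - \<Phi> a = integral {a..b} up" if "y0 \<le> a" "a \<le> b" for a b
  proof -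
    have "integral {y0..a} up + integral {a..b} up = integral {y0..b} up"
      using that int by (intro Henstock_Kurzweil_Integration.integral_combine) auto
    moreover have "integral {a..y0} lo = 0" "integral {b..y0} lo = 0" using that by (auto simp: order_le_less)
    ultimately show ?thesis by (simp add: \<Phi>_def)
  qed
  have \<Phi>_left: "\<Phi> b - \<Phi> a = integral {a..b} lo" if "b \<le> y0" "a \<le> b" for a b
  proof -
    have "integral {a..b} lo + integral {b..y0} lo = integral {a..y0} lo"
      using that int by (intro Henstock_Kurzweil_Integration.integral_combine) auto
    moreover have "integral {y0..a} up = 0" "integral {y0..b} up = 0" using that by (auto simp: order_le_less)
    ultimately show ?thesis by (simp add: \<Phi>_def)
  qed
  have lo_le_up: "integral {a..b} lo \<le> integral {a..b} up" for a b by (intro integral_le int lo_up)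
  have \<Phi>_incr: "integral {a..b} lo \<le> \<Phi> b - \<Phi> a \<and> \<Phi> b - \<Phi> a \<le> integral {a..b} up" if ab: "a \<le> b" for a b
  proof -
    consider "y0 \<le> a" | "b \<le> y0" | "a < y0" "y0 < b" by linarith
    then show ?thesis
    proof cases
      case 1
      then show ?thesis using \<Phi>_right[OF _ ab] lo_le_up[of a b] by simp
    next
      case 2
      then show ?thesis using \<Phi>_left[OF _ ab] lo_le_up[of a b] by simp
    next
      case 3
      have "integral {a..y0} up + integral {y0..b} up = integral {a..b} up"
        "integral {a..y0} lo + integral {y0..b} lo = integral {a..b} lo"
        using 3 int by (auto intro!: Henstock_Kurzweil_Integration.integral_combine)
      then show ?thesis using \<Phi>_right[of y0 b] \<Phi>_left[of y0 a] 3 lo_le_up[of a y0] lo_le_up[of y0 b] by simp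
    qed
  qed
  \<comment> \<open>Translates of \<open>\<Phi>\<close> by integers, raised by \<open>p\<close> per
    period. Their minimum grows by \<open>p\<close> over each period, so subtracting
    \<open>p * x\<close> makes it periodic.\<close>
  define V where "V k x = of_int k * p + \<Phi> (x - of_int k)" for k :: int and x
  define k0 where "k0 x = \<lfloor>x - y0\<rfloor>" for x
  \<comment> \<open>Two translates suffice for the minimum over all \<open>k\<close>: since
    \<open>p\<close> lies between the means, \<open>V k x\<close> is nonincreasing in
    \<open>k\<close> up to \<open>k0 x\<close> and nondecreasing from \<open>k0 x + 1\<close>
    on.\<close>
  define W where "W x = min (V (k0 x) x) (V (k0 x + 1) x)" for x
  have k0: "y0 \<le> x - of_int (k0 x)" "x - of_int (k0 x + 1) \<le> y0" for x unfolding k0_def by linarith+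
  have V_down: "V k x \<le> V (k - 1) x" if "y0 \<le> x - of_int k" for k x
    using \<Phi>_right[OF that, of "x - of_int k + 1"] p_up[of "x - of_int k"] by (simp add: V_def algebra_simps)
  have V_up: "V k x \<le> V (k + 1) x" if "x - of_int k \<le> y0" for k x
    using \<Phi>_left[OF that, of "x - of_int k - 1"] lo_p[of "x - of_int k - 1"] by (simp add: V_def algebra_simps)
  have V_k0: "V (k0 x) x \<le> V (k0 x - int n) x" for x n
  proof (induction n)
    case (Suc n)
    have "V (k0 x - int n) x \<le> V (k0 x - int n - 1) x"
      using k0(1)[of x] by (intro V_down) simp
    with Suc show ?case by (simp add: algebra_simps)
  qed simp
  have V_k1: "V (k0 x + 1) x \<le> V (k0 x + 1 + int n) x" for x n
  proof (induction n)
    case (Suc n)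
    have "V (k0 x + 1 + int n) x \<le> V (k0 x + 1 + int n + 1) x"
      using k0(2)[of x] by (intro V_up) simp
    with Suc show ?case by (simp add: algebra_simps)
  qed simp
  have W_le: "W x \<le> V k x" for k x
  proof (cases "k \<le> k0 x")
    case True
    then have "k = k0 x - int (nat (k0 x - k))" by simp
    with V_k0[of x "nat (k0 x - k)"] show ?thesis by (simp add: W_def min_le_iff_disj)
  next
    case False
    then have "k = k0 x + 1 + int (nat (k - k0 x - 1))" by simp
    with V_k1[of x "nat (k - k0 x - 1)"] show ?thesis by (simp add: W_def min_le_iff_disj)
  qed
  have W_att: "\<exists>k. W x = V k x" for x by (auto simp: W_def min_def)
  have V_incr: "integral {a..b} lo \<le> V k b - V k a \<and> V k b - V k a \<le> integral {a..b} up" if "a \<le> b" for a b k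
    using \<Phi>_incr[of "a - of_int k" "b - of_int k"] that
      integral_shift_periodic[of up a "- k" b] integral_shift_periodic[of lo a "- k" b] per
    by (simp add: V_def)
  have W_incr: "integral {a..b} lo \<le> W b - W a \<and> W b - W a \<le> integral {a..b} up" if "a \<le> b" for a b
  proof -
    obtain k l where "W a = V k a" "W b = V l b" using W_att by metis
    then show ?thesis using W_le[of b k] W_le[of a l] V_incr[OF that, of k] V_incr[OF that, of l] by linarith
  qed
  have W_per: "W (x + 1) = W x + p" for x
  proof -
    have k: "k0 (x + 1) = k0 x + 1" unfolding k0_def by linarith
    have V: "V (k + 1) (x + 1) = V k x + p" for k by (simp add: V_def algebra_simps)
    show ?thesis unfolding W_def k V by (simp add: min_def)
  qed
  obtain k l where growth: "k > 0" "\<And>y p. k * \<bar>p\<bar> - l \<le> H y p" using linear_growth by blast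
  define R where "R = (M + l) / k"
  have R: "- R \<le> lo z" "up z \<le> R" for z
    using slope_bound[OF growth(2,1) order_refl, of z] by (auto simp: R_def up_def lo_def abs_le_iff)
  have const_le: "integral {a..b} f \<le> C * (b - a)" if "a \<le> b" "f integrable_on {a..b}" "\<And>z. a \<le> z \<Longrightarrow> z \<le> b \<Longrightarrow> f z \<le> C"
    for a b C and f :: "real \<Rightarrow> real"
  proof -
    have "integral {a..b} f \<le> integral {a..b} (\<lambda>z. C)" using that by (intro integral_le) auto
    then show ?thesis using that by (simp add: mult.commute)
  qed
  have const_ge: "C * (b - a) \<le> integral {a..b} f" if "a \<le> b" "f integrable_on {a..b}" "\<And>z. a \<le> z \<Longrightarrow> z \<le> b \<Longrightarrow> C \<le> f z"
    for a b C and f :: "real \<Rightarrow> real"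
  proof -
    have "integral {a..b} (\<lambda>z. C) \<le> integral {a..b} f" using that by (intro integral_le) auto
    then show ?thesis using that by (simp add: mult.commute)
  qed
  have W_cont: "continuous_on UNIV W"
  proof (rule lipschitz_on_continuous_on[OF lipschitz_on_leI])
    fix a b :: real assume "a \<le> b"
    then have ab: "a \<le> b" .
    show "dist (W a) (W b) \<le> \<bar>R\<bar> * dist a b"
    proof -
      have "R * (b - a) \<le> \<bar>R\<bar> * (b - a)" using ab by (intro mult_right_mono) auto
      then have "\<bar>W b - W a\<bar> \<le> \<bar>R\<bar> * (b - a)"
        using W_incr[OF ab] const_le[OF ab int(1) R(2)] const_ge[OF ab int(2) R(1)] by linarith
      then show ?thesis using ab by (simp add: dist_real_def abs_minus_commute)
    qed
  qed simp
  define v where "v x = W x - p * x" for x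
  have v_cont: "continuous_on UNIV v" unfolding v_def by (intro continuous_on_diff W_cont continuous_intros)
  have v_per: "v (x + 1) = v x" for x unfolding v_def W_per by (simp add: algebra_simps)
  \<comment> \<open>Increments of \<open>W\<close> lie between those of the two branches, so a slope
    touching from above lies between the branches and hence in the sublevel set, at kinks
    too.\<close>
  have sub: "H y (p + s y) \<le> M"
    if C1: "C1_with_gradient UNIV \<phi> s" and max: "\<forall>\<^sub>F x in at y. v x - \<phi> x \<le> v y - \<phi> y" for \<phi> s y
  proof -
    define \<psi> where "\<psi> x = p * x + \<phi> x" for x
    have "DERIV \<phi> y :> s y" using C1 by (simp add: C1_with_gradient_def)
    then have \<psi>: "DERIV \<psi> y :> p + s y" unfolding \<psi>_def by (auto intro!: derivative_eq_intros)
    have ev: "\<forall>\<^sub>F x in at y. \<psi> y - \<psi> x \<le> W y - W x"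
      using max by eventually_elim (simp add: v_def \<psi>_def algebra_simps)
    have sides: "\<forall>\<^sub>F z in at y. (z < y \<longrightarrow> \<psi> y - \<psi> z \<le> integral {z..y} up) \<and>
        (y < z \<longrightarrow> integral {y..z} lo \<le> \<psi> z - \<psi> y)"
      using ev
    proof eventually_elim
      case (elim z)
      then show ?case using W_incr[of z y] W_incr[of y z] by auto
    qed
    have left: "\<forall>\<^sub>F z in at_left y. \<psi> y - \<psi> z \<le> integral {z..y} up"
      and right: "\<forall>\<^sub>F z in at_right y. integral {y..z} lo \<le> \<psi> z - \<psi> y"
      using sides by (auto simp: eventually_at_filter elim!: eventually_mono)
    have "p + s y \<le> U y M"
    proof (rule field_le_epsilon)
      fix e :: real assume e: "e > 0"
      show "p + s y \<le> U y M + e"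
        by (rule DERIV_le_if_increment_le[OF \<psi> int(1)])
          (use e left U_near_critical[OF e, of y] in \<open>auto simp: up_def elim: eventually_mono\<close>)
    qed
    moreover have "D y M \<le> p + s y"
    proof (rule field_le_epsilon)
      fix e :: real assume e: "e > 0"
      have "D y M - e \<le> p + s y"
        by (rule DERIV_ge_if_increment_ge[OF \<psi> int(2)])
          (use e right D_near_critical[OF e, of y] in \<open>auto simp: lo_def elim: eventually_mono\<close>)
      then show "D y M \<le> p + s y + e" by simp
    qed
    ultimately show ?thesis by (simp add: sublevel_iff)
  qed
  have super: "M \<le> H y (p + s y)"
    if C1: "C1_with_gradient UNIV \<phi> s" and min: "\<forall>\<^sub>F x in at y. v x - \<phi> x \<ge> v y - \<phi> y" for \<phi> s y
  proof (cases "\<exists>q. H y q < M")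
    case False
    then show ?thesis by (simp add: not_less)
  next
    case True
    define \<psi> where "\<psi> x = p * x + \<phi> x" for x
    have "DERIV \<phi> y :> s y" using C1 by (simp add: C1_with_gradient_def)
    then have \<psi>: "DERIV \<psi> y :> p + s y" unfolding \<psi>_def by (auto intro!: derivative_eq_intros)
    \<comment> \<open>A function touching the minimum \<open>W\<close> from below also touches the
      active translate from below. If \<open>H y\<close> goes below \<open>M\<close>, then
      \<open>y\<close> is not the convex kink of that translate, which is therefore an integral of a
      single branch near \<open>y\<close>, continuous at \<open>y\<close>.\<close>
    obtain k where k: "W y = V k y" using W_att by blast
    define y' where "y' = y - of_int k"
    have "y' \<noteq> y0"
    proof
      assume "y' = y0"
      then have "y = y0 + of_int k" by (simp add: y'_def)
      then have "H y q = H y0 q" for q by (simp add: periodic_int)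
      then show False using True y0 by (simp add: not_less[symmetric])
    qed
    have ev: "\<forall>\<^sub>F x in at y. \<psi> x - \<psi> y \<le> \<Phi> (x - of_int k) - \<Phi> y'"
      using min
    proof eventually_elim
      case (elim x)
      then show ?case using W_le[of x k] k by (simp add: V_def y'_def v_def \<psi>_def algebra_simps)
    qed
    have branch: "p + s y = b y"
      if b: "(b \<longlongrightarrow> b y) (at y)" "\<And>u v. b integrable_on {u..v}" and r: "r > 0"
        and incr: "\<And>z w. dist z y < r \<Longrightarrow> dist w y < r \<Longrightarrow> z \<le> w \<Longrightarrow> \<Phi> (w - of_int k) - \<Phi> (z - of_int k) = integral {z..w} b"
      for b :: "real \<Rightarrow> real" and r
    proof -
      have ev_r: "\<forall>\<^sub>F z in at y. dist z y < r" using r by (auto simp: eventually_at)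
      have sides: "\<forall>\<^sub>F z in at y. (y < z \<longrightarrow> \<psi> z - \<psi> y \<le> integral {y..z} b) \<and>
          (z < y \<longrightarrow> integral {z..y} b \<le> \<psi> y - \<psi> z)"
        using ev ev_r
      proof eventually_elim
        case (elim z)
        then show ?case using incr[of y z] incr[of z y] r by (auto simp: y'_def)
      qed
      have right: "\<forall>\<^sub>F z in at_right y. \<psi> z - \<psi> y \<le> integral {y..z} b"
        and left: "\<forall>\<^sub>F z in at_left y. integral {z..y} b \<le> \<psi> y - \<psi> z"
        using sides by (auto simp: eventually_at_filter elim!: eventually_mono)
      have "p + s y \<le> b y"
      proof (rule field_le_epsilon)
        fix e :: real assume e: "e > 0"
        show "p + s y \<le> b y + e"
          by (rule DERIV_le_if_increment_le[OF \<psi> b(2)])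
            (use e right order_tendstoD(2)[OF b(1), of "b y + e"] in \<open>auto elim: eventually_mono\<close>)
      qed
      moreover have "b y \<le> p + s y"
      proof (rule field_le_epsilon)
        fix e :: real assume e: "e > 0"
        have "b y - e \<le> p + s y"
          by (rule DERIV_ge_if_increment_ge[OF \<psi> b(2)])
            (use e left order_tendstoD(1)[OF b(1), of "b y - e"] in \<open>auto elim: eventually_mono\<close>)
        then show "b y \<le> p + s y + e" by simp
      qed
      ultimately show ?thesis by simp
    qed
    show ?thesis
    proof (cases "y0 < y'")
      case True
      have "p + s y = up y"
      proof (rule branch[OF _ int(1), of "y' - y0"])
        show "(up \<longlongrightarrow> up y) (at y)"
          using slopes_continuous_critical(1)[OF \<open>\<exists>q. H y q < M\<close>] by (simp add: up_def[abs_def])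
        show "\<Phi> (w - of_int k) - \<Phi> (z - of_int k) = integral {z..w} up"
          if "dist z y < y' - y0" "z \<le> w" for z w
          using \<Phi>_right[of "z - of_int k" "w - of_int k"] that integral_shift_periodic[of up z "- k" w] per
          by (simp add: y'_def dist_real_def abs_le_iff)
      qed (use True in auto)
      then show ?thesis by (simp add: up_def H_U)
    next
      case False
      then have less: "y' < y0" using \<open>y' \<noteq> y0\<close> by simp
      have "p + s y = lo y"
      proof (rule branch[OF _ int(2), of "y0 - y'"])
        show "(lo \<longlongrightarrow> lo y) (at y)"
          using slopes_continuous_critical(2)[OF \<open>\<exists>q. H y q < M\<close>] by (simp add: lo_def[abs_def])
        show "\<Phi> (w - of_int k) - \<Phi> (z - of_int k) = integral {z..w} lo"
          if "dist w y < y0 - y'" "z \<le> w" for z w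
          using \<Phi>_left[of "w - of_int k" "z - of_int k"] that integral_shift_periodic[of lo z "- k" w] per
          by (simp add: y'_def dist_real_def abs_le_iff)
      qed (use less in auto)
      then show ?thesis by (simp add: lo_def H_D)
    qed
  qed
  have "solves_cell_problem H p M v"
    unfolding solves_cell_problem_def viscosity_solution_def viscosity_subsolution_def viscosity_supersolution_def
    using v_per v_cont sub super by (auto simp: periodic_fun_simple'_def)
  then show ?thesis by blast
qed

end

section \<open>The effective Hamiltonian and the rate of convergence\<close>

context convex_Hamiltonian
begin

text \<open>Either \<open>p\<close> lies between the means on every level above \<open>M\<close>,
  the flat case, or it is beyond a mean on some level; then the intermediate value theorem gives a
  level on which that mean equals \<open>p\<close>, and the branch there yields a smooth
  corrector.\<close>

lemma cell_problem_solvable: "\<exists>c v. solves_cell_problem H p c v"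
proof (cases "\<forall>c>M. mean_lower H c \<le> p \<and> p \<le> mean_upper H c")
  case True
  then show ?thesis using cell_problem_flat by blast
next
  case False
  then obtain c0 where c0: "M < c0" "p < mean_lower H c0 \<or> mean_upper H c0 < p" by force
  obtain N where N: "\<And>y q. \<bar>q\<bar> \<le> \<bar>p\<bar> \<Longrightarrow> \<bar>H y q\<bar> \<le> N" using bounded_H by blast
  \<comment> \<open>On this level \<open>p\<close> lies between the slopes at every
    \<open>y\<close>, hence between the means, which provides the other end for the intermediate
    value theorem.\<close>
  define c1 where "c1 = max c0 N"
  have c1: "c0 \<le> c1" "M < c1" using c0 by (auto simp: c1_def)
  have "H y p \<le> c1" for y using N[of p y] unfolding c1_def abs_le_iff by linarith
  then have bounds: "p \<le> U y c1" "D y c1 \<le> p" for y by (simp_all add: slope_le_U D_le_slope)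
  have "integral {0..1} (\<lambda>y::real. p) \<le> mean_upper H c1" "mean_lower H c1 \<le> integral {0..1} (\<lambda>y::real. p)"
    unfolding mean_upper_def mean_lower_def using bounds c1
    by (intro integral_le integrable_continuous_real slopes_continuous_gt continuous_on_const; simp)+
  then have mean1: "p \<le> mean_upper H c1" "mean_lower H c1 \<le> p" by simp_all
  have sub: "{c0..c1} \<subseteq> {M<..}" using c0 by auto
  from c0(2) show ?thesis
  proof
    assume "mean_upper H c0 < p"
    then obtain c where c: "c0 \<le> c" "mean_upper H c = p"
      using IVT'[of "mean_upper H" c0 p c1] mean1(1) c1(1) continuous_on_subset[OF mean_continuous(1) sub] by auto
    then have "\<exists>v. solves_cell_problem H p c v"
      using c0(1) by (intro cell_problem_smooth[of "\<lambda>y. U y c"] slopes_continuous_gt U_periodic H_U)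
        (auto simp: mean_upper_def)
    then show ?thesis by blast
  next
    assume "p < mean_lower H c0"
    then obtain c where c: "c0 \<le> c" "mean_lower H c = p"
      using IVT2'[of "mean_lower H" c1 p c0] mean1(2) c1(1) continuous_on_subset[OF mean_continuous(2) sub] by auto
    then have "\<exists>v. solves_cell_problem H p c v"
      using c0(1) by (intro cell_problem_smooth[of "\<lambda>y. D y c"] slopes_continuous_gt D_periodic H_D)
        (auto simp: mean_lower_def)
    then show ?thesis by blast
  qed
qed

lemma effective_Hamiltonian_cell: "\<exists>v. solves_cell_problem H p (effective_Hamiltonian H p) v"
proof -
  obtain c v where "solves_cell_problem H p c v" using cell_problem_solvable by blast
  then have "\<exists>!c. \<exists>v. solves_cell_problem H p c v" using cell_level_unique by blast
  then show ?thesis unfolding effective_Hamiltonian_def by (rule theI')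
qed

lemma effective_Hamiltonian_ge: "M \<le> effective_Hamiltonian H p"
  using effective_Hamiltonian_cell cell_level_ge_critical by blast

text \<open>Identifies the averaged slopes with the slopes of the effective Hamiltonian. The cell
  problem bounds \<open>p\<close> only on levels strictly above the effective one, so the closed
  statement is a limit from the right, using continuity of the means.\<close>

lemma effective_Hamiltonian_le_iff:
  assumes c: "M < c"
  shows "effective_Hamiltonian H p \<le> c \<longleftrightarrow> mean_lower H c \<le> p \<and> p \<le> mean_upper H c"
proof
  obtain v where v: "solves_cell_problem H p (effective_Hamiltonian H p) v" using effective_Hamiltonian_cell by blast
  show "effective_Hamiltonian H p \<le> c" if "mean_lower H c \<le> p \<and> p \<le> mean_upper H c"
    using cell_level_le[OF v c] that by blast
  assume le: "effective_Hamiltonian H p \<le> c"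
  have ev: "\<forall>\<^sub>F c' in at_right c. mean_lower H c' \<le> p \<and> p \<le> mean_upper H c'"
    unfolding eventually_at_filter
  proof (intro always_eventually allI impI)
    fix c' assume "c' \<in> {c<..}"
    then have "M < c'" "effective_Hamiltonian H p < c'" using c le by auto
    from cell_slope_bounds[OF v this] show "mean_lower H c' \<le> p \<and> p \<le> mean_upper H c'" by blast
  qed
  have "isCont (mean_upper H) c" "isCont (mean_lower H) c"
    using mean_continuous c by (auto simp: continuous_on_eq_continuous_at)
  then have lim: "(mean_upper H \<longlongrightarrow> mean_upper H c) (at_right c)" "(mean_lower H \<longlongrightarrow> mean_lower H c) (at_right c)"
    by (auto simp: isCont_def intro: filterlim_at_split[THEN iffD1, THEN conjunct2])
  have "p \<le> mean_upper H c"
    by (rule tendsto_lowerbound[OF lim(1)]) (use ev in \<open>auto elim: eventually_mono\<close>)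
  moreover have "mean_lower H c \<le> p"
    by (rule tendsto_upperbound[OF lim(2)]) (use ev in \<open>auto elim: eventually_mono\<close>)
  ultimately show "mean_lower H c \<le> p \<and> p \<le> mean_upper H c" by blast
qed

lemma mean_upper_concave:
  assumes "M < c" "M < c'" "0 \<le> t" "t \<le> 1"
  shows "(1 - t) * mean_upper H c + t * mean_upper H c' \<le> mean_upper H ((1 - t) * c + t * c')"
proof -
  have c: "M < (1 - t) * c + t * c'"
  proof (cases "t = 1")
    case False
    then have "(1 - t) * M + t * M < (1 - t) * c + t * c'"
      using assms by (intro add_less_le_mono mult_strict_left_mono mult_left_mono) auto
    then show ?thesis by (simp add: algebra_simps)
  qed (use assms in simp)
  have "(1 - t) * mean_upper H c + t * mean_upper H c'
      = integral {0..1} (\<lambda>y. (1 - t) * U y c) + integral {0..1} (\<lambda>y. t * U y c')"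
    by (simp add: mean_upper_def)
  also have "\<dots> = integral {0..1} (\<lambda>y. (1 - t) * U y c + t * U y c')"
    by (intro integral_add[symmetric] integrable_continuous_real continuous_intros slopes_continuous_gt assms)
  also have "\<dots> \<le> mean_upper H ((1 - t) * c + t * c')"
    unfolding mean_upper_def
    by (intro integral_le integrable_continuous_real continuous_intros slopes_continuous_gt assms c U_concave)
      (use assms in auto)
  finally show ?thesis .
qed

lemma mean_lower_convex:
  assumes "M < c" "M < c'" "0 \<le> t" "t \<le> 1"
  shows "mean_lower H ((1 - t) * c + t * c') \<le> (1 - t) * mean_lower H c + t * mean_lower H c'"
proof -
  interpret r: convex_Hamiltonian "\<lambda>y p. H y (- p)" by (rule reflected)
  show ?thesis using r.mean_upper_concave[of c c' t] assms
    by (simp add: mean_reflected critical_level_reflected algebra_simps)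
qed

lemma effective_Hamiltonian_convex: "convex_on UNIV (effective_Hamiltonian H)"
proof (rule convex_onI)
  fix t p q :: real assume t: "0 < t" "t < 1"
  let ?E = "effective_Hamiltonian H"
  show "?E ((1 - t) *\<^sub>R p + t *\<^sub>R q) \<le> (1 - t) * ?E p + t * ?E q"
  proof (rule field_le_epsilon)
    fix e :: real assume e: "e > 0"
    let ?c = "?E p + e" and ?d = "?E q + e"
    have cd: "M < ?c" "M < ?d" using effective_Hamiltonian_ge[of p] effective_Hamiltonian_ge[of q] e by auto
    have p: "mean_lower H ?c \<le> p" "p \<le> mean_upper H ?c" and q: "mean_lower H ?d \<le> q" "q \<le> mean_upper H ?d"
      using effective_Hamiltonian_le_iff[OF cd(1), of p] effective_Hamiltonian_le_iff[OF cd(2), of q] e by auto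
    have "(1 - t) * p + t * q \<le> (1 - t) * mean_upper H ?c + t * mean_upper H ?d"
      using p q t by (intro add_mono mult_left_mono) auto
    also have "\<dots> \<le> mean_upper H ((1 - t) * ?c + t * ?d)" using cd t by (intro mean_upper_concave) auto
    finally have upper: "(1 - t) * p + t * q \<le> mean_upper H ((1 - t) * ?c + t * ?d)" .
    have "mean_lower H ((1 - t) * ?c + t * ?d) \<le> (1 - t) * mean_lower H ?c + t * mean_lower H ?d"
      using cd t by (intro mean_lower_convex) auto
    also have "\<dots> \<le> (1 - t) * p + t * q"
      using p q t by (intro add_mono mult_left_mono) auto
    finally have lower: "mean_lower H ((1 - t) * ?c + t * ?d) \<le> (1 - t) * p + t * q" .
    have "M < (1 - t) * ?c + t * ?d"
    proof -
      have "(1 - t) * M + t * M < (1 - t) * ?c + t * ?d"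
        using cd t by (intro add_strict_mono mult_strict_left_mono) auto
      then show ?thesis by (simp add: algebra_simps)
    qed
    from effective_Hamiltonian_le_iff[OF this, of "(1 - t) * p + t * q"] upper lower
    show "?E ((1 - t) *\<^sub>R p + t *\<^sub>R q) \<le> (1 - t) * ?E p + t * ?E q + e"
      by (simp add: algebra_simps)
  qed
qed simp

text \<open>Makes the Hopf--Lax bounds applicable to the limit problem, as a Hamiltonian constant in
  \<open>y\<close>.\<close>

lemma effective_convex_Hamiltonian: "convex_Hamiltonian (\<lambda>y. effective_Hamiltonian H)"
proof
  have "continuous_on UNIV (effective_Hamiltonian H)"
    by (rule convex_on_continuous[OF open_UNIV effective_Hamiltonian_convex])
  then show "continuous_on UNIV (\<lambda>(y::real, p). effective_Hamiltonian H p)"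
    unfolding case_prod_beta by (rule continuous_on_compose2) (auto intro: continuous_on_snd continuous_on_id)
  show "\<exists>R. \<forall>(y::real) p. R \<le> \<bar>p\<bar> \<longrightarrow> N \<le> effective_Hamiltonian H p" for N
  proof -
    define c where "c = max N (M + 1)"
    have c: "M < c" by (simp add: c_def)
    have "N \<le> effective_Hamiltonian H p" if "\<bar>mean_upper H c\<bar> + \<bar>mean_lower H c\<bar> + 1 \<le> \<bar>p\<bar>" for p
    proof (rule ccontr)
      assume "\<not> ?thesis"
      then have "effective_Hamiltonian H p \<le> c" by (simp add: c_def)
      then have "mean_lower H c \<le> p" "p \<le> mean_upper H c" using effective_Hamiltonian_le_iff[OF c] by auto
      then show False using that by linarith
    qed
    then show ?thesis by blast
  qed
qed (auto intro: effective_Hamiltonian_convex)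

lemma critical_level_effective: "critical_level (\<lambda>y. effective_Hamiltonian H) = M"
proof (rule antisym)
  interpret e: convex_Hamiltonian "\<lambda>y. effective_Hamiltonian H" by (rule effective_convex_Hamiltonian)
  show "e.M \<le> M"
  proof (rule field_le_epsilon)
    fix e :: real assume "e > 0"
    then have c: "M < M + e" by simp
    have "effective_Hamiltonian H (mean_upper H (M + e)) \<le> M + e"
      unfolding effective_Hamiltonian_le_iff[OF c] using mean_lower_le_upper[OF c] by simp
    then show "e.M \<le> M + e" by (intro e.critical_le) blast
  qed
  obtain p where "effective_Hamiltonian H p \<le> e.M" using e.sublevel_nonempty[of e.M] by blast
  then show "M \<le> e.M" using effective_Hamiltonian_ge[of p] by linarith
qed

text \<open>With the equality of critical levels, this makes the Hopf--Lax formulas of the two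
  problems coincide.\<close>

lemma travel_cost_effective:
  assumes c: "M < c"
  shows "travel_cost (\<lambda>y. effective_Hamiltonian H) c \<xi> = travel_cost H c \<xi>"
proof -
  have "{p. effective_Hamiltonian H p \<le> c} = {mean_lower H c..mean_upper H c}"
    unfolding effective_Hamiltonian_le_iff[OF c] by auto
  then have upper: "upper_slope (effective_Hamiltonian H) c = mean_upper H c"
    using mean_lower_le_upper[OF c] by (simp add: upper_slope_def)
  have "{p. effective_Hamiltonian H (- p) \<le> c} = {- mean_upper H c..- mean_lower H c}"
    unfolding effective_Hamiltonian_le_iff[OF c] by auto
  then have lower: "lower_slope (effective_Hamiltonian H) c = mean_lower H c"
    using mean_lower_le_upper[OF c] by (simp add: lower_slope_def upper_slope_def)
  show ?thesis by (simp add: travel_cost_def mean_upper_def[of "\<lambda>y. effective_Hamiltonian H"]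
      mean_lower_def[of "\<lambda>y. effective_Hamiltonian H"] upper lower)
qed

end

section \<open>Rescaling space and time to unit period\<close>

lemma C1_with_gradient_rescale:
  fixes \<phi> :: "real \<times> real \<Rightarrow> real"
  assumes C1: "C1_with_gradient (UNIV \<times> {0<..}) \<phi> D\<phi>" and \<epsilon>: "\<epsilon> > 0"
  shows "C1_with_gradient (UNIV \<times> {0<..}) (\<lambda>z. \<epsilon> * \<phi> (z /\<^sub>R \<epsilon>)) (\<lambda>z. D\<phi> (z /\<^sub>R \<epsilon>))"
  unfolding C1_with_gradient_def
proof (intro conjI ballI)
  have dom: "z /\<^sub>R \<epsilon> \<in> UNIV \<times> {0<..}" if "z \<in> UNIV \<times> {0<..}" for z :: "real \<times> real"
    using that \<epsilon> by (auto simp: mem_Times_iff)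
  fix z :: "real \<times> real" assume "z \<in> UNIV \<times> {0<..}"
  then have "GDERIV \<phi> (z /\<^sub>R \<epsilon>) :> D\<phi> (z /\<^sub>R \<epsilon>)" using C1 dom unfolding C1_with_gradient_def by blast
  then have \<phi>: "(\<phi> has_derivative (\<lambda>h. inner h (D\<phi> (z /\<^sub>R \<epsilon>)))) (at (z /\<^sub>R \<epsilon>))" by (simp add: gderiv_def)
  have "((\<lambda>z. z /\<^sub>R \<epsilon>) has_derivative (\<lambda>h. h /\<^sub>R \<epsilon>)) (at z)"
    by (intro has_derivative_scaleR_right has_derivative_ident)
  from has_derivative_compose[OF this \<phi>] have "((\<lambda>z. \<phi> (z /\<^sub>R \<epsilon>)) has_derivative (\<lambda>h. inner (h /\<^sub>R \<epsilon>) (D\<phi> (z /\<^sub>R \<epsilon>)))) (at z)" .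
  from has_derivative_mult_right[OF this, of \<epsilon>]
  have "GDERIV (\<lambda>z. \<epsilon> * \<phi> (z /\<^sub>R \<epsilon>)) z :> \<epsilon> *\<^sub>R (D\<phi> (z /\<^sub>R \<epsilon>) /\<^sub>R \<epsilon>)"
    by (simp add: gderiv_def mult.assoc)
  then show "GDERIV (\<lambda>z. \<epsilon> * \<phi> (z /\<^sub>R \<epsilon>)) z :> D\<phi> (z /\<^sub>R \<epsilon>)" using \<epsilon> by simp
next
  have "continuous_on (UNIV \<times> {0<..}) D\<phi>" using C1 by (simp add: C1_with_gradient_def)
  then show "continuous_on (UNIV \<times> {0<..}) (\<lambda>z. D\<phi> (z /\<^sub>R \<epsilon>))"
    by (rule continuous_on_compose2) (use \<epsilon> in \<open>auto intro!: continuous_intros\<close>)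
qed

lemma eventually_at_rescale:
  fixes z0 :: "'a::real_normed_vector"
  assumes "\<forall>\<^sub>F z in at z0. P z" "\<epsilon> > 0"
  shows "\<forall>\<^sub>F z in at (\<epsilon> *\<^sub>R z0). P (z /\<^sub>R \<epsilon>)"
proof -
  have "filterlim (\<lambda>z. z /\<^sub>R \<epsilon>) (at z0) (at (\<epsilon> *\<^sub>R z0))"
    unfolding filterlim_at
  proof
    show "((\<lambda>z. z /\<^sub>R \<epsilon>) \<longlongrightarrow> z0) (at (\<epsilon> *\<^sub>R z0))" using assms(2) by (auto intro!: tendsto_eq_intros)
    show "\<forall>\<^sub>F z in at (\<epsilon> *\<^sub>R z0). z /\<^sub>R \<epsilon> \<in> UNIV \<and> z /\<^sub>R \<epsilon> \<noteq> z0"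
      unfolding eventually_at_filter using assms(2) by (intro always_eventually) auto
  qed
  from eventually_compose_filterlim[OF assms(1) this] show ?thesis .
qed

lemma rescaled_continuous:
  fixes u :: "real \<times> real \<Rightarrow> real"
  assumes "continuous_on (UNIV \<times> {0<..}) u" "\<epsilon> > 0"
  shows "continuous_on (UNIV \<times> {0<..}) (\<lambda>z. u (\<epsilon> *\<^sub>R z) / \<epsilon>)"
proof -
  have "continuous_on (UNIV \<times> {0<..}) (\<lambda>z. u (\<epsilon> *\<^sub>R z))"
    by (rule continuous_on_compose2[OF assms(1)]) (use assms(2) in \<open>auto intro!: continuous_intros\<close>)
  then show ?thesis using assms(2) by (intro continuous_on_divide continuous_on_const) auto
qed

text \<open>Dividing both the variables and the values by \<open>\<epsilon>\<close> preserves
  gradients, so \<open>\<epsilon>\<close> leaves the equation and bounded errors at unit scale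
  become errors of order \<open>\<epsilon>\<close>.\<close>

lemma subsolution_rescale:
  fixes u :: "real \<times> real \<Rightarrow> real"
  assumes sub: "viscosity_subsolution (UNIV \<times> {0<..}) (\<lambda>(x, t) r (q, \<tau>). \<tau> + H (x / \<epsilon>) q) u" and \<epsilon>: "\<epsilon> > 0"
  shows "viscosity_subsolution (UNIV \<times> {0<..}) (\<lambda>(x, t) r (q, \<tau>). \<tau> + H x q) (\<lambda>z. u (\<epsilon> *\<^sub>R z) / \<epsilon>)"
  unfolding viscosity_subsolution_def
proof (intro conjI allI impI)
  show "continuous_on (UNIV \<times> {0<..}) (\<lambda>z. u (\<epsilon> *\<^sub>R z) / \<epsilon>)"
    using sub \<epsilon> by (intro rescaled_continuous) (auto simp: viscosity_subsolution_def)
  fix \<phi> D\<phi> and z0 :: "real \<times> real"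
  assume C1: "C1_with_gradient (UNIV \<times> {0<..}) \<phi> D\<phi>" and z0: "z0 \<in> UNIV \<times> {0<..}"
    and "\<forall>\<^sub>F z in at z0. u (\<epsilon> *\<^sub>R z) / \<epsilon> - \<phi> z \<le> u (\<epsilon> *\<^sub>R z0) / \<epsilon> - \<phi> z0"
  from eventually_at_rescale[OF this(3) \<epsilon>]
  have touch: "\<forall>\<^sub>F z in at (\<epsilon> *\<^sub>R z0). u z - \<epsilon> * \<phi> (z /\<^sub>R \<epsilon>) \<le> u (\<epsilon> *\<^sub>R z0) - \<epsilon> * \<phi> ((\<epsilon> *\<^sub>R z0) /\<^sub>R \<epsilon>)"
  proof eventually_elim
    case (elim z)
    then have "\<epsilon> * (u z / \<epsilon> - \<phi> (z /\<^sub>R \<epsilon>)) \<le> \<epsilon> * (u (\<epsilon> *\<^sub>R z0) / \<epsilon> - \<phi> z0)"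
      using \<epsilon> by (intro mult_left_mono) auto
    then show ?case using \<epsilon> by (simp add: right_diff_distrib)
  qed
  have mem: "\<epsilon> *\<^sub>R z0 \<in> UNIV \<times> {0<..}" using z0 \<epsilon> by (auto simp: mem_Times_iff)
  note sub[unfolded viscosity_subsolution_def, THEN conjunct2, rule_format,
    OF C1_with_gradient_rescale[OF C1 \<epsilon>] mem touch]
  then show "(case z0 of (x, t) \<Rightarrow> \<lambda>r (q, \<tau>). \<tau> + H x q) (u (\<epsilon> *\<^sub>R z0) / \<epsilon>) (D\<phi> z0) \<le> 0"
    using \<epsilon> by (simp add: case_prod_beta)
qed

lemma supersolution_rescale:
  fixes u :: "real \<times> real \<Rightarrow> real"
  assumes super: "viscosity_supersolution (UNIV \<times> {0<..}) (\<lambda>(x, t) r (q, \<tau>). \<tau> + H (x / \<epsilon>) q) u" and \<epsilon>: "\<epsilon> > 0"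
  shows "viscosity_supersolution (UNIV \<times> {0<..}) (\<lambda>(x, t) r (q, \<tau>). \<tau> + H x q) (\<lambda>z. u (\<epsilon> *\<^sub>R z) / \<epsilon>)"
  unfolding viscosity_supersolution_def
proof (intro conjI allI impI)
  show "continuous_on (UNIV \<times> {0<..}) (\<lambda>z. u (\<epsilon> *\<^sub>R z) / \<epsilon>)"
    using super \<epsilon> by (intro rescaled_continuous) (auto simp: viscosity_supersolution_def)
  fix \<phi> D\<phi> and z0 :: "real \<times> real"
  assume C1: "C1_with_gradient (UNIV \<times> {0<..}) \<phi> D\<phi>" and z0: "z0 \<in> UNIV \<times> {0<..}"
    and "\<forall>\<^sub>F z in at z0. u (\<epsilon> *\<^sub>R z0) / \<epsilon> - \<phi> z0 \<le> u (\<epsilon> *\<^sub>R z) / \<epsilon> - \<phi> z"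
  from eventually_at_rescale[OF this(3) \<epsilon>]
  have touch: "\<forall>\<^sub>F z in at (\<epsilon> *\<^sub>R z0). u z - \<epsilon> * \<phi> (z /\<^sub>R \<epsilon>) \<ge> u (\<epsilon> *\<^sub>R z0) - \<epsilon> * \<phi> ((\<epsilon> *\<^sub>R z0) /\<^sub>R \<epsilon>)"
  proof eventually_elim
    case (elim z)
    then have "\<epsilon> * (u (\<epsilon> *\<^sub>R z0) / \<epsilon> - \<phi> z0) \<le> \<epsilon> * (u z / \<epsilon> - \<phi> (z /\<^sub>R \<epsilon>))"
      using \<epsilon> by (intro mult_left_mono) auto
    then show ?case using \<epsilon> by (simp add: right_diff_distrib)
  qed
  have mem: "\<epsilon> *\<^sub>R z0 \<in> UNIV \<times> {0<..}" using z0 \<epsilon> by (auto simp: mem_Times_iff)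
  note super[unfolded viscosity_supersolution_def, THEN conjunct2, rule_format,
    OF C1_with_gradient_rescale[OF C1 \<epsilon>] mem touch]
  then show "(case z0 of (x, t) \<Rightarrow> \<lambda>r (q, \<tau>). \<tau> + H x q) (u (\<epsilon> *\<^sub>R z0) / \<epsilon>) (D\<phi> z0) \<ge> 0"
    using \<epsilon> by (simp add: case_prod_beta)
qed

lemma travel_cost_scale: "\<epsilon> > 0 \<Longrightarrow> \<epsilon> * travel_cost H c (\<xi> / \<epsilon>) = travel_cost H c \<xi>"
  by (auto simp: travel_cost_def zero_le_divide_iff)

text \<open>Says through witnesses that \<open>u\<close> is within \<open>C\<close> of the inf over
  \<open>y\<close> of the sup over \<open>c\<close>. In this form two such functions are compared by
  taking \<open>y\<close> from one and \<open>c\<close> from the other.\<close>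

definition near_Hopf_Lax ::
    "(real \<Rightarrow> real \<Rightarrow> real) \<Rightarrow> real \<Rightarrow> (real \<Rightarrow> real) \<Rightarrow> real \<Rightarrow> (real \<times> real \<Rightarrow> real) \<Rightarrow> bool" where
  "near_Hopf_Lax H C1 g C u \<longleftrightarrow> (\<forall>x t. 0 \<le> t \<longrightarrow>
     (\<forall>y. \<exists>c. critical_level H < c \<and> c \<le> C1 \<and> u (x, t) \<le> g y + travel_cost H c (x - y) - c * t + C) \<and>
     (\<exists>y. \<forall>c. critical_level H < c \<longrightarrow> c \<le> C1 \<longrightarrow> g y + travel_cost H c (x - y) - c * t - C \<le> u (x, t)))"

context convex_Hamiltonian
begin

text \<open>A cap on the levels at which barriers are steeper than \<open>K\<close>-Lipschitz data,
  with one unit of level to spare for perturbing \<open>H\<close>.\<close>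

definition admissible_level :: "real \<Rightarrow> real \<Rightarrow> bool" where
  "admissible_level K C1 \<longleftrightarrow> M < C1 \<and> (\<forall>x. H x (K + 1) \<le> C1 - 1 \<and> H x (- (K + 1)) \<le> C1 - 1)"

lemma representation:
  assumes K: "K \<ge> 0" and C1: "admissible_level K C1"
  shows "\<exists>C\<ge>0. \<forall>\<epsilon> g u. \<epsilon> > 0 \<longrightarrow> bounded (range g) \<longrightarrow> K-lipschitz_on UNIV g \<longrightarrow>
     solves_Cauchy_problem (\<lambda>x. H (x / \<epsilon>)) g u \<longrightarrow> near_Hopf_Lax H C1 g (C * \<epsilon>) u"
proof -
  note C1' = C1[unfolded admissible_level_def]
  from C1' have C1_bounds: "M < C1" "\<And>x. H x (K + 1) \<le> C1 - 1" "\<And>x. H x (- (K + 1)) \<le> C1 - 1" by auto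
  from subsolution_upper_bound[OF K C1_bounds]
  obtain Ca where Ca: "\<forall>u L N. viscosity_subsolution (UNIV \<times> {0<..}) (\<lambda>(x, t) r (q, \<tau>). \<tau> + H x q) u \<longrightarrow>
     L-lipschitz_on (UNIV \<times> {0..}) u \<longrightarrow> (\<forall>x. \<bar>u (x, 0)\<bar> \<le> N) \<longrightarrow>
     (\<forall>x y. u (x, 0) \<le> u (y, 0) + K * \<bar>x - y\<bar>) \<longrightarrow>
     (\<forall>x t y. 0 \<le> t \<longrightarrow> (\<exists>c. M < c \<and> c \<le> C1 \<and> u (x, t) \<le> u (y, 0) + travel_cost H c (x - y) - c * t + Ca))" ..
  from supersolution_lower_bound[OF K C1_bounds]
  obtain Cb where Cb: "\<forall>u L N. viscosity_supersolution (UNIV \<times> {0<..}) (\<lambda>(x, t) r (q, \<tau>). \<tau> + H x q) u \<longrightarrow>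
     L-lipschitz_on (UNIV \<times> {0..}) u \<longrightarrow> (\<forall>x. \<bar>u (x, 0)\<bar> \<le> N) \<longrightarrow>
     (\<forall>x t. 0 \<le> t \<longrightarrow> (\<exists>y. \<forall>c. M < c \<longrightarrow> c \<le> C1 \<longrightarrow> u (y, 0) + travel_cost H c (x - y) - c * t - Cb \<le> u (x, t)))" ..
  define C where "C = max 0 (max Ca Cb)"
  show ?thesis
    unfolding near_Hopf_Lax_def
  proof (rule exI[of _ C], intro conjI allI impI)
    show "0 \<le> C" by (simp add: C_def)
    fix \<epsilon> :: real and g :: "real \<Rightarrow> real" and u :: "real \<times> real \<Rightarrow> real" and x t :: real
    assume \<epsilon>: "0 < \<epsilon>" and bdd: "bounded (range g)" and lip: "K-lipschitz_on UNIV g"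
      and sol: "solves_Cauchy_problem (\<lambda>x. H (x / \<epsilon>)) g u" and t: "0 \<le> t"
    \<comment> \<open>The rescaled datum \<open>g (\<epsilon> * x) / \<epsilon>\<close> keeps the
      Lipschitz constant \<open>K\<close>. Its sup norm depends on \<open>\<epsilon>\<close>, but
      \<open>Ca\<close> and \<open>Cb\<close> were fixed before any bound \<open>N\<close>.\<close>
    define U where "U z = u (\<epsilon> *\<^sub>R z) / \<epsilon>" for z
    obtain L where L: "L-lipschitz_on (UNIV \<times> {0..}) u" using sol by (auto simp: solves_Cauchy_problem_def)
    have init: "u (x, 0) = g x" for x using sol by (simp add: solves_Cauchy_problem_def)
    have visc: "viscosity_subsolution (UNIV \<times> {0<..}) (\<lambda>(x, t) r (q, \<tau>). \<tau> + H x q) U"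
      "viscosity_supersolution (UNIV \<times> {0<..}) (\<lambda>(x, t) r (q, \<tau>). \<tau> + H x q) U"
      using sol unfolding U_def[abs_def] solves_Cauchy_problem_def viscosity_solution_def
      by (auto intro: subsolution_rescale supersolution_rescale \<epsilon>)
    have UL: "L-lipschitz_on (UNIV \<times> {0..}) U"
    proof (rule lipschitz_onI)
      fix w z :: "real \<times> real" assume wz: "w \<in> UNIV \<times> {0..}" "z \<in> UNIV \<times> {0..}"
      have "dist (u (\<epsilon> *\<^sub>R w)) (u (\<epsilon> *\<^sub>R z)) \<le> L * dist (\<epsilon> *\<^sub>R w) (\<epsilon> *\<^sub>R z)"
        using wz \<epsilon> by (intro lipschitz_onD[OF L]) (auto simp: mem_Times_iff)
      then have "\<bar>u (\<epsilon> *\<^sub>R w) - u (\<epsilon> *\<^sub>R z)\<bar> \<le> L * (\<epsilon> * dist w z)"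
        using \<epsilon> by (simp add: dist_norm flip: scaleR_diff_right)
      then show "dist (U w) (U z) \<le> L * dist w z"
        using \<epsilon> by (simp add: U_def dist_real_def diff_divide_distrib[symmetric] pos_divide_le_eq algebra_simps)
    qed (rule lipschitz_on_nonneg[OF L])
    have U0: "U (x, 0) = g (\<epsilon> * x) / \<epsilon>" for x by (simp add: U_def init)
    obtain N where "\<And>x. \<bar>g x\<bar> \<le> N" using bdd by (auto simp: bounded_iff)
    then have N: "\<forall>x. \<bar>U (x, 0)\<bar> \<le> N / \<epsilon>" using \<epsilon> by (simp add: U0 divide_right_mono)
    have UK: "\<forall>x y. U (x, 0) \<le> U (y, 0) + K * \<bar>x - y\<bar>"
    proof (intro allI)
      fix x y
      have "\<bar>g (\<epsilon> * x) - g (\<epsilon> * y)\<bar> \<le> K * \<bar>\<epsilon> * x - \<epsilon> * y\<bar>"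
        using lipschitz_on_normD[OF lip, of "\<epsilon> * x" "\<epsilon> * y"] by simp
      also have "\<bar>\<epsilon> * x - \<epsilon> * y\<bar> = \<epsilon> * \<bar>x - y\<bar>" using \<epsilon> by (simp flip: right_diff_distrib add: abs_mult)
      finally have "g (\<epsilon> * x) \<le> g (\<epsilon> * y) + \<epsilon> * (K * \<bar>x - y\<bar>)" by (simp add: algebra_simps abs_le_iff)
      then have "g (\<epsilon> * x) / \<epsilon> \<le> (g (\<epsilon> * y) + \<epsilon> * (K * \<bar>x - y\<bar>)) / \<epsilon>" using \<epsilon> by (intro divide_right_mono) auto
      then show "U (x, 0) \<le> U (y, 0) + K * \<bar>x - y\<bar>" using \<epsilon> by (simp add: U0 add_divide_distrib)
    qed
    have t': "0 \<le> t / \<epsilon>" using t \<epsilon> by simp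
    have Ueq: "\<epsilon> * U (x / \<epsilon>, t / \<epsilon>) = u (x, t)" using \<epsilon> by (simp add: U_def)
    have U0eq: "\<epsilon> * U (y, 0) = g (\<epsilon> * y)" for y using \<epsilon> by (simp add: U0)
    have scale: "\<epsilon> * (U (y, 0) + travel_cost H c (x / \<epsilon> - y) - c * (t / \<epsilon>) + d)
        = g (\<epsilon> * y) + travel_cost H c (x - \<epsilon> * y) - c * t + d * \<epsilon>" for y c d
      using travel_cost_scale[OF \<epsilon>, of H c "x - \<epsilon> * y"] \<epsilon>
      by (simp add: distrib_left right_diff_distrib U0eq diff_divide_distrib mult.commute)
    show "\<exists>c. M < c \<and> c \<le> C1 \<and> u (x, t) \<le> g y + travel_cost H c (x - y) - c * t + C * \<epsilon>" for y
    proof -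
      obtain c where c: "M < c" "c \<le> C1"
        "U (x / \<epsilon>, t / \<epsilon>) \<le> U (y / \<epsilon>, 0) + travel_cost H c (x / \<epsilon> - y / \<epsilon>) - c * (t / \<epsilon>) + Ca"
        using Ca[rule_format, OF visc(1) UL N[rule_format] UK[rule_format] t', of "x / \<epsilon>" "y / \<epsilon>"] by blast
      have "u (x, t) \<le> \<epsilon> * (U (y / \<epsilon>, 0) + travel_cost H c (x / \<epsilon> - y / \<epsilon>) - c * (t / \<epsilon>) + Ca)"
        unfolding Ueq[symmetric] using c(3) \<epsilon> by (intro mult_left_mono) auto
      also have "\<dots> = g y + travel_cost H c (x - y) - c * t + Ca * \<epsilon>" unfolding scale using \<epsilon> by simp
      also have "Ca * \<epsilon> \<le> C * \<epsilon>" using \<epsilon> by (intro mult_right_mono) (auto simp: C_def)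
      finally show ?thesis using c by auto
    qed
    obtain y where y: "\<And>c. M < c \<Longrightarrow> c \<le> C1 \<Longrightarrow>
        U (y, 0) + travel_cost H c (x / \<epsilon> - y) - c * (t / \<epsilon>) - Cb \<le> U (x / \<epsilon>, t / \<epsilon>)"
      using Cb[rule_format, OF visc(2) UL N[rule_format] t', of "x / \<epsilon>"] by blast
    have "g (\<epsilon> * y) + travel_cost H c (x - \<epsilon> * y) - c * t - C * \<epsilon> \<le> u (x, t)" if c: "M < c" "c \<le> C1" for c
    proof -
      have "\<epsilon> * (U (y, 0) + travel_cost H c (x / \<epsilon> - y) - c * (t / \<epsilon>) + - Cb) \<le> u (x, t)"
        unfolding Ueq[symmetric] using y[OF c] \<epsilon> by (intro mult_left_mono) auto
      moreover have "Cb * \<epsilon> \<le> C * \<epsilon>" using \<epsilon> by (intro mult_right_mono) (auto simp: C_def)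
      ultimately show ?thesis unfolding scale by simp
    qed
    then show "\<exists>y. \<forall>c. M < c \<longrightarrow> c \<le> C1 \<longrightarrow> g y + travel_cost H c (x - y) - c * t - C * \<epsilon> \<le> u (x, t)" by blast
  qed
qed

theorem homogenization_rate:
  assumes K: "K \<ge> 0"
  shows "\<exists>C. \<forall>g u \<epsilon> u'. bounded (range g) \<longrightarrow> K-lipschitz_on UNIV g \<longrightarrow>
     solves_Cauchy_problem (\<lambda>x. effective_Hamiltonian H) g u \<longrightarrow> \<epsilon> > 0 \<longrightarrow>
     solves_Cauchy_problem (\<lambda>x. H (x / \<epsilon>)) g u' \<longrightarrow>
     (\<forall>x t. 0 \<le> t \<longrightarrow> \<bar>u' (x, t) - u (x, t)\<bar> \<le> C * \<epsilon>)"
proof -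
  interpret e: convex_Hamiltonian "\<lambda>y. effective_Hamiltonian H" by (rule effective_convex_Hamiltonian)
  obtain N where N: "\<And>y p. \<bar>p\<bar> \<le> K + 1 \<Longrightarrow> \<bar>H y p\<bar> \<le> N" using bounded_H by blast
  have NH: "H y (K + 1) \<le> N" "H y (- (K + 1)) \<le> N" for y
    using N[of "K + 1" y] N[of "- (K + 1)" y] K by (auto simp: abs_le_iff)
  define C1 where "C1 = max (N + 1) (M + 1) + 1"
  have adm: "admissible_level K C1"
    unfolding admissible_level_def
  proof (intro conjI allI)
    show "H x (K + 1) \<le> C1 - 1" "H x (- (K + 1)) \<le> C1 - 1" for x
      using NH[of x] unfolding C1_def by linarith+
  qed (simp add: C1_def)
  have "e.admissible_level K C1"
  proof -
    have c: "M < C1 - 1" by (simp add: C1_def)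
    \<comment> \<open>If all \<open>H y p\<close> are at most \<open>N\<close>, then
      \<open>p\<close> lies between the slopes on level \<open>C1 - 1\<close> for every
      \<open>y\<close>, hence between the means. So one cap serves both problems.\<close>
    have "effective_Hamiltonian H p \<le> C1 - 1" if "\<And>y. H y p \<le> N" for p
    proof -
      have "H y p \<le> C1 - 1" for y using that[of y] by (simp add: C1_def)
      then have "integral {0..1} (\<lambda>y::real. p) \<le> mean_upper H (C1 - 1)"
        "mean_lower H (C1 - 1) \<le> integral {0..1} (\<lambda>y::real. p)"
        unfolding mean_upper_def mean_lower_def
        by (intro integral_le integrable_continuous_real slopes_continuous_gt c continuous_on_const slope_le_U D_le_slope; simp)+
      then show ?thesis using effective_Hamiltonian_le_iff[OF c] by simp
    qed
    then show ?thesis using NH c by (simp add: e.admissible_level_def critical_level_effective)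
  qed
  from e.representation[OF K this]
  obtain Ce where Ce: "Ce \<ge> 0 \<and> (\<forall>\<epsilon> g u. \<epsilon> > 0 \<longrightarrow> bounded (range g) \<longrightarrow> K-lipschitz_on UNIV g \<longrightarrow>
     solves_Cauchy_problem (\<lambda>x. effective_Hamiltonian H) g u \<longrightarrow>
     near_Hopf_Lax (\<lambda>y. effective_Hamiltonian H) C1 g (Ce * \<epsilon>) u)" ..
  from representation[OF K adm]
  obtain Ch where Ch: "Ch \<ge> 0 \<and> (\<forall>\<epsilon> g u. \<epsilon> > 0 \<longrightarrow> bounded (range g) \<longrightarrow> K-lipschitz_on UNIV g \<longrightarrow>
     solves_Cauchy_problem (\<lambda>x. H (x / \<epsilon>)) g u \<longrightarrow> near_Hopf_Lax H C1 g (Ch * \<epsilon>) u)" ..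
  show ?thesis
  proof (rule exI[of _ Ch], intro allI impI)
    fix g :: "real \<Rightarrow> real" and u u' :: "real \<times> real \<Rightarrow> real" and \<epsilon> x t :: real
    assume g: "bounded (range g)" "K-lipschitz_on UNIV g"
      and u: "solves_Cauchy_problem (\<lambda>x. effective_Hamiltonian H) g u"
      and \<epsilon>: "\<epsilon> > 0" and u': "solves_Cauchy_problem (\<lambda>x. H (x / \<epsilon>)) g u'" and t: "0 \<le> t"
    have "\<bar>u' (x, t) - u (x, t)\<bar> \<le> Ch * \<epsilon> + d" if d: "d > 0" for d
    proof -
      \<comment> \<open>The effective Hamiltonian does not depend on \<open>x\<close>, so
        \<open>u\<close> solves the rescaled problem for every scale; a scale \<open>\<eta>\<close>
        small against \<open>d\<close> makes its own error negligible.\<close>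
      define \<eta> where "\<eta> = d / (Ce + 1)"
      have \<eta>: "\<eta> > 0" "Ce * \<eta> \<le> d" using d Ce[THEN conjunct1] by (auto simp: \<eta>_def field_simps)
      note h = Ch[THEN conjunct2, rule_format, OF \<epsilon> g u', unfolded near_Hopf_Lax_def, rule_format, OF t, of x]
      have "near_Hopf_Lax H C1 g (Ce * \<eta>) u"
        using Ce[THEN conjunct2, rule_format, OF \<eta>(1) g u] travel_cost_effective
        unfolding near_Hopf_Lax_def critical_level_effective by (simp cong: conj_cong imp_cong)
      note e = this[unfolded near_Hopf_Lax_def, rule_format, OF t, of x]
      \<comment> \<open>The minimiser \<open>y\<close> comes from the lower bound on
        \<open>u\<close>, the level \<open>c\<close> from the upper bound on \<open>u'\<close> at
        this \<open>y\<close>; the common terms cancel.\<close>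
      obtain y where y: "\<And>c. M < c \<Longrightarrow> c \<le> C1 \<Longrightarrow> g y + travel_cost H c (x - y) - c * t - Ce * \<eta> \<le> u (x, t)"
        using e by blast
      obtain c where "M < c" "c \<le> C1" "u' (x, t) \<le> g y + travel_cost H c (x - y) - c * t + Ch * \<epsilon>"
        using h by blast
      with y[of c] \<eta>(2) have 1: "u' (x, t) - u (x, t) \<le> Ch * \<epsilon> + d" by linarith
      obtain y where y: "\<And>c. M < c \<Longrightarrow> c \<le> C1 \<Longrightarrow> g y + travel_cost H c (x - y) - c * t - Ch * \<epsilon> \<le> u' (x, t)"
        using h by blast
      obtain c where "M < c" "c \<le> C1" "u (x, t) \<le> g y + travel_cost H c (x - y) - c * t + Ce * \<eta>"
        using e by blast
      with y[of c] \<eta>(2)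
      have "u (x, t) - u' (x, t) \<le> Ch * \<epsilon> + d" by linarith
      with 1 show ?thesis by linarith
    qed
    then show "\<bar>u' (x, t) - u (x, t)\<bar> \<le> Ch * \<epsilon>" by (rule field_le_epsilon)
  qed
qed

end

text \<open>Continuity provides the measurability without which the essential supremum would be
  infinite.\<close>

lemma Linf_norm_le:
  fixes f :: "'a::euclidean_space \<Rightarrow> real"
  assumes "continuous_on S f" "S \<in> sets lebesgue" "\<And>z. z \<in> S \<Longrightarrow> \<bar>f z\<bar> \<le> C"
  shows "Linf_norm S f \<le> ereal C"
proof -
  have "f \<in> borel_measurable (lebesgue_on S)"
    using assms by (intro continuous_imp_measurable_on_sets_lebesgue)
  then show ?thesis
    unfolding Linf_norm_def using assms(3) by (intro esssup_I AE_I2) auto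
qed

text \<open>The function \<open>C\<close> is chosen after \<open>H\<close> and before the datum,
  which it sees only through the norm of \<open>deriv g\<close>; this expresses the claimed
  dependence of the constant.\<close>

theorem theorem1p3:
  fixes H :: "real \<Rightarrow> real \<Rightarrow> real"
  assumes continuous: "continuous_on UNIV (\<lambda>(y, p). H y p)"
    and periodic: "\<And>p. periodic_fun_simple' (\<lambda>y. H y p)"
    and coercive: "\<And>M. \<forall>\<^sub>F p in at_infinity. \<forall>y. M \<le> H y p"
    and convex: "\<And>y. convex_on UNIV (\<lambda>p. H y p)"
  shows "\<exists>C :: ereal \<Rightarrow> real.
    \<forall>(g :: real \<Rightarrow> real) (u :: real \<times> real \<Rightarrow> real).
      bounded (range g) \<longrightarrow> (\<exists>L. L-lipschitz_on UNIV g) \<longrightarrow>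
      solves_Cauchy_problem (\<lambda>x. effective_Hamiltonian H) g u \<longrightarrow>
      (\<forall>(\<epsilon> :: real) (u\<epsilon> :: real \<times> real \<Rightarrow> real).
         \<epsilon> > 0 \<longrightarrow> solves_Cauchy_problem (\<lambda>x. H (x / \<epsilon>)) g u\<epsilon> \<longrightarrow>
         Linf_norm (UNIV \<times> {0..}) (\<lambda>z. u\<epsilon> z - u z)
           \<le> ereal (C (Linf_norm UNIV (deriv g)) * \<epsilon>))"
proof -
  interpret convex_Hamiltonian H
  proof
    show "\<exists>R. \<forall>y p. R \<le> \<bar>p\<bar> \<longrightarrow> N \<le> H y p" for N
      using coercive[of N] by (auto simp: eventually_at_infinity)
  qed (use continuous periodic convex in \<open>auto simp: periodic_fun_simple'_def\<close>)
  \<comment> \<open>The rate theorem gives a constant for each \<open>K\<close> separately; choice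
    turns these into a function of \<open>K\<close>.\<close>
  obtain C where C: "\<And>K g u \<epsilon> u' x t. K \<ge> 0 \<Longrightarrow> bounded (range g) \<Longrightarrow> K-lipschitz_on UNIV g \<Longrightarrow>
     solves_Cauchy_problem (\<lambda>x. effective_Hamiltonian H) g u \<Longrightarrow> \<epsilon> > 0 \<Longrightarrow>
     solves_Cauchy_problem (\<lambda>x. H (x / \<epsilon>)) g u' \<Longrightarrow> 0 \<le> t \<Longrightarrow> \<bar>u' (x, t) - u (x, t)\<bar> \<le> C K * \<epsilon>"
  proof -
    have "\<forall>K. \<exists>C. K \<ge> 0 \<longrightarrow> (\<forall>g u \<epsilon> u'. bounded (range g) \<longrightarrow> K-lipschitz_on UNIV g \<longrightarrow>
       solves_Cauchy_problem (\<lambda>x. effective_Hamiltonian H) g u \<longrightarrow> \<epsilon> > 0 \<longrightarrow>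
       solves_Cauchy_problem (\<lambda>x. H (x / \<epsilon>)) g u' \<longrightarrow>
       (\<forall>x t. 0 \<le> t \<longrightarrow> \<bar>u' (x, t) - u (x, t)\<bar> \<le> C * \<epsilon>))"
      using homogenization_rate by blast
    from choice[OF this] show ?thesis using that by blast
  qed
  show ?thesis
  proof (intro exI[of _ "\<lambda>m. C (real_of_ereal m)"] allI impI)
    fix g :: "real \<Rightarrow> real" and u u\<epsilon> :: "real \<times> real \<Rightarrow> real" and \<epsilon> :: real
    assume g: "bounded (range g)" "\<exists>L. L-lipschitz_on UNIV g"
      and u: "solves_Cauchy_problem (\<lambda>x. effective_Hamiltonian H) g u"
      and \<epsilon>: "\<epsilon> > 0" and u\<epsilon>: "solves_Cauchy_problem (\<lambda>x. H (x / \<epsilon>)) g u\<epsilon>"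
    obtain m where m: "m \<ge> 0" "Linf_norm UNIV (deriv g) = ereal m" "m-lipschitz_on UNIV g"
      using g(2) Linf_norm_deriv_lipschitz by blast
    have cont: "continuous_on (UNIV \<times> {0..}) u" "continuous_on (UNIV \<times> {0..}) u\<epsilon>"
      using u u\<epsilon> by (auto simp: solves_Cauchy_problem_def intro: lipschitz_on_continuous_on)
    have "closed (UNIV \<times> {0..} :: (real \<times> real) set)" by (intro closed_Times) auto
    then have sets: "(UNIV \<times> {0..} :: (real \<times> real) set) \<in> sets lebesgue" by (simp add: borel_closed)
    show "Linf_norm (UNIV \<times> {0..}) (\<lambda>z. u\<epsilon> z - u z)
           \<le> ereal (C (real_of_ereal (Linf_norm UNIV (deriv g))) * \<epsilon>)"
    proof (rule Linf_norm_le[OF _ sets])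
      show "continuous_on (UNIV \<times> {0..}) (\<lambda>z. u\<epsilon> z - u z)" using cont by (intro continuous_on_diff)
      fix z :: "real \<times> real" assume "z \<in> UNIV \<times> {0..}"
      then obtain x t where "z = (x, t)" "0 \<le> t" by (cases z) auto
      then show "\<bar>u\<epsilon> z - u z\<bar> \<le> C (real_of_ereal (Linf_norm UNIV (deriv g))) * \<epsilon>"
        using C[OF m(1) g(1) m(3) u \<epsilon> u\<epsilon>] by (simp add: m(2))
    qed
  qed
qed

end
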